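(* Let $t\ge 0$ and let $w_t$ be the uniform measure on $\Gamma_t$, which means that $w_t(\Gamma_t(0))=1$ and that the restriction of $w_t$ to $\Gamma_t(\mathbf{n})$ is the $2|\mathbf{n}|$-dimensional Lebesgue measure on $\Gamma_t(\mathbf{n})$. Then the total mass is $$\int w_t=Z(t)=\exp(2t^2),$$ and $\mu_t=Z(t)^{-1}w_t$ is a probability measure on $\Gamma_t$. If the height lines evolve under the RSK dynamics, then $\mu_t$ is the joint distribution of $\{h_\ell(x,t),\ x\in\mathbb{R},\ \ell\in\mathbb{N}_-\}$ under the step map $S$.
   Context: $\mathbb{N}_-=\{0,-1,-2,\dots\}$. **Line configurations.** $\Lambda_t$ is the set of all families $(h_\ell)_{\ell\in\mathbb{N}_-}$ of functions $h_\ell(\cdot,t):\mathbb{R}\to\mathbb{Z}$ (height lines) which are piecewise constant with jumps of size $\pm1$ (up-steps: $+1$, down-steps: $-1$, read from left to right), with finite total number of steps, such that $h_\ell(x,t)<h_{\ell+1}(x,t)$ for all $x$ and all $\ell\leq -1$, $h_\ell(x,t)=\ell$ for $|x|\ge t$, and $h_\ell(x,t)-\lim_{\epsilon\searrow0}h_\ell(x\pm\epsilon,t)\in\{0,1\}$ (upper semicontinuity). In particular, if an up-step and a down-step of the same line sit at the same location, they represent a nucleation (a point where the line is higher by one), not a collision. **Steps.** Let $n_\ell$ be the number of up-steps (equal to the number of down-steps) of line $\ell$, $\mathbf{n}=(n_0,n_{-1},\dots)$, $|\mathbf{n}|=\sum_{\ell\le0}n_\ell<\infty$. Denote by $-t<y^{\ell,+}_1<\dots<y^{\ell,+}_{n_\ell}<t$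 the positions of the up-steps and by $-t<y^{\ell,-}_1<\dots<y^{\ell,-}_{n_\ell}<t$ the positions of the down-steps of line $\ell$. $\Gamma_t(\mathbf{n})\subset[-t,t]^{2|\mathbf{n}|}$ is the set of all step configurations $\big((y_j^{\ell,+},y_j^{\ell,-})_{1\le j\le n_\ell}\big)_{\ell\le0}$ arising from line configurations in $\Lambda_t$ with step numbers $\mathbf{n}$; $\Gamma_t(0)$ is a single point; $\Gamma_t=\bigcup_{|\mathbf{n}|<\infty}\Gamma_t(\mathbf{n})$. The step map $S:\Lambda_t\to\Gamma_t$ sends a line configuration to its step configuration; it is invertible. **RSK dynamics.** Initially $h_\ell(x,0)=\ell$ for all $x$ and $\ell\in\mathbb{N}_-$. In every line up-steps move with velocity $-1$, down-steps with velocity $+1$, and an up-step and a down-step of the same line which collide disappear. Nucleations (an increase of the line by $1$ at a single point, creating an up-step/down-step pair there) occur as follows. In the top line $h_0$, nucleations occur at the points $(x',t')$ of a Poisson point process of intensity $2$ in the space-time region $\{|x'|<t'\}$. In line $\ell-1$, $\ell\in\mathbb{N}_-$, a nucleation occurs at $(x,t)$ exactly when in line $\ell$ an up-step and a down-step annihilate at position $x$ at time $t$. At each time $t$ this produces an element of $\Lambda_t$ with probability one. *)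

theory Defs
  imports "HOL-Probability.Probability"
begin

text \<open>
  A family of height lines is a function \<open>h\<close> of \<open>k :: nat\<close> and \<open>x :: real\<close>, where \<open>h k\<close> is the
  line with index \<open>\<ell> = -k\<close>. Thus \<open>h 0\<close> is the top line and \<open>h (Suc k)\<close> the line directly below
  \<open>h k\<close>.
\<close>

type_synonym line_config = "nat \<Rightarrow> real \<Rightarrow> int"

definition piecewise_const :: "(real \<Rightarrow> int) \<Rightarrow> bool" where
  "piecewise_const f \<longleftrightarrow>
     (\<exists>F. finite F \<and> (\<forall>a b. a \<le> b \<and> {a..b} \<inter> F = {} \<longrightarrow> f a = f b))"

text \<open>
  The second condition is upper semicontinuity with unit steps. It forces the jump between the two
  one-sided limits at a point to be \<open>1\<close> (up-step only), \<open>-1\<close> (down-step only) or \<open>0\<close>; in the last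
  case either there is no step, or the point is higher by one than both sides (a nucleation).
\<close>

definition height_line :: "(real \<Rightarrow> int) \<Rightarrow> bool" where
  "height_line f \<longleftrightarrow> piecewise_const f \<and>
     (\<forall>x. f x - Lim (at_left x) f \<in> {0, 1} \<and> f x - Lim (at_right x) f \<in> {0, 1})"

definition ups :: "(real \<Rightarrow> int) \<Rightarrow> real set" where
  "ups f = {x. f x - Lim (at_left x) f = 1}"

definition downs :: "(real \<Rightarrow> int) \<Rightarrow> real set" where
  "downs f = {x. f x - Lim (at_right x) f = 1}"

definition Lambda :: "real \<Rightarrow> line_config set" where
  "Lambda t = {h. (\<forall>k. height_line (h k)) \<and>
                  finite {(k, x). x \<in> ups (h k) \<union> downs (h k)} \<and>
                  (\<forall>k x. h (Suc k) x < h k x) \<and>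
                  (\<forall>k x. \<bar>x\<bar> \<ge> t \<longrightarrow> h k x = - int k)}"

text \<open>
  A step configuration is a pair \<open>(n, y)\<close>: \<open>n k\<close> is the number of up-steps of line \<open>k\<close>, and
  \<open>y (k, Up, j)\<close>, \<open>y (k, Down, j)\<close> for \<open>j < n k\<close> are the positions of its up-steps and down-steps in
  increasing order (counted from \<open>j = 0\<close>). So for fixed \<open>n\<close> the positions \<open>y\<close> form a point of the
  \<open>2\<bar>n\<bar>\<close>-dimensional space of extensional functions on \<open>step_index n\<close>, which consists of the single
  point \<open>\<lambda>_. undefined\<close> if \<open>n = 0\<close>.
\<close>

datatype step_kind = Up | Down

type_synonym step_index = "nat \<times> step_kind \<times> nat"

type_synonym step_config = "(nat \<Rightarrow> nat) \<times> (step_index \<Rightarrow> real)"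

definition step_index :: "(nat \<Rightarrow> nat) \<Rightarrow> step_index set" where
  "step_index n = {(k, s, j). j < n k}"

definition steps :: "step_kind \<Rightarrow> (real \<Rightarrow> int) \<Rightarrow> real set" where
  "steps s f = (case s of Up \<Rightarrow> ups f | Down \<Rightarrow> downs f)"

definition step_map :: "line_config \<Rightarrow> step_config" where
  "step_map h =
     (let n = (\<lambda>k. card (ups (h k)))
      in (n, \<lambda>(k, s, j) \<in> step_index n. sorted_list_of_set (steps s (h k)) ! j))"

definition Gamma :: "real \<Rightarrow> step_config set" where
  "Gamma t = step_map ` Lambda t"

definition slice :: "(nat \<Rightarrow> nat) \<Rightarrow> step_config set \<Rightarrow> (step_index \<Rightarrow> real) set" where
  "slice n A = {y. (n, y) \<in> A}"

definition step_lebesgue :: "(nat \<Rightarrow> nat) \<Rightarrow> (step_index \<Rightarrow> real) measure" where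
  "step_lebesgue n = PiM (step_index n) (\<lambda>_. lborel)"

text \<open>
  \<open>Gamma t\<close> is the disjoint union of its slices \<open>\<Gamma>\<^sub>t(n)\<close> over the finitely supported \<open>n\<close>.
  Its measurable sets are those all of whose slices are Borel, and \<open>w t\<close> adds up the Lebesgue
  measures of the slices. For \<open>n = 0\<close> the empty product measure is the unit point mass, so the
  slice of \<open>n = 0\<close> has mass \<open>1\<close>.
\<close>

definition w :: "real \<Rightarrow> step_config measure" where
  "w t = measure_of (Gamma t)
           {A. A \<subseteq> Gamma t \<and> (\<forall>n. finite {k. n k \<noteq> 0} \<longrightarrow> slice n A \<in> sets (step_lebesgue n))}
           (\<lambda>A. \<integral>\<^sup>+n. emeasure (step_lebesgue n) (slice n A)
                  \<partial>count_space {n. finite {k. n k \<noteq> 0}})"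

definition Z :: "real \<Rightarrow> ennreal" where
  "Z t = emeasure (w t) (space (w t))"

definition mu :: "real \<Rightarrow> step_config measure" where
  "mu t = scale_measure (inverse (Z t)) (w t)"

text \<open>
  A Poisson point process with diffuse intensity measure \<open>L\<close>, as a random set of points. The Poisson
  probabilities are written out because the library's \<open>poisson_pmf\<close> excludes the rate \<open>0\<close>.
  The finiteness clause is needed since \<open>card\<close> is \<open>0\<close> on infinite sets.
\<close>

definition poisson_point_process ::
    "'a measure \<Rightarrow> 'b measure \<Rightarrow> ('a \<Rightarrow> 'b set) \<Rightarrow> bool" where
  "poisson_point_process M L N \<longleftrightarrow>
     (\<forall>A \<in> sets L. emeasure L A < \<infinity> \<longrightarrow>
        (AE \<omega> in M. finite (N \<omega> \<inter> A)) \<and>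
        (\<lambda>\<omega>. card (N \<omega> \<inter> A)) \<in> measurable M (count_space UNIV) \<and>
        (\<forall>m. measure M {\<omega> \<in> space M. card (N \<omega> \<inter> A) = m} =
               measure L A ^ m / fact m * exp (- measure L A))) \<and>
     (\<forall>(I :: nat set) A.
        finite I \<and> (\<forall>i\<in>I. A i \<in> sets L \<and> emeasure L (A i) < \<infinity>) \<and> disjoint_family_on A I \<longrightarrow>
        prob_space.indep_vars M (\<lambda>_. count_space UNIV) (\<lambda>i \<omega>. card (N \<omega> \<inter> A i)) I)"

text \<open>
  Space-time points are pairs \<open>(x, s)\<close> of a position and a time. Points outside the cone have
  intensity \<open>0\<close>, hence almost surely do not occur.
\<close>

definition nucleation_intensity :: "(real \<times> real) measure" where
  "nucleation_intensity = density lborel (\<lambda>(x, s). if \<bar>x\<bar> < s then 2 else 0)"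

text \<open>
  Here \<open>g s x\<close> is the height of a single line at time \<open>s\<close> and position \<open>x\<close>. An up-step (velocity
  \<open>-1\<close>) arrives at \<open>(x, s)\<close> if it was at \<open>x + e\<close> at time \<open>s - e\<close> just before, for all small \<open>e > 0\<close>;
  similarly for a down-step (velocity \<open>+1\<close>).
\<close>

definition up_arrives :: "(real \<Rightarrow> real \<Rightarrow> int) \<Rightarrow> real \<Rightarrow> real \<Rightarrow> bool" where
  "up_arrives g x s \<longleftrightarrow> (\<forall>\<^sub>F e in at_right 0. x + e \<in> ups (g (s - e)))"

definition down_arrives :: "(real \<Rightarrow> real \<Rightarrow> int) \<Rightarrow> real \<Rightarrow> real \<Rightarrow> bool" where
  "down_arrives g x s \<longleftrightarrow> (\<forall>\<^sub>F e in at_right 0. x - e \<in> downs (g (s - e)))"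

definition annihilations :: "(real \<Rightarrow> real \<Rightarrow> int) \<Rightarrow> (real \<times> real) set" where
  "annihilations g = {(x, s). s > 0 \<and> up_arrives g x s \<and> down_arrives g x s}"

text \<open>
  The evolution, for times \<open>s \<ge> 0\<close>, of a line that starts flat at height \<open>l\<close> and has the set \<open>N\<close> of
  nucleation points. The third conjunct says that a step present at time \<open>s\<close> moves on with its
  velocity right after \<open>s\<close>, and that no step appears right after \<open>s\<close> which is not there at time \<open>s\<close>.
  The last conjunct says which steps are present at time \<open>s > 0\<close>: those nucleated at time \<open>s\<close>, and
  those which arrive without meeting a step of the opposite kind. The steps determine the line up to
  an additive constant, which is fixed by requiring that the far left of the line stays at \<open>l\<close>.
\<close>

definition line_evolution ::
    "int \<Rightarrow> (real \<times> real) set \<Rightarrow> (real \<Rightarrow> real \<Rightarrow> int) \<Rightarrow> bool" where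
  "line_evolution l N g \<longleftrightarrow>
     (\<forall>x. g 0 x = l) \<and>
     (\<forall>s\<ge>0. height_line (g s) \<and> (\<forall>\<^sub>F x in at_bot. g s x = l)) \<and>
     (\<forall>s\<ge>0. \<forall>x.
        (x \<in> ups (g s) \<longleftrightarrow> (\<forall>\<^sub>F e in at_right 0. x - e \<in> ups (g (s + e)))) \<and>
        (x \<in> downs (g s) \<longleftrightarrow> (\<forall>\<^sub>F e in at_right 0. x + e \<in> downs (g (s + e))))) \<and>
     (\<forall>s>0. \<forall>x.
        (x \<in> ups (g s) \<longleftrightarrow> (x, s) \<in> N \<or> up_arrives g x s \<and> \<not> down_arrives g x s) \<and>
        (x \<in> downs (g s) \<longleftrightarrow> (x, s) \<in> N \<or> down_arrives g x s \<and> \<not> up_arrives g x s))"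

text \<open>
  In \<open>h s k x\<close> the time \<open>s\<close> comes first, so that \<open>h s\<close> is the family of lines at time \<open>s\<close>. The set
  \<open>N\<close> consists of the nucleation points of the top line.
\<close>

definition rsk_evolution :: "(real \<times> real) set \<Rightarrow> (real \<Rightarrow> line_config) \<Rightarrow> bool" where
  "rsk_evolution N h \<longleftrightarrow>
     line_evolution 0 N (\<lambda>s. h s 0) \<and>
     (\<forall>k. line_evolution (- int (Suc k)) (annihilations (\<lambda>s. h s k)) (\<lambda>s. h s (Suc k)))"

end

theory Submission
  imports Defs "HOL-Combinatorics.Permutations"
begin

text \<open>
  In the coordinates \<open>u = s + x\<close>, \<open>v = s - x\<close> up-steps and down-steps move along the two axes, and the
  height of a line at \<open>(u, v)\<close> is, up to its additive constant, the length of a longest increasing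
  chain of its nucleation points in \<open>{..u} \<times> {..v}\<close>; the annihilation points (the shadow, in Viennot's
  terms) are the nucleation points of the line below. Recording for every step only the line which it
  belongs to turns each crossing into an invertible local rule, as in the Robinson--Schensted--Knuth
  correspondence. Hence a step configuration at time \<open>t\<close> arises from exactly one finite point set, and
  the coordinates of these points are \<open>t + y\<close> for the up-steps and \<open>t - y\<close> for the down-steps \<open>y\<close>,
  matched by some bijection.

  If the steps range over pairwise disjoint sets which are separated from each other, the bijection
  does not depend on their positions, and the event that the configuration lies in such a box says
  that there is exactly one point in each of \<open>|n|\<close> disjoint rectangles and no other point. For the
  Poisson process this has probability \<open>exp (-2 t\<^sup>2)\<close> times the volume of the box, and almost every
  configuration lies in such a box with rational end points. The total mass follows in the same way
  from \<open>m\<close> independent uniform points in place of the Poisson process: the configurations with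
  \<open>|n| = m\<close> have mass \<open>(2 t\<^sup>2)^m / m!\<close>.
\<close>

section \<open>Longest increasing chains and shadows\<close>

text \<open>A Poisson process is given through its counts in Borel sets, so neither the
  configuration as a function of the sample point nor the event that two points share a light ray is
  measurable for free. Events are therefore rewritten as conditions on counts in fixed rectangles,
  and genericity follows from a union bound over thin strips. Since \<open>du dv = 2 dx ds\<close>,
  intensity 2 in space-time is intensity 1 in light-cone coordinates, and \<open>2 t^2\<close> is
  the area of the triangle \<open>u, v > 0\<close>, \<open>u + v \<le> 2 t\<close> of all points
  that can act up to time \<open>t\<close>. The total mass is taken from uniform points because
  these live on a product measure, while a Poisson process is only ever assumed. Once the mass is
  known, almost sure regularity of the Poisson configuration is a consequence: the regular part of
  its law already has probability 1. The dynamics is described by one-sided limits only; that it has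
  a single solution is shown by descent along the finitely many times at which two light rays from
  nucleations cross.\<close>

definition up_chain :: "(real \<times> real) set \<Rightarrow> bool" where
  "up_chain C \<longleftrightarrow> (\<forall>p\<in>C. \<forall>q\<in>C. p = q \<or> fst p < fst q \<and> snd p < snd q \<or> fst q < fst p \<and> snd q < snd p)"

definition len :: "(real \<times> real) set \<Rightarrow> nat" where
  "len X = Max (card ` {C. C \<subseteq> X \<and> up_chain C})"

lemma up_chain_empty [simp]: "up_chain {}"
  by (simp add: up_chain_def)

lemma up_chain_subset: "up_chain C \<Longrightarrow> C' \<subseteq> C \<Longrightarrow> up_chain C'"
  unfolding up_chain_def by blast

lemma len_ge:
  assumes "finite X" "C \<subseteq> X" "up_chain C"
  shows "card C \<le> len X"
  unfolding len_def using assms by (intro Max_ge) auto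

lemma len_attained:
  assumes "finite X"
  obtains C where "C \<subseteq> X" "up_chain C" "card C = len X"
proof -
  have "len X \<in> card ` {C. C \<subseteq> X \<and> up_chain C}"
    unfolding len_def using assms by (intro Max_in) (auto intro: exI[of _ "{}"])
  then show ?thesis using that by auto
qed

lemma len_mono: "X \<subseteq> Y \<Longrightarrow> finite Y \<Longrightarrow> len X \<le> len Y"
  by (metis finite_subset len_attained len_ge subset_trans)

lemma len_empty [simp]: "len {} = 0"
  using len_attained[of "{}"] by fastforce

text \<open>Distinct points of a chain differ in both coordinates, so a chain has at most one point
  in a set whose points pairwise share a coordinate.\<close>

lemma len_le_Suc:
  assumes fin: "finite Y" and one: "\<And>p q. p \<in> Y - X \<Longrightarrow> q \<in> Y - X \<Longrightarrow> fst p = fst q \<or> snd p = snd q"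
    and "X \<subseteq> Y"
  shows "len Y \<le> Suc (len X)"
proof -
  obtain C where C: "C \<subseteq> Y" "up_chain C" "card C = len Y" using len_attained fin by blast
  have finC: "finite C" using C(1) fin finite_subset by blast
  have eq: "p = q" if "p \<in> C - X" "q \<in> C - X" for p q
    using that one[of p q] C unfolding up_chain_def by fastforce
  have "card (C - X) \<le> 1"
    using eq finC by (metis Diff_iff card_le_Suc0_iff_eq finite_Diff One_nat_def)
  moreover have "card (C \<inter> X) \<le> len X"
    using assms C by (intro len_ge) (auto intro: up_chain_subset finite_subset)
  moreover have "card C = card (C \<inter> X) + card (C - X)"
    using finC by (metis card_Int_Diff)
  ultimately show ?thesis using C(3) by linarith
qed

lemma len_top:
  assumes "finite Y" "p \<in> Y" "X \<subseteq> Y" "\<And>q. q \<in> X \<Longrightarrow> fst q < fst p \<and> snd q < snd p"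
  shows "Suc (len X) \<le> len Y"
proof -
  have finX: "finite X" using assms finite_subset by blast
  obtain C where C: "C \<subseteq> X" "up_chain C" "card C = len X" using len_attained finX by blast
  have "p \<notin> C" using C(1) assms(4)[of p] by auto
  moreover have "up_chain (insert p C)"
  proof -
    have "fst q < fst p \<and> snd q < snd p" if "q \<in> C" for q using that C(1) assms(4) by blast
    then show ?thesis using C(2) unfolding up_chain_def ball_simps by blast
  qed
  moreover have "insert p C \<subseteq> Y" using C assms by auto
  ultimately show ?thesis
    using len_ge[OF assms(1), of "insert p C"] C(3) finite_subset[OF C(1) finX] by simp
qed

text \<open>Being a chain depends only on the order of the coordinates. This later allows the steps
  to be moved inside a box.\<close>

lemma len_image:
  assumes f: "strict_mono_on (fst ` X) \<phi>" and g: "strict_mono_on (snd ` X) \<psi>" and fin: "finite X"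
  shows "len (map_prod \<phi> \<psi> ` X) = len X"
proof -
  let ?f = "map_prod \<phi> \<psi>"
  have iff: "fst (?f p) < fst (?f q) \<longleftrightarrow> fst p < fst q" "snd (?f p) < snd (?f q) \<longleftrightarrow> snd p < snd q"
    if "p \<in> X" "q \<in> X" for p q
    using f g that by (auto simp: strict_mono_on_less)
  have inj: "inj_on ?f X"
    by (intro inj_onI) (metis (no_types, lifting) iff linorder_neq_iff prod_eqI order_less_irrefl)
  have ch: "up_chain (?f ` C) \<longleftrightarrow> up_chain C" if "C \<subseteq> X" for C
  proof -
    have "?f p = ?f q \<longleftrightarrow> p = q" if "p \<in> C" "q \<in> C" for p q
      using that \<open>C \<subseteq> X\<close> inj by (meson inj_onD subsetD)
    moreover have "fst (?f p) < fst (?f q) \<longleftrightarrow> fst p < fst q" "snd (?f p) < snd (?f q) \<longleftrightarrow> snd p < snd q"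
      if "p \<in> C" "q \<in> C" for p q using that \<open>C \<subseteq> X\<close> iff by blast+
    ultimately show ?thesis unfolding up_chain_def ball_simps by (simp cong: ball_cong)
  qed
  have "card ` {C. C \<subseteq> ?f ` X \<and> up_chain C} = card ` (\<lambda>C. ?f ` C) ` {C. C \<subseteq> X \<and> up_chain C}"
    by (intro arg_cong[of _ _ "\<lambda>Y. card ` Y"]) (auto simp: ch image_iff subset_image_iff Bex_def)
  also have "\<dots> = card ` {C. C \<subseteq> X \<and> up_chain C}"
    unfolding image_image using inj by (intro image_cong refl card_image) (auto intro: inj_on_subset)
  finally show ?thesis unfolding len_def by simp
qed

text \<open>The reflection \<open>(u, v) \<mapsto> (v, u)\<close> exchanges up-steps and down-steps,
  so facts about down-steps can be drawn from those about up-steps.\<close>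

lemma len_swap: "len (prod.swap ` X) = len X"
proof -
  have ch: "up_chain (prod.swap ` C) \<longleftrightarrow> up_chain C" for C
    unfolding up_chain_def ball_simps by (auto 4 4)
  have "card ` {C. C \<subseteq> prod.swap ` X \<and> up_chain C} = card ` (\<lambda>C. prod.swap ` C) ` {C. C \<subseteq> X \<and> up_chain C}"
    by (intro arg_cong[of _ _ "\<lambda>Y. card ` Y"]) (auto simp: ch image_iff subset_image_iff Bex_def)
  also have "\<dots> = card ` {C. C \<subseteq> X \<and> up_chain C}"
    unfolding image_image by (intro image_cong refl card_image) (auto intro: inj_on_subset)
  finally show ?thesis unfolding len_def by simp
qed

section \<open>The height around a point and its shadow\<close>

text \<open>The height changes across the four edges that meet at \<open>(u, v)\<close>:
  \<open>up_at\<close> and \<open>down_at\<close> are the steps leaving the point,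
  \<open>up_before\<close> and \<open>down_before\<close> those entering it; the strict bounds play
  the role of limits from below.\<close>

definition up_at :: "(real \<times> real) set \<Rightarrow> real \<Rightarrow> real \<Rightarrow> bool" where
  "up_at P u v \<longleftrightarrow> len (P \<inter> {..<u} \<times> {..v}) < len (P \<inter> {..u} \<times> {..v})"
definition down_at :: "(real \<times> real) set \<Rightarrow> real \<Rightarrow> real \<Rightarrow> bool" where
  "down_at P u v \<longleftrightarrow> len (P \<inter> {..u} \<times> {..<v}) < len (P \<inter> {..u} \<times> {..v})"
definition up_before :: "(real \<times> real) set \<Rightarrow> real \<Rightarrow> real \<Rightarrow> bool" where
  "up_before P u v \<longleftrightarrow> len (P \<inter> {..<u} \<times> {..<v}) < len (P \<inter> {..u} \<times> {..<v})"
definition down_before :: "(real \<times> real) set \<Rightarrow> real \<Rightarrow> real \<Rightarrow> bool" where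
  "down_before P u v \<longleftrightarrow> len (P \<inter> {..<u} \<times> {..<v}) < len (P \<inter> {..<u} \<times> {..v})"

definition shadow :: "(real \<times> real) set \<Rightarrow> (real \<times> real) set" where
  "shadow P = {(u, v). up_before P u v \<and> down_before P u v}"

text \<open>Local finiteness keeps \<open>len\<close> of a quadrant meaningful; injectivity says
  that each light ray carries at most one nucleation, so that a step is identified by its
  ray.\<close>

definition generic :: "(real \<times> real) set \<Rightarrow> bool" where
  "generic P \<longleftrightarrow> (\<forall>a b. finite (P \<inter> {..a} \<times> {..b})) \<and> inj_on fst P \<and> inj_on snd P"

lemma swap_iff: "(a, b) \<in> prod.swap ` X \<longleftrightarrow> (b, a) \<in> X"
  by force

lemma swap_rect: "prod.swap ` P \<inter> S \<times> T = prod.swap ` (P \<inter> T \<times> S)"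
  by auto

lemma up_at_swap: "up_at (prod.swap ` P) u v \<longleftrightarrow> down_at P v u"
  unfolding up_at_def down_at_def swap_rect len_swap ..
lemma up_before_swap: "up_before (prod.swap ` P) u v \<longleftrightarrow> down_before P v u"
  unfolding up_before_def down_before_def swap_rect len_swap ..
lemma down_before_swap: "down_before (prod.swap ` P) u v \<longleftrightarrow> up_before P v u"
  unfolding up_before_def down_before_def swap_rect len_swap ..
lemma shadow_swap: "shadow (prod.swap ` P) = prod.swap ` shadow P"
  unfolding shadow_def by (auto simp: up_before_swap down_before_swap image_iff)
lemma generic_swap: "generic P \<Longrightarrow> generic (prod.swap ` P)"
  unfolding generic_def swap_rect by (auto simp: inj_on_def)

context
  fixes P :: "(real \<times> real) set"
  assumes gen: "generic P"
begin

lemma finite_rect: "S \<subseteq> {..a} \<Longrightarrow> T \<subseteq> {..b} \<Longrightarrow> finite (P \<inter> S \<times> T)"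
  using gen unfolding generic_def by (meson Int_mono Sigma_mono finite_subset order_refl)

lemma finite_rects [simp]:
  "finite (P \<inter> {..u} \<times> {..v})" "finite (P \<inter> {..<u} \<times> {..v})"
  "finite (P \<inter> {..u} \<times> {..<v})" "finite (P \<inter> {..<u} \<times> {..<v})"
  by (rule finite_rect[of _ u _ v]; auto)+

lemma fst_unique: "(u, v) \<in> P \<Longrightarrow> (u, v') \<in> P \<Longrightarrow> v' = v"
  using gen unfolding generic_def inj_on_def by fastforce
lemma snd_unique: "(u, v) \<in> P \<Longrightarrow> (u', v) \<in> P \<Longrightarrow> u' = u"
  using gen unfolding generic_def inj_on_def by fastforce

lemma len_rect_mono: "S \<subseteq> S' \<Longrightarrow> T \<subseteq> T' \<Longrightarrow> S' \<subseteq> {..a} \<Longrightarrow> T' \<subseteq> {..b} \<Longrightarrow>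
    len (P \<inter> S \<times> T) \<le> len (P \<inter> S' \<times> T')"
  by (rule len_mono) (auto intro: finite_rect)

lemma len_at_le:
  "len (P \<inter> {..<u} \<times> {..v}) \<le> len (P \<inter> {..u} \<times> {..v})"
  "len (P \<inter> {..u} \<times> {..v}) \<le> Suc (len (P \<inter> {..<u} \<times> {..v}))"
  "len (P \<inter> {..u} \<times> {..<v}) \<le> len (P \<inter> {..u} \<times> {..v})"
  "len (P \<inter> {..u} \<times> {..v}) \<le> Suc (len (P \<inter> {..u} \<times> {..<v}))"
  "len (P \<inter> {..<u} \<times> {..<v}) \<le> len (P \<inter> {..u} \<times> {..<v})"
  "len (P \<inter> {..u} \<times> {..<v}) \<le> Suc (len (P \<inter> {..<u} \<times> {..<v}))"
  "len (P \<inter> {..<u} \<times> {..<v}) \<le> len (P \<inter> {..<u} \<times> {..v})"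
  "len (P \<inter> {..<u} \<times> {..v}) \<le> Suc (len (P \<inter> {..<u} \<times> {..<v}))"
  by (rule len_mono len_le_Suc; auto)+

text \<open>A point with first coordinate \<open>u\<close> and a different point with second
  coordinate \<open>v\<close> are never comparable inside the rectangle, and the corner itself is
  excluded; so a chain misses one of the two edges.\<close>

lemma len_local:
  assumes "(u, v) \<notin> P"
  shows "len (P \<inter> {..u} \<times> {..v}) = max (len (P \<inter> {..<u} \<times> {..v})) (len (P \<inter> {..u} \<times> {..<v}))"
proof (rule antisym)
  obtain C where C: "C \<subseteq> P \<inter> {..u} \<times> {..v}" "up_chain C" "card C = len (P \<inter> {..u} \<times> {..v})"
    by (rule len_attained[OF finite_rects(1)])
  have "C \<subseteq> P \<inter> {..<u} \<times> {..v} \<or> C \<subseteq> P \<inter> {..u} \<times> {..<v}"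
  proof (rule ccontr)
    assume "\<not> ?thesis"
    then obtain p q where "p \<in> C" "q \<in> C" "\<not> fst p < u" "\<not> snd q < v"
      using C(1) by (auto simp: subset_iff)
    moreover from this have "fst p = u" "snd q = v" "fst q \<le> u" "snd p \<le> v" using C(1) by fastforce+
    moreover have "p \<noteq> q"
      using calculation assms C(1) by (metis IntE prod.collapse subsetD)
    ultimately show False using C(2) unfolding up_chain_def by force
  qed
  then show "len (P \<inter> {..u} \<times> {..v}) \<le> max (len (P \<inter> {..<u} \<times> {..v})) (len (P \<inter> {..u} \<times> {..<v}))"
    using len_ge[OF finite_rects(2) _ C(2), of u v] len_ge[OF finite_rects(3) _ C(2), of u v] C(3) by auto
qed (use len_at_le[of u v] in auto)

text \<open>By genericity the point is alone on both of its rays, so the three smaller rectangles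
  contain the same points of \<open>P\<close>, and the point extends every chain in them.\<close>

lemma point_local:
  assumes "(u, v) \<in> P"
  shows "up_at P u v" "down_at P u v" "\<not> up_before P u v" "\<not> down_before P u v"
proof -
  have "P \<inter> {..u} \<times> {..<v} = P \<inter> {..<u} \<times> {..<v}" "P \<inter> {..<u} \<times> {..v} = P \<inter> {..<u} \<times> {..<v}"
    using assms by (auto simp: order_le_less dest: fst_unique[OF assms] snd_unique[OF assms])
  moreover have "Suc (len (P \<inter> {..<u} \<times> {..<v})) \<le> len (P \<inter> {..u} \<times> {..v})"
    using assms by (intro len_top[where p = "(u, v)"]) auto
  ultimately show "up_at P u v" "down_at P u v" "\<not> up_before P u v" "\<not> down_before P u v"
    unfolding up_at_def down_at_def up_before_def down_before_def by auto
qed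

text \<open>This is the collision rule in the last conjunct of \<open>line_evolution\<close>. Away
  from points the height is the maximum of its two neighbours by \<open>len_local\<close>, which
  lets a lone step pass and cancels two.\<close>

lemma up_at_iff: "up_at P u v \<longleftrightarrow> (u, v) \<in> P \<or> up_before P u v \<and> \<not> down_before P u v"
proof (cases "(u, v) \<in> P")
  case False
  show ?thesis using False len_local[OF False] len_at_le[of u v]
    unfolding up_at_def down_at_def up_before_def down_before_def by (simp add: max_def split: if_splits) linarith+
qed (simp add: point_local)

lemma down_at_iff: "down_at P u v \<longleftrightarrow> (u, v) \<in> P \<or> down_before P u v \<and> \<not> up_before P u v"
proof (cases "(u, v) \<in> P")
  case False
  show ?thesis using False len_local[OF False] len_at_le[of u v]
    unfolding up_at_def down_at_def up_before_def down_before_def by (simp add: max_def split: if_splits) linarith+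
qed (simp add: point_local)

lemma shadow_disjoint: "(u, v) \<in> shadow P \<Longrightarrow> (u, v) \<notin> P"
  using point_local unfolding shadow_def by blast

lemma up_before_point: "up_before P u v \<Longrightarrow> \<exists>v'<v. (u, v') \<in> P"
proof -
  assume "up_before P u v"
  then have "P \<inter> {..<u} \<times> {..<v} \<noteq> P \<inter> {..u} \<times> {..<v}" unfolding up_before_def by auto
  then show ?thesis by (auto simp: order_le_less)
qed

lemma up_at_point: "up_at P u v \<Longrightarrow> \<exists>v'\<le>v. (u, v') \<in> P"
  using up_before_point up_at_iff by (metis order.strict_implies_order order_refl)

end

lemma down_before_point: "generic P \<Longrightarrow> down_before P u v \<Longrightarrow> \<exists>u'<u. (u', v) \<in> P"
  using up_before_point[OF generic_swap, of P v u] by (force simp: up_before_swap)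
lemma down_at_point: "generic P \<Longrightarrow> down_at P u v \<Longrightarrow> \<exists>u'\<le>u. (u', v) \<in> P"
  using up_at_point[OF generic_swap, of P v u] by (force simp: up_at_swap)

text \<open>A longest chain that needs the edge \<open>u\<close> contains a point
  \<open>(u, v0)\<close>, which is its top. With no point on the ray above \<open>v\<close> this
  forces \<open>v0 \<le> v\<close>, so the whole chain already lies below \<open>v\<close>.\<close>

lemma not_up_at_mono:
  assumes gen: "generic P" and not: "\<not> up_at P u v" and "v \<le> v'"
    and no: "\<And>v''. v < v'' \<Longrightarrow> v'' \<le> v' \<Longrightarrow> (u, v'') \<notin> P"
  shows "\<not> up_at P u v'"
proof
  assume up: "up_at P u v'"
  obtain C where C: "C \<subseteq> P \<inter> {..u} \<times> {..v'}" "up_chain C" "card C = len (P \<inter> {..u} \<times> {..v'})"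
    by (rule len_attained[OF finite_rects(1)[OF gen]])
  have "\<not> C \<subseteq> P \<inter> {..<u} \<times> {..v'}"
    using up C(3) len_ge[OF finite_rects(2)[OF gen] _ C(2), of u v'] unfolding up_at_def by fastforce
  then obtain p where "p \<in> C" "p \<notin> P \<inter> {..<u} \<times> {..v'}" by blast
  moreover from this have "p \<in> P \<inter> {..u} \<times> {..v'}" using C(1) by blast
  ultimately have "(u, snd p) \<in> C" by (cases p) auto
  then obtain v0 where v0: "(u, v0) \<in> C" ..
  then have "(u, v0) \<in> P \<inter> {..u} \<times> {..v'}" using C(1) by blast
  then have "v0 \<le> v" using no[of v0] by (auto simp: not_less[symmetric])
  have "snd q \<le> v0" if "q \<in> C" for q
  proof -
    have "fst q \<le> u" using that C(1) by force
    then show ?thesis using that v0 C(2) unfolding up_chain_def by force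
  qed
  with C(1) \<open>v0 \<le> v\<close> have "C \<subseteq> P \<inter> {..u} \<times> {..v}"
    by (auto simp: subset_iff) (metis order_trans snd_conv)
  then have "len (P \<inter> {..u} \<times> {..v'}) \<le> len (P \<inter> {..u} \<times> {..v})"
    using len_ge[OF finite_rects(1)[OF gen] _ C(2), of u v] C(3) by simp
  also have "\<dots> \<le> len (P \<inter> {..<u} \<times> {..v})" using not unfolding up_at_def by simp
  also have "\<dots> \<le> len (P \<inter> {..<u} \<times> {..v'})"
    using \<open>v \<le> v'\<close> by (intro len_rect_mono[OF gen, of _ _ _ _ u v']) auto
  finally show False using up unfolding up_at_def by simp
qed

section \<open>Local finiteness and the life of a step\<close>

text \<open>Among the points that matter, no coordinate lies within \<open>d\<close> of
  \<open>u\<close> or \<open>v\<close> without being equal to it. One-sided limits at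
  \<open>(u, v)\<close> can then be read off at any single offset up to \<open>d\<close>.\<close>

definition gapped :: "(real \<times> real) set \<Rightarrow> real \<Rightarrow> real \<Rightarrow> real \<Rightarrow> bool" where
  "gapped P u v d \<longleftrightarrow> (\<forall>p\<in>P. fst p \<le> u + d \<and> snd p \<le> v + d \<longrightarrow>
     (fst p = u \<or> d < \<bar>fst p - u\<bar>) \<and> (snd p = v \<or> d < \<bar>snd p - v\<bar>))"

lemma gap:
  assumes gen: "generic P"
  obtains d where "d > 0" "gapped P u v d"
proof -
  let ?F = "P \<inter> {..u + 1} \<times> {..v + 1}"
  \<comment> \<open>The element 1 keeps the gap at most 1/2, so that only the finitely many points
    of \<open>?F\<close> can interfere.\<close>
  define D where "D = insert 1 ((\<lambda>p. \<bar>fst p - u\<bar>) ` {p\<in>?F. fst p \<noteq> u} \<union> (\<lambda>p. \<bar>snd p - v\<bar>) ` {p\<in>?F. snd p \<noteq> v})"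
  have fin: "finite D" 
    unfolding D_def using finite_rects(1)[OF gen, of "u + 1" "v + 1"]
    by (intro finite.insertI finite_UnI finite_imageI) (rule rev_finite_subset[of ?F]; blast)+
  have pos: "\<And>x. x \<in> D \<Longrightarrow> x > 0" unfolding D_def by auto
  have "Min D > 0" using pos fin Min_in[OF fin] unfolding D_def by blast
  moreover have "Min D \<le> 1" by (rule Min_le[OF fin]) (simp add: D_def)
  show thesis
  proof (rule that[of "Min D / 2"])
    show "Min D / 2 > 0" using \<open>Min D > 0\<close> by simp
    show "gapped P u v (Min D / 2)" unfolding gapped_def
    proof (intro ballI impI)
    fix p assume p: "p \<in> P" "fst p \<le> u + Min D / 2 \<and> snd p \<le> v + Min D / 2"
    then have "p \<in> ?F" using \<open>Min D \<le> 1\<close> by (cases p) auto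
    then have "fst p = u \<or> \<bar>fst p - u\<bar> \<in> D" "snd p = v \<or> \<bar>snd p - v\<bar> \<in> D"
      unfolding D_def by auto
    then show "(fst p = u \<or> Min D / 2 < \<bar>fst p - u\<bar>) \<and> (snd p = v \<or> Min D / 2 < \<bar>snd p - v\<bar>)"
      using Min_le[OF fin] \<open>Min D > 0\<close> by force
    qed
  qed
qed

lemma rect_gap:
  fixes P :: "(real \<times> real) set"
  assumes "gapped P u v d"
    and "u \<le> a" "a \<le> u + d" "u - d \<le> a'" "a' < u" "v \<le> b" "b \<le> v + d" "v - d \<le> b'" "b' < v"
  shows "P \<inter> {..a} \<times> {..b} = P \<inter> {..u} \<times> {..v}"
    and "P \<inter> {..a'} \<times> {..b} = P \<inter> {..<u} \<times> {..v}"
    and "P \<inter> {..a} \<times> {..b'} = P \<inter> {..u} \<times> {..<v}"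
    and "P \<inter> {..a'} \<times> {..b'} = P \<inter> {..<u} \<times> {..<v}"
    and "u < a \<Longrightarrow> P \<inter> {..<a} \<times> {..b} = P \<inter> {..u} \<times> {..v}"
    and "v < b \<Longrightarrow> P \<inter> {..a} \<times> {..<b} = P \<inter> {..u} \<times> {..v}"
    and "P \<inter> {..<u} \<times> {..b} = P \<inter> {..<u} \<times> {..v}"
    and "P \<inter> {..<u} \<times> {..b'} = P \<inter> {..<u} \<times> {..<v}"
    and "P \<inter> {..a} \<times> {..<v} = P \<inter> {..u} \<times> {..<v}"
    and "P \<inter> {..a'} \<times> {..<v} = P \<inter> {..<u} \<times> {..<v}"
proof -
  have *: "(x \<le> a \<longleftrightarrow> x \<le> u) \<and> (x \<le> a' \<longleftrightarrow> x < u) \<and> (u < a \<longrightarrow> (x < a \<longleftrightarrow> x \<le> u)) \<and>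
      (y \<le> b \<longleftrightarrow> y \<le> v) \<and> (y \<le> b' \<longleftrightarrow> y < v) \<and> (v < b \<longrightarrow> (y < b \<longleftrightarrow> y \<le> v))"
    if "(x, y) \<in> P" "x \<le> u + d" "y \<le> v + d" for x y
    using assms(1)[unfolded gapped_def, rule_format, OF that(1)] that assms(2-) by auto
  have le: "x \<le> u + d" if "x \<le> a \<or> x \<le> a' \<or> x < a \<or> x \<le> u \<or> x < u" for x using assms(2-) that by auto
  have le': "y \<le> v + d" if "y \<le> b \<or> y \<le> b' \<or> y < b \<or> y \<le> v \<or> y < v" for y using assms(2-) that by auto
  show "P \<inter> {..a} \<times> {..b} = P \<inter> {..u} \<times> {..v}"
    "P \<inter> {..a'} \<times> {..b} = P \<inter> {..<u} \<times> {..v}"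
    "P \<inter> {..a} \<times> {..b'} = P \<inter> {..u} \<times> {..<v}"
    "P \<inter> {..a'} \<times> {..b'} = P \<inter> {..<u} \<times> {..<v}"
    "u < a \<Longrightarrow> P \<inter> {..<a} \<times> {..b} = P \<inter> {..u} \<times> {..v}"
    "v < b \<Longrightarrow> P \<inter> {..a} \<times> {..<b} = P \<inter> {..u} \<times> {..v}"
    "P \<inter> {..<u} \<times> {..b} = P \<inter> {..<u} \<times> {..v}"
    "P \<inter> {..<u} \<times> {..b'} = P \<inter> {..<u} \<times> {..<v}"
    "P \<inter> {..a} \<times> {..<v} = P \<inter> {..u} \<times> {..<v}"
    "P \<inter> {..a'} \<times> {..<v} = P \<inter> {..<u} \<times> {..<v}"
    using * le le' by blast+
qed

lemma up_before_gap:
  assumes "gapped P u v d"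
    and "v - d \<le> v'" "v' < v"
  shows "up_at P u v' \<longleftrightarrow> up_before P u v"
proof -
  have "d > 0" using assms(2,3) by linarith
  then show ?thesis unfolding up_at_def up_before_def
    using rect_gap(3,8)[where a = u and a' = "u - d" and b = v and b' = v', OF assms(1)] assms(2,3) by simp
qed

text \<open>The two arriving steps cancel at a shadow point, and since the nucleation of the ray
  lies strictly earlier, no later one can restore the step.\<close>

lemma shadow_not_up_at:
  assumes gen: "generic P" and sh: "(u, v') \<in> shadow P" and "v' \<le> v"
  shows "\<not> up_at P u v"
proof (rule not_up_at_mono[OF gen _ \<open>v' \<le> v\<close>])
  have "up_before P u v'" "down_before P u v'" using sh unfolding shadow_def by auto
  then show "\<not> up_at P u v'" using up_at_iff[OF gen] shadow_disjoint[OF gen sh] by blast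
  obtain v0 where "v0 < v'" "(u, v0) \<in> P" using up_before_point[OF gen] \<open>up_before P u v'\<close> by blast
  then show "(u, v'') \<notin> P" if "v' < v''" for v'' using fst_unique[OF gen] that by force
qed

text \<open>A step runs along its ray from its nucleation to its annihilation. This replaces the
  global quantity \<open>len\<close> by membership in \<open>P\<close> and
  \<open>shadow P\<close>.\<close>

lemma up_at_shadow:
  assumes gen: "generic P"
  shows "up_at P u v \<longleftrightarrow> (\<exists>v'\<le>v. (u, v') \<in> P) \<and> (\<forall>v'\<le>v. (u, v') \<notin> shadow P)"
proof (intro iffI conjI)
  assume "(\<exists>v'\<le>v. (u, v') \<in> P) \<and> (\<forall>v'\<le>v. (u, v') \<notin> shadow P)"
  then obtain v0 where v0: "v0 \<le> v" "(u, v0) \<in> P" and no: "\<And>v'. v' \<le> v \<Longrightarrow> (u, v') \<notin> shadow P" by blast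
  \<comment> \<open>Along the ray the lengths can change only at second coordinates of points in the
    rectangle, so the step is followed through this finite set.\<close>
  define F where "F = snd ` (P \<inter> {..u} \<times> {..v})"
  have finF: "finite F" unfolding F_def using finite_rects(1)[OF gen] by simp
  have v0F: "v0 \<in> F" unfolding F_def using v0 by force
  have up: "up_at P u w" if "w \<in> F" "v0 \<le> w" for w
    using that
  proof (induction "card {x\<in>F. x < w}" arbitrary: w rule: less_induct)
    case less
    show ?case
    proof (cases "w = v0")
      case False
      then have "v0 \<in> {x\<in>F. x < w}" using less.prems v0F by auto
      then have ne: "{x\<in>F. x < w} \<noteq> {}" and fin: "finite {x\<in>F. x < w}" using finF by auto
      define w' where "w' = Max {x\<in>F. x < w}"
      have w': "w' \<in> F" "w' < w" using Max_in[OF fin ne] unfolding w'_def by auto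
      have "v0 \<le> w'" unfolding w'_def using \<open>v0 \<in> {x\<in>F. x < w}\<close> fin by simp
      have "{x\<in>F. x < w'} \<subset> {x\<in>F. x < w}" using w' by force
      then have "up_at P u w'" using less.hyps[OF psubset_card_mono[OF fin]] w' \<open>v0 \<le> w'\<close> by blast
      \<comment> \<open>Nothing happens between the consecutive coordinates \<open>w'\<close> and
        \<open>w\<close>, so the step present at \<open>w'\<close> is the one that arrives at
        \<open>w\<close>.\<close>
      have "y \<le> w'" if "(x, y) \<in> P" "x \<le> u" "y < w" for x y
      proof -
        have "w \<le> v" using less.prems unfolding F_def by auto
        then have "y \<in> F" unfolding F_def using that by force
        then show ?thesis unfolding w'_def using fin that by simp
      qed
      then have "P \<inter> {..u} \<times> {..<w} = P \<inter> {..u} \<times> {..w'}" "P \<inter> {..<u} \<times> {..<w} = P \<inter> {..<u} \<times> {..w'}"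
        using w' by force+
      then have "up_before P u w" using \<open>up_at P u w'\<close> unfolding up_at_def up_before_def by simp
      moreover have "w \<le> v" using less.prems(1) unfolding F_def by auto
      ultimately show ?thesis using up_at_iff[OF gen] no unfolding shadow_def by blast
    qed (use point_local[OF gen] v0 in auto)
  qed
  have ne: "F \<noteq> {}" using v0F by auto
  have "up_at P u (Max F)" using up Max_in[OF finF ne] Max_ge[OF finF v0F] by blast
  moreover have "y \<le> Max F" if "(x, y) \<in> P" "x \<le> u" "y \<le> v" for x y
    using that finF by (force simp: F_def intro!: Max_ge)
  then have "P \<inter> {..u} \<times> {..v} = P \<inter> {..u} \<times> {..Max F}" "P \<inter> {..<u} \<times> {..v} = P \<inter> {..<u} \<times> {..Max F}"
    using Max_in[OF finF ne] by (force simp: F_def)+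
  ultimately show "up_at P u v" unfolding up_at_def by simp
qed (use up_at_point[OF gen] shadow_not_up_at[OF gen] in auto)

lemma down_at_shadow:
  assumes "generic P"
  shows "down_at P u v \<longleftrightarrow> (\<exists>u'\<le>u. (u', v) \<in> P) \<and> (\<forall>u'\<le>u. (u', v) \<notin> shadow P)"
  using up_at_shadow[OF generic_swap[OF assms], of v u]
  by (simp add: up_at_swap shadow_swap swap_iff)

lemma up_before_shadow:
  assumes gen: "generic P"
  shows "up_before P u v \<longleftrightarrow> (\<exists>v'<v. (u, v') \<in> P) \<and> (\<forall>v'<v. (u, v') \<notin> shadow P)"
proof -
  obtain d where d: "d > 0" "gapped P u v d" using gap[OF gen] by blast
  have up: "up_at P u v' \<longleftrightarrow> up_before P u v" if "v - d \<le> v'" "v' < v" for v'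
    using up_before_gap[OF d(2) that] .
  show ?thesis
  proof
    assume before: "up_before P u v"
    then have "\<exists>v'<v. (u, v') \<in> P" by (rule up_before_point[OF gen])
    moreover have "(u, v') \<notin> shadow P" if "v' < v" for v'
    proof -
      have "up_at P u (max v' (v - d))" using up[of "max v' (v - d)"] before that d(1) by auto
      then show ?thesis using up_at_shadow[OF gen] by (meson max.cobounded1)
    qed
    ultimately show "(\<exists>v'<v. (u, v') \<in> P) \<and> (\<forall>v'<v. (u, v') \<notin> shadow P)" by blast
  next
    assume *: "(\<exists>v'<v. (u, v') \<in> P) \<and> (\<forall>v'<v. (u, v') \<notin> shadow P)"
    then obtain v0 where v0: "v0 < v" "(u, v0) \<in> P" by blast
    have "max v0 (v - d) < v" using v0 d(1) by simp
    then have "up_at P u (max v0 (v - d))" using up_at_shadow[OF gen] v0 *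
      by (meson max.cobounded1 order_le_less_trans)
    then show "up_before P u v" using up[of "max v0 (v - d)"] v0 d(1) by auto
  qed
qed

lemma down_before_shadow:
  assumes "generic P"
  shows "down_before P u v \<longleftrightarrow> (\<exists>u'<u. (u', v) \<in> P) \<and> (\<forall>u'<u. (u', v) \<notin> shadow P)"
  using up_before_shadow[OF generic_swap[OF assms], of v u]
  by (simp add: up_before_swap shadow_swap swap_iff)

lemma shadow_points:
  assumes "generic P" "(u, v) \<in> shadow P"
  shows "\<exists>v'<v. (u, v') \<in> P" "\<exists>u'<u. (u', v) \<in> P"
  using assms up_before_point down_before_point unfolding shadow_def by blast+

lemma shadow_fst_unique:
  assumes gen: "generic P" and "(u, v) \<in> shadow P" "(u, v') \<in> shadow P"
  shows "v = v'"
proof -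
  have "\<not> v < v'" if "(u, v) \<in> shadow P" "(u, v') \<in> shadow P" for v v'
    using that up_before_shadow[OF gen, of u v'] unfolding shadow_def by auto
  then show ?thesis using assms by (meson linorder_neq_iff)
qed

text \<open>Both rays of a shadow point are rays of earlier points of \<open>P\<close>, and a step
  is annihilated at most once. Hence genericity is inherited and shadows can be iterated.\<close>

lemma generic_shadow:
  assumes gen: "generic P"
  shows "generic (shadow P)"
  unfolding generic_def
proof (intro conjI allI)
  fix a b
  have "shadow P \<inter> {..a} \<times> {..b} \<subseteq> fst ` (P \<inter> {..a} \<times> {..b}) \<times> snd ` (P \<inter> {..a} \<times> {..b})"
  proof clarsimp
    fix u v assume "(u, v) \<in> shadow P" "u \<le> a" "v \<le> b"
    then show "u \<in> fst ` (P \<inter> {..a} \<times> {..b}) \<and> v \<in> snd ` (P \<inter> {..a} \<times> {..b})"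
      using shadow_points[OF gen] by (force simp: image_iff)
  qed
  then show "finite (shadow P \<inter> {..a} \<times> {..b})"
    using finite_rects(1)[OF gen] by (meson finite_SigmaI finite_imageI finite_subset)
  show "inj_on fst (shadow P)"
    using shadow_fst_unique[OF gen] by (auto simp: inj_on_def)
  show "inj_on snd (shadow P)"
    using shadow_fst_unique[OF generic_swap[OF gen]] unfolding shadow_swap by (force simp: inj_on_def)
qed

text \<open>This yields the strict order of the lines. When the top point \<open>p\<close> of a
  chain of shadow points is peeled off, the rest is bounded inside the open quadrant below
  \<open>p\<close>, and the up-step arriving at \<open>p\<close> adds one.\<close>

lemma len_shadow_le:
  assumes gen: "generic P"
  shows "len (shadow P \<inter> {..a} \<times> {..b}) \<le> len (P \<inter> {..a} \<times> {..b})"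
proof -
  \<comment> \<open>Arbitrary down-closed sides \<open>S\<close> and \<open>T\<close> let the
    induction pass from closed rectangles to open ones.\<close>
  have *: "card C \<le> len (P \<inter> S \<times> T)"
    if "finite C" "up_chain C" "C \<subseteq> shadow P \<inter> S \<times> T" "S \<subseteq> {..a}" "T \<subseteq> {..b}"
      "\<And>x y. x \<in> S \<Longrightarrow> y \<le> x \<Longrightarrow> y \<in> S" "\<And>x y. x \<in> T \<Longrightarrow> y \<le> x \<Longrightarrow> y \<in> T" for C S T
    using that
  proof (induction "card C" arbitrary: C S T)
    case (Suc n)
    then have ne: "fst ` C \<noteq> {}" and fin: "finite (fst ` C)" by auto
    obtain p where p: "p \<in> C" "fst p = Max (fst ` C)" using Max_in[OF fin ne] by (metis imageE)
    have less: "fst q < fst p \<and> snd q < snd p" if "q \<in> C - {p}" for q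
    proof -
      have "fst q \<le> fst p" using that p fin by simp
      then show ?thesis using Suc.prems(2) that p(1) unfolding up_chain_def by force
    qed
    have pS: "fst p \<in> S" "snd p \<in> T" and sh: "(fst p, snd p) \<in> shadow P"
      using p(1) Suc.prems(3) by auto
    have "card (C - {p}) \<le> len (P \<inter> {..<fst p} \<times> {..<snd p})"
    proof (rule Suc.hyps(1))
      show "n = card (C - {p})" using Suc.hyps(2) p Suc.prems(1) by simp
      show "up_chain (C - {p})" using Suc.prems(2) by (rule up_chain_subset) auto
      show "C - {p} \<subseteq> shadow P \<inter> {..<fst p} \<times> {..<snd p}" using less Suc.prems(3) by auto
      show "{..<fst p} \<subseteq> {..a}" "{..<snd p} \<subseteq> {..b}" using pS Suc.prems(4,5) by fastforce+
    qed (use Suc.prems in auto)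
    also have "\<dots> < len (P \<inter> {..fst p} \<times> {..<snd p})"
      using sh unfolding shadow_def up_before_def by (simp only: mem_Collect_eq prod.case)
    also have "\<dots> \<le> len (P \<inter> S \<times> T)"
    proof (rule len_mono)
      show "finite (P \<inter> S \<times> T)" by (rule finite_rect[OF gen Suc.prems(4,5)])
      show "P \<inter> {..fst p} \<times> {..<snd p} \<subseteq> P \<inter> S \<times> T" using pS Suc.prems(6,7) by (auto dest: less_imp_le)
    qed
    finally show ?case using p Suc.prems(1) Suc.hyps(2) by simp
  qed simp
  obtain C where "C \<subseteq> shadow P \<inter> {..a} \<times> {..b}" "up_chain C" "card C = len (shadow P \<inter> {..a} \<times> {..b})"
    by (rule len_attained[OF finite_rects(1)[OF generic_shadow[OF gen]]])
  then show ?thesis using *[of C "{..a}" "{..b}"] finite_rects(1)[OF generic_shadow[OF gen]]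
    by (metis atMost_iff finite_subset order_refl order_trans)
qed

section \<open>Iterated shadows\<close>

definition lower :: "(real \<times> real) set \<Rightarrow> bool" where
  "lower S \<longleftrightarrow> (\<forall>p\<in>S. \<forall>q. fst q \<le> fst p \<and> snd q \<le> snd p \<longrightarrow> q \<in> S)"

text \<open>Causality: whether a point is a shadow point depends only on \<open>P\<close> in the
  quadrant below it, which a lower set contains.\<close>

lemma shadow_lower:
  assumes "lower S" "P \<inter> S = Q \<inter> S"
  shows "shadow P \<inter> S = shadow Q \<inter> S"
proof -
  have "P \<inter> A \<times> B = Q \<inter> A \<times> B" if "A \<subseteq> {..u}" "B \<subseteq> {..v}" "(u, v) \<in> S" for A B u v
  proof -
    have "A \<times> B \<subseteq> S" using that assms(1) unfolding lower_def by force
    then show ?thesis using assms(2) by blast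
  qed
  then have "(u, v) \<in> shadow P \<longleftrightarrow> (u, v) \<in> shadow Q" if "(u, v) \<in> S" for u v
  proof -
    note * = \<open>\<And>v u B A. A \<subseteq> {..u} \<Longrightarrow> B \<subseteq> {..v} \<Longrightarrow> (u, v) \<in> S \<Longrightarrow> P \<inter> A \<times> B = Q \<inter> A \<times> B\<close>
    have "P \<inter> {..<u} \<times> {..<v} = Q \<inter> {..<u} \<times> {..<v}" "P \<inter> {..u} \<times> {..<v} = Q \<inter> {..u} \<times> {..<v}"
      "P \<inter> {..<u} \<times> {..v} = Q \<inter> {..<u} \<times> {..v}"
      using that by (intro *[of _ u _ v]; auto)+
    then show ?thesis unfolding shadow_def up_before_def down_before_def by simp
  qed
  then show ?thesis by auto
qed

text \<open>The nucleation points of the line with index \<open>- k\<close>.\<close>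

definition layer :: "(real \<times> real) set \<Rightarrow> nat \<Rightarrow> (real \<times> real) set" where
  "layer P k = (shadow ^^ k) P"

lemma layer_0 [simp]: "layer P 0 = P" and layer_Suc: "layer P (Suc k) = shadow (layer P k)"
  by (simp_all add: layer_def)

lemma generic_layer: "generic P \<Longrightarrow> generic (layer P k)"
  by (induction k) (auto simp: layer_Suc generic_shadow)

lemma layer_lower: "lower S \<Longrightarrow> P \<inter> S = Q \<inter> S \<Longrightarrow> layer P k \<inter> S = layer Q k \<inter> S"
proof (induction k)
  case (Suc k)
  show ?case unfolding layer_Suc by (rule shadow_lower[OF Suc.prems(1) Suc.IH[OF Suc.prems]])
qed simp

lemma layer_fst_snd:
  assumes "generic P" "(u, v) \<in> layer P k" "l \<le> k"
  shows "\<exists>v'\<le>v. (u, v') \<in> layer P l" "\<exists>u'\<le>u. (u', v) \<in> layer P l"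
proof -
  have "(\<exists>v'\<le>v. (u, v') \<in> layer P l) \<and> (\<exists>u'\<le>u. (u', v) \<in> layer P l)"
    using assms(2,3)
  proof (induction k arbitrary: u v)
    case (Suc k)
    show ?case
    proof (cases "l = Suc k")
      case False
      obtain v' u' where "v' < v" "(u, v') \<in> layer P k" "u' < u" "(u', v) \<in> layer P k"
        using shadow_points[OF generic_layer[OF assms(1)]] Suc.prems(1) unfolding layer_Suc by blast
      then show ?thesis using Suc.IH Suc.prems(2) False
        by (meson le_SucE less_imp_le order_trans)
    qed (use Suc.prems in auto)
  qed auto
  then show "\<exists>v'\<le>v. (u, v') \<in> layer P l" "\<exists>u'\<le>u. (u', v) \<in> layer P l" by auto
qed

text \<open>A shadow point has a point of its layer strictly to its left, so each shadow loses the
  leftmost point and the count in the quadrant drops by at least one. Hence only finitely many lines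
  have moved by a given time.\<close>

lemma layer_empty:
  assumes gen: "generic P" and "card (P \<inter> {..a} \<times> {..b}) \<le> k"
  shows "layer P k \<inter> {..a} \<times> {..b} = {}"
proof -
  let ?R = "{..a} \<times> {..b} :: (real \<times> real) set"
  have "card (layer P k \<inter> ?R) \<le> card (P \<inter> ?R) - k"
  proof (induction k)
    case (Suc k)
    let ?Q = "layer P k"
    have genQ: "generic ?Q" by (rule generic_layer[OF gen])
    have fin: "finite (fst ` (?Q \<inter> ?R))" using finite_rects(1)[OF genQ] by simp
    have card_fst: "card (fst ` (X \<inter> ?R)) = card (X \<inter> ?R)" if "generic X" for X
      using that unfolding generic_def by (intro card_image) (auto intro: inj_on_subset)
    have sub: "fst ` (shadow ?Q \<inter> ?R) \<subseteq> fst ` (?Q \<inter> ?R) - {Min (fst ` (?Q \<inter> ?R))}"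
    proof clarsimp
      fix u v assume uv: "(u, v) \<in> shadow ?Q" "u \<le> a" "v \<le> b"
      obtain v' u' where *: "v' < v" "(u, v') \<in> ?Q" "u' < u" "(u', v) \<in> ?Q"
        using shadow_points[OF genQ uv(1)] by blast
      then have mem: "u \<in> fst ` (?Q \<inter> ?R)" "u' \<in> fst ` (?Q \<inter> ?R)" using uv by force+
      then show "u \<in> fst ` (?Q \<inter> ?R) \<and> u \<noteq> Min (fst ` (?Q \<inter> ?R))"
        using mem(1) Min_le[OF fin mem(2)] *(3) by linarith
    qed
    show ?case
    proof (cases "?Q \<inter> ?R = {}")
      case True
      then show ?thesis using sub card_fst[OF generic_shadow[OF genQ]] by (simp add: layer_Suc)
    next
      case False
      have "card (shadow ?Q \<inter> ?R) \<le> card (fst ` (?Q \<inter> ?R) - {Min (fst ` (?Q \<inter> ?R))})"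
        unfolding card_fst[OF generic_shadow[OF genQ], symmetric] by (rule card_mono) (use sub fin in auto)
      also have "\<dots> = card (?Q \<inter> ?R) - 1"
        using fin False Min_in[OF fin] card_fst[OF genQ] by (subst card_Diff_singleton) auto
      finally show ?thesis using Suc by (simp add: layer_Suc)
    qed
  qed simp
  then have "card (layer P k \<inter> ?R) = 0" using assms(2) by simp
  moreover have "finite (layer P k \<inter> ?R)" by (rule finite_rects(1)[OF generic_layer[OF gen]])
  ultimately show ?thesis by simp
qed

section \<open>The local rule\<close>

lemma initial_card:
  fixes Q :: "nat \<Rightarrow> bool"
  assumes "finite {k. Q k}" "\<And>l k. Q k \<Longrightarrow> l \<le> k \<Longrightarrow> Q l"
  shows "k < card {k. Q k} \<longleftrightarrow> Q k"
proof -
  define m where "m = (LEAST k. \<not> Q k)"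
  obtain k0 where "\<not> Q k0" using assms(1) by (metis Collect_cong infinite_UNIV_nat UNIV_def)
  then have "\<not> Q m" unfolding m_def by (rule LeastI)
  moreover have "Q l" if "l < m" for l using not_less_Least[of l] that unfolding m_def by blast
  ultimately have "Q l \<longleftrightarrow> l < m" for l using assms(2) by (meson not_less)
  then show ?thesis by simp
qed

text \<open>A step that is annihilated reappears one line lower, so its ray meets the layers
  \<open>0, 1, ...\<close> in turn, and the number of layers met inside \<open>S\<close> tells which
  line the step has reached.\<close>

definition row_label :: "(real \<times> real) set \<Rightarrow> (real \<times> real) set \<Rightarrow> real \<Rightarrow> nat" where
  "row_label P S u = card {k. u \<in> fst ` (layer P k \<inter> S)}"

definition col_label :: "(real \<times> real) set \<Rightarrow> (real \<times> real) set \<Rightarrow> real \<Rightarrow> nat" where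
  "col_label P S v = card {k. v \<in> snd ` (layer P k \<inter> S)}"

lemma label_lower:
  assumes "lower S" "P \<inter> S = Q \<inter> S"
  shows "row_label P S = row_label Q S" "col_label P S = col_label Q S"
  using layer_lower[OF assms] by (auto simp: row_label_def col_label_def)

lemma layer_finite_empty:
  assumes "generic P" "finite P" "card P \<le> k"
  shows "layer P k = {}"
proof -
  have "card (P \<inter> {..u} \<times> {..v}) \<le> k" for u v
    using assms by (meson card_mono Int_lower1 order_trans)
  then have "layer P k \<inter> {..u} \<times> {..v} = {}" for u v by (intro layer_empty assms)
  then show ?thesis by fastforce
qed

lemma layer_subset:
  assumes "generic P" "P \<subseteq> U \<times> V"
  shows "layer P k \<subseteq> U \<times> V"
  using layer_fst_snd[OF assms(1), where l = 0] assms(2) by fastforce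

lemma less_row_label:
  assumes "generic P" "finite P" "lower S"
  shows "k < row_label P S u \<longleftrightarrow> u \<in> fst ` (layer P k \<inter> S)"
  unfolding row_label_def
proof (rule initial_card)
  have "k \<le> card P" if "u \<in> fst ` (layer P k \<inter> S)" for k
  proof -
    have "layer P k \<noteq> {}" using that by auto
    then show ?thesis using layer_finite_empty[OF assms(1,2)] nat_le_linear by blast
  qed
  then have "{k. u \<in> fst ` (layer P k \<inter> S)} \<subseteq> {..card P}" by blast
  then show "finite {k. u \<in> fst ` (layer P k \<inter> S)}" by (rule finite_subset) simp
  fix k l assume "u \<in> fst ` (layer P k \<inter> S)" "l \<le> k"
  then obtain v where v: "(u, v) \<in> layer P k" "(u, v) \<in> S" by force
  then obtain v' where "v' \<le> v" "(u, v') \<in> layer P l" using layer_fst_snd[OF assms(1) v(1) \<open>l \<le> k\<close>] by blast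
  moreover from this have "(u, v') \<in> S" using v(2) assms(3) unfolding lower_def by force
  ultimately show "u \<in> fst ` (layer P l \<inter> S)" by force
qed

lemma less_col_label:
  assumes "generic P" "finite P" "lower S"
  shows "k < col_label P S v \<longleftrightarrow> v \<in> snd ` (layer P k \<inter> S)"
  unfolding col_label_def
proof (rule initial_card)
  have "k \<le> card P" if "v \<in> snd ` (layer P k \<inter> S)" for k
  proof -
    have "layer P k \<noteq> {}" using that by auto
    then show ?thesis using layer_finite_empty[OF assms(1,2)] nat_le_linear by blast
  qed
  then have "{k. v \<in> snd ` (layer P k \<inter> S)} \<subseteq> {..card P}" by blast
  then show "finite {k. v \<in> snd ` (layer P k \<inter> S)}" by (rule finite_subset) simp
  fix k l assume "v \<in> snd ` (layer P k \<inter> S)" "l \<le> k"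
  then obtain u where u: "(u, v) \<in> layer P k" "(u, v) \<in> S" by force
  then obtain u' where "u' \<le> u" "(u', v) \<in> layer P l" using layer_fst_snd[OF assms(1) u(1) \<open>l \<le> k\<close>] by blast
  moreover from this have "(u', v) \<in> S" using u(2) assms(3) unfolding lower_def by force
  ultimately show "v \<in> snd ` (layer P l \<inter> S)" by force
qed

lemma generic_finite:
  "finite P \<Longrightarrow> inj_on fst P \<Longrightarrow> inj_on snd P \<Longrightarrow> generic P"
  unfolding generic_def by auto

text \<open>The local rule at a corner \<open>(u, v)\<close> of the region \<open>S\<close>: an up-step and a down-step that meet are
  both moved one line down if they belong to the same line, and pass each other otherwise. Labels are
  shifted by one, so that label \<open>0\<close> means that there is no step yet.\<close>
lemma corner_rule:
  fixes u v :: real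
  assumes fin: "finite P" and inj: "inj_on fst P" "inj_on snd P" and P: "P \<subseteq> U \<times> V"
    and S: "lower S" and uv: "(u, v) \<in> S" and corner: "S \<inter> U \<times> V \<inter> {u..} \<times> {v..} \<subseteq> {(u, v)}"
  defines "S' \<equiv> S - {u..} \<times> {v..}"
  defines "hit \<equiv> (u, v) \<in> P \<or> 1 \<le> row_label P S' u \<and> row_label P S' u = col_label P S' v"
  shows "row_label P S x = row_label P S' x + (if x = u \<and> hit then 1 else 0)"
    and "col_label P S y = col_label P S' y + (if y = v \<and> hit then 1 else 0)"
    and "(u, v) \<in> P \<Longrightarrow> row_label P S' u = 0 \<and> col_label P S' v = 0"
proof -
  have gen: "generic P" using fin inj by (rule generic_finite)
  have S': "lower S'" using S unfolding S'_def lower_def by auto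
  note row = less_row_label[OF gen fin] and col = less_col_label[OF gen fin]
  \<comment> \<open>Layer points lie on the grid \<open>U \<times> V\<close>, and
    \<open>(u, v)\<close> is the only grid point of \<open>S\<close> outside \<open>S'\<close>; so
    enlarging \<open>S'\<close> to \<open>S\<close> can add only this point.\<close>
  have LS: "layer P k \<inter> S = layer P k \<inter> S' \<union> (if (u, v) \<in> layer P k then {(u, v)} else {})" for k
    using corner layer_subset[OF gen P, of k] uv unfolding S'_def by auto
  have below: "(\<exists>v'<v. (u, v') \<in> layer P k) \<longleftrightarrow> u \<in> fst ` (layer P k \<inter> S')"
     "(\<exists>u'<u. (u', v) \<in> layer P k) \<longleftrightarrow> v \<in> snd ` (layer P k \<inter> S')" for k
  proof -
    have "(u, v') \<in> S" "(u', v) \<in> S" if "v' < v" "u' < u" for u' v'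
      using uv S that unfolding lower_def by force+
    then have "(u, v') \<in> S'" "(u', v) \<in> S'" if "v' < v" "u' < u" for u' v'
      using that unfolding S'_def by (auto intro: exI[of _ "u - 1"] simp: gt_ex)
    moreover have "\<exists>z::real. z < x" for x by (rule lt_ex)
    ultimately have *: "(u, v') \<in> S'" "(u', v) \<in> S'" if "v' < v" "u' < u" for u' v' using that by blast+
    then have **: "v' < v \<Longrightarrow> (u, v') \<in> S'" "u' < u \<Longrightarrow> (u', v) \<in> S'" for u' v'
      using \<open>\<And>x. \<exists>z::real. z < x\<close> by blast+
    show "(\<exists>v'<v. (u, v') \<in> layer P k) \<longleftrightarrow> u \<in> fst ` (layer P k \<inter> S')"
      using ** by (force simp: S'_def image_iff)
    show "(\<exists>u'<u. (u', v) \<in> layer P k) \<longleftrightarrow> v \<in> snd ` (layer P k \<inter> S')"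
      using ** by (force simp: S'_def image_iff)
  qed
  \<comment> \<open>A point of layer \<open>k + 1\<close> is a meeting of two steps of line
    \<open>k\<close>, both of which carry the label \<open>k + 1\<close> on arrival.\<close>
  have suc: "(u, v) \<in> layer P (Suc k) \<longleftrightarrow> row_label P S' u = Suc k \<and> col_label P S' v = Suc k" for k
  proof -
    have "(u, v) \<in> layer P (Suc k) \<longleftrightarrow>
        (\<exists>v'<v. (u, v') \<in> layer P k) \<and> \<not> (\<exists>v'<v. (u, v') \<in> layer P (Suc k)) \<and>
        (\<exists>u'<u. (u', v) \<in> layer P k) \<and> \<not> (\<exists>u'<u. (u', v) \<in> layer P (Suc k))"
      unfolding layer_Suc using up_before_shadow[OF generic_layer[OF gen]] down_before_shadow[OF generic_layer[OF gen]]
      by (subst shadow_def) auto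
    then show ?thesis unfolding below row[OF S', symmetric] col[OF S', symmetric] by linarith
  qed
  show zero: "row_label P S' u = 0 \<and> col_label P S' v = 0" if "(u, v) \<in> P"
  proof -
    have "\<not> (\<exists>v'<v. (u, v') \<in> layer P 0)" "\<not> (\<exists>u'<u. (u', v) \<in> layer P 0)"
      unfolding layer_0 using fst_unique[OF gen that] snd_unique[OF gen that] less_irrefl by blast+
    then show ?thesis unfolding below row[OF S', symmetric] col[OF S', symmetric] by simp
  qed
  have lay: "(u, v) \<in> layer P k \<longleftrightarrow> hit \<and> k = row_label P S' u \<and> k = col_label P S' v" for k
  proof (cases k)
    case 0
    then show ?thesis unfolding hit_def using zero by auto
  next
    case (Suc j)
    then show ?thesis unfolding hit_def using suc[of j] zero by auto
  qed
  have lay': "(u, v) \<in> layer P k \<longleftrightarrow> hit \<and> k = row_label P S' u" "(u, v) \<in> layer P k \<longleftrightarrow> hit \<and> k = col_label P S' v" for k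
  proof -
    have "row_label P S' u = col_label P S' v" if hit
      using that zero unfolding hit_def by (elim disjE) simp_all
    then show "(u, v) \<in> layer P k \<longleftrightarrow> hit \<and> k = row_label P S' u"
      "(u, v) \<in> layer P k \<longleftrightarrow> hit \<and> k = col_label P S' v" unfolding lay by auto
  qed
  have "k < row_label P S x \<longleftrightarrow> k < row_label P S' x + (if x = u \<and> hit then 1 else 0)" for k
  proof -
    have "k < row_label P S x \<longleftrightarrow> x \<in> fst ` (layer P k \<inter> S') \<or> x = u \<and> (u, v) \<in> layer P k"
      unfolding row[OF S] LS image_Un by (simp split: if_split)
    then show ?thesis unfolding row[OF S', symmetric] lay'(1) by auto
  qed
  then show "row_label P S x = row_label P S' x + (if x = u \<and> hit then 1 else 0)"
    by (metis linorder_neq_iff)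
  have "k < col_label P S y \<longleftrightarrow> k < col_label P S' y + (if y = v \<and> hit then 1 else 0)" for k
  proof -
    have "k < col_label P S y \<longleftrightarrow> y \<in> snd ` (layer P k \<inter> S') \<or> y = v \<and> (u, v) \<in> layer P k"
      unfolding col[OF S] LS image_Un by (simp split: if_split)
    then show ?thesis unfolding col[OF S', symmetric] lay'(2) by auto
  qed
  then show "col_label P S y = col_label P S' y + (if y = v \<and> hit then 1 else 0)"
    by (metis linorder_neq_iff)
qed

text \<open>A grid point of \<open>S\<close> with maximal coordinate sum has no other grid point of
  \<open>S\<close> above it in both coordinates.\<close>

lemma obtain_corner:
  fixes U V :: "real set"
  assumes "finite U" "finite V" "S \<inter> U \<times> V \<noteq> {}"
  obtains u v where "(u, v) \<in> S" "u \<in> U" "v \<in> V" "S \<inter> U \<times> V \<inter> {u..} \<times> {v..} \<subseteq> {(u, v)}"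
proof -
  let ?D = "S \<inter> U \<times> V"
  have fin: "finite ((\<lambda>p. fst p + snd p) ` ?D)" "(\<lambda>p. fst p + snd p) ` ?D \<noteq> {}" using assms by auto
  obtain p where p: "p \<in> ?D" "fst p + snd p = Max ((\<lambda>p. fst p + snd p) ` ?D)"
    using Max_in[OF fin] by (metis (no_types, lifting) imageE)
  have "q = p" if "q \<in> ?D \<inter> {fst p..} \<times> {snd p..}" for q
  proof -
    have "fst q + snd q \<le> fst p + snd p" unfolding p(2) using that fin(1) by (intro Max_ge) auto
    moreover have "fst p \<le> fst q" "snd p \<le> snd q" using that by auto
    ultimately show ?thesis by (intro prod_eqI) linarith+
  qed
  then have "?D \<inter> {fst p..} \<times> {snd p..} \<subseteq> {(fst p, snd p)}" by auto
  moreover have "(fst p, snd p) \<in> S" "fst p \<in> U" "snd p \<in> V" using p(1) by auto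
  ultimately show thesis by (rule that[rotated 3])
qed

lemma lower_corner: "lower S \<Longrightarrow> lower (S - {u..} \<times> {v..})"
  unfolding lower_def by auto

text \<open>The local rule is reversible, so removing corners of \<open>S\<close> one at a time
  recovers \<open>P\<close>: equal positive labels behind the corner mean a hit and were smaller by
  one before it, and the hit is a point of \<open>P\<close> exactly if they are 1.\<close>

lemma rsk_unique:
  assumes "finite U" "finite V" "lower S"
    and "P \<subseteq> S \<inter> U \<times> V" "inj_on fst P" "inj_on snd P"
    and "Q \<subseteq> S \<inter> U \<times> V" "inj_on fst Q" "inj_on snd Q"
    and "\<And>u. u \<in> U \<Longrightarrow> row_label P S u = row_label Q S u"
    and "\<And>v. v \<in> V \<Longrightarrow> col_label P S v = col_label Q S v"
  shows "P = Q"
  using assms(3-)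
proof (induction "card (S \<inter> U \<times> V)" arbitrary: S P Q rule: less_induct)
  case less
  show ?case
  proof (cases "S \<inter> U \<times> V = {}")
    case False
    obtain u v where uv: "(u, v) \<in> S" "u \<in> U" "v \<in> V" and corner: "S \<inter> U \<times> V \<inter> {u..} \<times> {v..} \<subseteq> {(u, v)}"
      using obtain_corner[OF assms(1,2) False] by blast
    define S' where "S' = S - {u..} \<times> {v..}"
    have S': "lower S'" unfolding S'_def using lower_corner less.prems(1) .
    have D': "S' \<inter> U \<times> V = S \<inter> U \<times> V - {(u, v)}" using corner unfolding S'_def by auto
    have fin: "finite (S \<inter> U \<times> V)" using assms(1,2) by auto
    have P: "finite P" "P \<subseteq> U \<times> V" and Q: "finite Q" "Q \<subseteq> U \<times> V"
      using less.prems(2,5) finite_subset[OF less.prems(2) fin] finite_subset[OF less.prems(5) fin] by auto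
    note ruleP = corner_rule[OF P(1) less.prems(3,4) P(2) less.prems(1) uv(1) corner, folded S'_def]
    note ruleQ = corner_rule[OF Q(1) less.prems(6,7) Q(2) less.prems(1) uv(1) corner, folded S'_def]
    note lab = label_lower[OF S', of "P - {(u, v)}" P] label_lower[OF S', of "Q - {(u, v)}" Q]
    have S'P: "(P - {(u, v)}) \<inter> S' = P \<inter> S'" "(Q - {(u, v)}) \<inter> S' = Q \<inter> S'" unfolding S'_def by auto
    have u: "row_label P S u = row_label Q S u" and v: "col_label P S v = col_label Q S v"
      using less.prems(8,9) uv by auto
    have same: "(u, v) \<in> P \<longleftrightarrow> (u, v) \<in> Q" "row_label P S' u = row_label Q S' u" "col_label P S' v = col_label Q S' v"
      using u v ruleP(3) ruleQ(3) unfolding ruleP(1,2) ruleQ(1,2) by (auto split: if_splits)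
    have "P - {(u, v)} = Q - {(u, v)}"
    proof (rule less.hyps)
      show "card (S' \<inter> U \<times> V) < card (S \<inter> U \<times> V)"
        unfolding D' using uv fin by (intro card_Diff1_less) auto
      show "row_label (P - {(u, v)}) S' x = row_label (Q - {(u, v)}) S' x" if "x \<in> U" for x
        using less.prems(8)[OF that] same unfolding lab(1)[OF S'P(1)] lab(3)[OF S'P(2)] ruleP(1) ruleQ(1)
        by (cases "x = u") auto
      show "col_label (P - {(u, v)}) S' x = col_label (Q - {(u, v)}) S' x" if "x \<in> V" for x
        using less.prems(9)[OF that] same unfolding lab(2)[OF S'P(1)] lab(4)[OF S'P(2)] ruleP(2) ruleQ(2)
        by (cases "x = v") auto
    qed (use S' D' less.prems in \<open>auto intro: inj_on_subset\<close>)
    then show ?thesis using same(1) by blast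
  qed (use less.prems in auto)
qed

section \<open>Which labels occur\<close>

text \<open>A down-step with \<open>q < v\<close> lies to the left of the cut, just as an up-step
  with \<open>u \<le> p\<close> does. So this is the net height gained up to the cut by the line
  whose steps carry the label \<open>m\<close>.\<close>

definition cut_count :: "real set \<Rightarrow> real set \<Rightarrow> (real \<Rightarrow> nat) \<Rightarrow> (real \<Rightarrow> nat) \<Rightarrow> real \<Rightarrow> real \<Rightarrow> nat \<Rightarrow> int" where
  "cut_count U V a b p q m = int (card {u\<in>U. u \<le> p \<and> a u = m}) - int (card {v\<in>V. q < v \<and> b v = m})"

text \<open>A cut is a place on the staircase boundary of \<open>S\<close>, as seen by the grid, at
  which the heights of the lines can be compared.\<close>

definition is_cut :: "real set \<Rightarrow> real set \<Rightarrow> (real \<times> real) set \<Rightarrow> real \<Rightarrow> real \<Rightarrow> bool" where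
  "is_cut U V S p q \<longleftrightarrow> (\<forall>u\<in>U. \<forall>v\<in>V. (u \<le> p \<and> v \<le> q \<longrightarrow> (u, v) \<in> S) \<and> (p < u \<and> q < v \<longrightarrow> (u, v) \<notin> S))"

text \<open>Every line has as many up-steps as down-steps and nowhere gains more than the line above
  it, which is the strict order of integer lines whose base levels differ by one. The label 0 stands
  for no step, so the conditions start at 1.\<close>

definition valid_labels :: "real set \<Rightarrow> real set \<Rightarrow> (real \<times> real) set \<Rightarrow> (real \<Rightarrow> nat) \<Rightarrow> (real \<Rightarrow> nat) \<Rightarrow> bool" where
  "valid_labels U V S a b \<longleftrightarrow>
     (\<forall>m\<ge>1. card {u\<in>U. a u = m} = card {v\<in>V. b v = m}) \<and>
     (\<forall>p q. is_cut U V S p q \<longrightarrow> (\<forall>m\<ge>1. cut_count U V a b p q (Suc m) \<le> cut_count U V a b p q m))"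

lemma card_update:
  assumes "finite U" "u \<in> U"
  shows "card {x\<in>U. R x \<and> (a(u := n)) x = m} = card {x\<in>U - {u}. R x \<and> a x = m} + (if R u \<and> n = m then 1 else 0)"
proof -
  have "{x\<in>U. R x \<and> (a(u := n)) x = m} = {x\<in>U - {u}. R x \<and> a x = m} \<union> (if R u \<and> n = m then {u} else {})"
    using assms by auto
  then show ?thesis using assms by (auto simp: card_Un_disjoint)
qed

text \<open>The inverse of the local rule keeps labels admissible. Only cuts in the removed corner
  are new, and the heights there are controlled by three neighbouring cuts.\<close>

lemma valid_labels_corner:
  assumes fin: "finite U" "finite V" and S: "lower S" and uv: "(u, v) \<in> S" "u \<in> U" "v \<in> V"
    and corner: "S \<inter> U \<times> V \<inter> {u..} \<times> {v..} \<subseteq> {(u, v)}" and valid: "valid_labels U V S a b"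
  defines "S' \<equiv> S - {u..} \<times> {v..}"
  \<comment> \<open>If both labels are 0, truncated subtraction leaves them 0: two absent steps do
    not meet.\<close>
  defines "a' \<equiv> a(u := (if a u = b v then a u - 1 else a u))"
  defines "b' \<equiv> b(v := (if a u = b v then b v - 1 else b v))"
  shows "valid_labels U V S' a' b'"
  unfolding valid_labels_def
proof (intro conjI allI impI)
  note cu = card_update[OF fin(1) uv(2), of _ a] and cv = card_update[OF fin(2) uv(3), of _ b]
  have bal: "card {x\<in>U. a x = m} = card {y\<in>V. b y = m}" if "m \<ge> 1" for m
    using valid that unfolding valid_labels_def by blast
  show "card {x\<in>U. a' x = m} = card {y\<in>V. b' y = m}" if "m \<ge> 1" for m
  proof -
    have "a' = a(u := a' u)" "b' = b(v := b' v)" unfolding a'_def b'_def by auto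
    then have e: "card {x\<in>U. a' x = m} = card {x\<in>U - {u}. a x = m} + (if a' u = m then 1 else 0)"
      "card {y\<in>V. b' y = m} = card {y\<in>V - {v}. b y = m} + (if b' v = m then 1 else 0)"
      using cu[of "\<lambda>_. True" "a' u" m] cv[of "\<lambda>_. True" "b' v" m] by simp_all
    have e0: "card {x\<in>U - {u}. a x = m} + (if a u = m then 1 else 0) =
        card {y\<in>V - {v}. b y = m} + (if b v = m then 1 else 0)"
      using bal[OF that] cu[of "\<lambda>_. True" "a u" m] cv[of "\<lambda>_. True" "b v" m] by simp
    show ?thesis
    proof (cases "a u = b v")
      case True
      then show ?thesis using e0 unfolding e by (simp add: a'_def b'_def)
    next
      case False
      then show ?thesis using e0 unfolding e by (simp add: a'_def b'_def)
    qed
  qed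
  have cc0: "cut_count U V a b p q n = int (card {x\<in>U - {u}. x \<le> p \<and> a x = n}) + of_bool (u \<le> p \<and> a u = n)
      - int (card {y\<in>V - {v}. q < y \<and> b y = n}) - of_bool (q < v \<and> b v = n)" for p q n
    using cu[of "\<lambda>x. x \<le> p" "a u" n] cv[of "\<lambda>y. q < y" "b v" n]
    unfolding cut_count_def fun_upd_triv by (simp add: of_bool_def)
  have cc: "cut_count U V a' b' p q n = int (card {x\<in>U - {u}. x \<le> p \<and> a x = n}) + of_bool (u \<le> p \<and> a' u = n)
      - int (card {y\<in>V - {v}. q < y \<and> b y = n}) - of_bool (q < v \<and> b' v = n)" for p q n
  proof -
    have "a' = a(u := a' u)" "b' = b(v := b' v)" unfolding a'_def b'_def by auto
    then show ?thesis using cu[of "\<lambda>x. x \<le> p" "a' u" n] cv[of "\<lambda>y. q < y" "b' v" n]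
      unfolding cut_count_def by (simp add: of_bool_def)
  qed
  fix p q m assume cut: "is_cut U V S' p q" and m: "1 \<le> (m::nat)"
  have dec: "cut_count U V a b p q (Suc m) \<le> cut_count U V a b p q m" if "is_cut U V S p q" for p q
    using valid that m unfolding valid_labels_def by blast
  show "cut_count U V a' b' p q (Suc m) \<le> cut_count U V a' b' p q m"
  proof (cases "p < u \<and> q < v")
    case False
    have "is_cut U V S p q"
      using cut False corner unfolding is_cut_def S'_def by auto
    moreover have "\<not> (u \<le> p \<and> v \<le> q)"
      using cut uv unfolding is_cut_def S'_def by auto
    then have "u \<le> p \<and> q < v \<or> p < u \<and> v \<le> q" using False by auto
    \<comment> \<open>Such a cut counts both of the corner rays or neither, so a common decrease of
      their labels cancels.\<close>
    then have "cut_count U V a' b' p q n = cut_count U V a b p q n" if "n \<ge> 1" for n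
      unfolding cc cc0 using that by (cases "a u = b v") (auto simp: a'_def b'_def)
    ultimately show ?thesis using dec m by simp
  next
    case True
    have inS: "(x, y) \<in> S" if "x \<le> u" "y \<le> v" for x y
      using uv(1) S that unfolding lower_def by force
    have noS: "x = u \<and> y = v" if "x \<in> U" "y \<in> V" "(x, y) \<in> S" "p < x" "q < y" for x y
      using cut that corner unfolding is_cut_def S'_def by auto
    have x: "x \<le> p" if "x \<in> U" "x < u" for x
      using noS[of x v] inS[of x v] that uv True by force
    have y: "y \<le> q" if "y \<in> V" "y < v" for y
      using noS[of u y] inS[of u y] that uv True by force
    have noS': "(x, y) \<notin> S" if "x \<in> U" "y \<in> V" "u \<le> x" "v \<le> y" "x \<noteq> u \<or> y \<noteq> v" for x y
      using corner that by auto
    have "is_cut U V S p v" unfolding is_cut_def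
    proof (intro ballI conjI impI)
      fix x y assume "x \<in> U" "y \<in> V"
      then show "x \<le> p \<and> y \<le> v \<Longrightarrow> (x, y) \<in> S" "p < x \<and> v < y \<Longrightarrow> (x, y) \<notin> S"
        using inS[of x y] noS[of x y] True by auto
    qed
    moreover have "is_cut U V S u v" unfolding is_cut_def
    proof (intro ballI conjI impI)
      fix x y assume "x \<in> U" "y \<in> V"
      then show "x \<le> u \<and> y \<le> v \<Longrightarrow> (x, y) \<in> S" "u < x \<and> v < y \<Longrightarrow> (x, y) \<notin> S"
        using inS[of x y] noS[of x y] True by auto
    qed
    moreover have "is_cut U V S u q" unfolding is_cut_def
    proof (intro ballI conjI impI)
      fix x y assume "x \<in> U" "y \<in> V"
      then show "x \<le> u \<and> y \<le> q \<Longrightarrow> (x, y) \<in> S" "u < x \<and> q < y \<Longrightarrow> (x, y) \<notin> S"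
        using inS[of x y] noS[of x y] True by auto
    qed
    ultimately have decs: "cut_count U V a b p v (Suc m) \<le> cut_count U V a b p v m"
      "cut_count U V a b u v (Suc m) \<le> cut_count U V a b u v m"
      "cut_count U V a b u q (Suc m) \<le> cut_count U V a b u q m" using dec by blast+
    define c where "c n = card {x\<in>U - {u}. x \<le> p \<and> a x = n}" for n
    define d where "d n = card {y\<in>V - {v}. v < y \<and> b y = n}" for n
    have cU: "card {x\<in>U - {u}. x \<le> u \<and> a x = n} = c n" for n
      unfolding c_def using x True by (intro arg_cong[of _ _ card]) force
    have dV: "card {y\<in>V - {v}. q < y \<and> b y = n} = d n" for n
      unfolding d_def using y True by (intro arg_cong[of _ _ card]) force
    have 1: "cut_count U V a b p v n = int (c n) - int (d n)" for n
      unfolding cc0 c_def d_def using True by simp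
    have 2: "cut_count U V a b u v n = int (c n) + of_bool (a u = n) - int (d n)" for n
      unfolding cc0 cU d_def by simp
    have 3: "cut_count U V a b u q n = int (c n) + of_bool (a u = n) - int (d n) - of_bool (b v = n)" for n
      unfolding cc0 cU dV using True by simp
    have 4: "cut_count U V a' b' p q n = int (c n) - int (d n) - of_bool (b' v = n)" for n
      unfolding cc c_def dV using True by simp
    \<comment> \<open>The cut \<open>(p, v)\<close> suffices unless the new label of
      \<open>v\<close> is \<open>m\<close>; then \<open>(u, v)\<close> settles the case of equal old
      labels and \<open>(u, q)\<close> that of different ones.\<close>
    show ?thesis using decs m unfolding 1 2 3 4
      by (auto simp: of_bool_def b'_def split: if_splits)
  qed
qed

lemma layer_empty_set [simp]: "layer {} k = {}"
  by (rule layer_finite_empty) (auto intro: generic_finite)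

text \<open>A cut below the whole grid counts all down-steps and no up-step, so the order of the
  lines makes the number of down-steps with label \<open>m\<close> nondecreasing in
  \<open>m\<close>. Only finitely many labels occur, so this number is 0.\<close>

lemma valid_labels_zero:
  assumes fin: "finite U" "finite V" and valid: "valid_labels U V S a b" and S: "S \<inter> U \<times> V = {}"
  shows "u \<in> U \<Longrightarrow> a u = 0" "v \<in> V \<Longrightarrow> b v = 0"
proof -
  obtain p where p: "\<And>u. u \<in> U \<Longrightarrow> p < u" using fin(1)
    by (metis Min_le empty_iff finite_has_minimal2 lt_ex order_less_le_trans)
  obtain q where q: "\<And>v. v \<in> V \<Longrightarrow> q < v" using fin(2)
    by (metis Min_le empty_iff finite_has_minimal2 lt_ex order_less_le_trans)
  have "is_cut U V S p q" using p q S unfolding is_cut_def by force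
  moreover have "cut_count U V a b p q m = - int (card {v\<in>V. b v = m})" for m
  proof -
    have e: "{u\<in>U. u \<le> p \<and> a u = m} = {}" "{v\<in>V. q < v \<and> b v = m} = {v\<in>V. b v = m}" using p q by force+
    show ?thesis unfolding cut_count_def e by simp
  qed
  ultimately have step: "card {v\<in>V. b v = m} \<le> card {v\<in>V. b v = Suc m}" if "m \<ge> 1" for m
    using valid that unfolding valid_labels_def by force
  have zero: "card {v\<in>V. b v = m} = 0" if "m \<ge> 1" for m
  proof -
    have le: "card {v\<in>V. b v = m} \<le> card {v\<in>V. b v = m + j}" for j
    proof (induction j)
      case (Suc j)
      then show ?case using step[of "m + j"] that by simp
    qed simp
    have "b v \<noteq> m + Suc (Max (b ` V))" if "v \<in> V" for v
      using Max_ge[OF finite_imageI[OF fin(2)] imageI[OF that], of b] by simp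
    then have "{v\<in>V. b v = m + Suc (Max (b ` V))} = {}" by blast
    then have "card {v\<in>V. b v = m + Suc (Max (b ` V))} = 0" by (simp only: card.empty)
    then show ?thesis using le[of "Suc (Max (b ` V))"] by linarith
  qed
  moreover have "card {u\<in>U. a u = m} = 0" if "m \<ge> 1" for m
    using zero[OF that] valid that unfolding valid_labels_def by metis
  ultimately show "u \<in> U \<Longrightarrow> a u = 0" "v \<in> V \<Longrightarrow> b v = 0"
    using fin by (fastforce simp: Suc_le_eq)+
qed

text \<open>The labels are undone corner by corner. A point is placed where two steps with label 1
  meet: their labels become 0, and only a nucleation creates steps out of nothing.\<close>

lemma rsk_exists:
  assumes "finite U" "finite V" "lower S" "valid_labels U V S a b"
  obtains P where "P \<subseteq> S \<inter> U \<times> V" "inj_on fst P" "inj_on snd P"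
    "\<And>u. u \<in> U \<Longrightarrow> row_label P S u = a u" "\<And>v. v \<in> V \<Longrightarrow> col_label P S v = b v"
proof -
  have "\<exists>P. P \<subseteq> S \<inter> U \<times> V \<and> inj_on fst P \<and> inj_on snd P \<and> (\<forall>u\<in>U. row_label P S u = a u) \<and>
      (\<forall>v\<in>V. col_label P S v = b v)"
    using assms(3,4)
  proof (induction "card (S \<inter> U \<times> V)" arbitrary: S a b rule: less_induct)
    case less
    show ?case
    proof (cases "S \<inter> U \<times> V = {}")
      case True
      then show ?thesis using valid_labels_zero[OF assms(1,2) less.prems(2) True]
        by (intro exI[of _ "{}"]) (auto simp: row_label_def col_label_def)
    next
      case False
      obtain u v where uv: "(u, v) \<in> S" "u \<in> U" "v \<in> V" and corner: "S \<inter> U \<times> V \<inter> {u..} \<times> {v..} \<subseteq> {(u, v)}"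
        using obtain_corner[OF assms(1,2) False] by blast
      define S' where "S' = S - {u..} \<times> {v..}"
      define a' where "a' = a(u := (if a u = b v then a u - 1 else a u))"
      define b' where "b' = b(v := (if a u = b v then b v - 1 else b v))"
      have S': "lower S'" unfolding S'_def using lower_corner less.prems(1) .
      have D': "S' \<inter> U \<times> V = S \<inter> U \<times> V - {(u, v)}" using corner unfolding S'_def by auto
      have fin: "finite (S \<inter> U \<times> V)" using assms(1,2) by auto
      have lt: "card (S' \<inter> U \<times> V) < card (S \<inter> U \<times> V)"
        unfolding D' using uv fin by (intro card_Diff1_less) auto
      have val: "valid_labels U V S' a' b'"
        unfolding S'_def a'_def b'_def by (rule valid_labels_corner[OF assms(1,2) less.prems(1) uv corner less.prems(2)])
      obtain P0 where P0: "P0 \<subseteq> S' \<inter> U \<times> V" "inj_on fst P0" "inj_on snd P0"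
          "\<And>x. x \<in> U \<Longrightarrow> row_label P0 S' x = a' x" "\<And>y. y \<in> V \<Longrightarrow> col_label P0 S' y = b' y"
        using less.hyps[OF lt S' val] by auto
      define P where "P = (if a u = 1 \<and> b v = 1 then insert (u, v) P0 else P0)"
      have finP0: "finite P0" using P0(1) fin D' by (metis finite_Diff finite_subset)
      have sub: "P \<subseteq> S \<inter> U \<times> V" using P0(1) uv unfolding P_def S'_def by auto
      then have P: "finite P" "P \<subseteq> U \<times> V" using finite_subset[OF sub fin] by auto
      have PS': "P \<inter> S' = P0 \<inter> S'" unfolding P_def S'_def by auto
      note lab = label_lower[OF S' PS']
      have notin: "(u, v) \<notin> P0" using P0(1) D' by auto
      have "u \<notin> fst ` P0" "v \<notin> snd ` P0" if "a u = 1 \<and> b v = 1"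
      proof -
        have "P0 \<inter> S' = P0" using P0(1) by auto
        moreover have "row_label P0 S' u = 0" "col_label P0 S' v = 0"
          using P0(4)[OF uv(2)] P0(5)[OF uv(3)] that by (simp_all add: a'_def b'_def)
        ultimately show "u \<notin> fst ` P0" "v \<notin> snd ` P0"
          using less_row_label[OF generic_finite[OF finP0 P0(2,3)] finP0 S', of 0 u]
            less_col_label[OF generic_finite[OF finP0 P0(2,3)] finP0 S', of 0 v] by simp_all
      qed
      then have inj: "inj_on fst P" "inj_on snd P" using P0(2,3) unfolding P_def by auto
      note rule = corner_rule[OF P(1) inj P(2) less.prems(1) uv(1) corner, folded S'_def, unfolded lab]
      have uvP: "(u, v) \<in> P \<longleftrightarrow> a u = 1 \<and> b v = 1" using notin unfolding P_def by auto
      have "row_label P S x = a x" if "x \<in> U" for x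
        unfolding rule(1) P0(4)[OF that] P0(4)[OF uv(2)] P0(5)[OF uv(3)] uvP
        by (cases "a u = b v") (auto simp: a'_def b'_def)
      moreover have "col_label P S y = b y" if "y \<in> V" for y
        unfolding rule(2) P0(5)[OF that] P0(4)[OF uv(2)] P0(5)[OF uv(3)] uvP
        by (cases "a u = b v") (auto simp: a'_def b'_def)
      ultimately show ?thesis using sub inj by blast
    qed
  qed
  then show thesis using that by blast
qed

section \<open>Evolution of a single line\<close>

lemma Lim_at_left_const:
  fixes f :: "real \<Rightarrow> int"
  assumes "d > 0" "\<And>y. x - d < y \<Longrightarrow> y < x \<Longrightarrow> f y = c"
  shows "Lim (at_left x) f = c"
proof (rule tendsto_Lim)
  show "(f \<longlongrightarrow> c) (at_left x)"
    by (rule tendsto_eventually, rule eventually_at_leftI[of "x - d"]) (use assms in auto)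
qed simp

lemma Lim_at_right_const:
  fixes f :: "real \<Rightarrow> int"
  assumes "d > 0" "\<And>y. x < y \<Longrightarrow> y < x + d \<Longrightarrow> f y = c"
  shows "Lim (at_right x) f = c"
proof (rule tendsto_Lim)
  show "(f \<longlongrightarrow> c) (at_right x)"
    by (rule tendsto_eventually, rule eventually_at_rightI[of _ "x + d"]) (use assms in auto)
qed simp

text \<open>The exceptional set is named by the choice operator so that all \<open>x\<close> refer
  to the same finite set; \<open>finite_ups_downs\<close> draws the finiteness of the steps from
  this.\<close>

lemma piecewise_const_local:
  assumes "piecewise_const f"
  obtains d where "d > 0" "\<And>y. x - d < y \<Longrightarrow> y < x \<Longrightarrow> f y = Lim (at_left x) f"
    "\<And>y. x < y \<Longrightarrow> y < x + d \<Longrightarrow> f y = Lim (at_right x) f"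
    "Lim (at_left x) f \<noteq> f x \<or> Lim (at_right x) f \<noteq> f x \<Longrightarrow> x \<in> (SOME F. finite F \<and> (\<forall>a b. a \<le> b \<and> {a..b} \<inter> F = {} \<longrightarrow> f a = f b))"
proof -
  define F where "F = (SOME F. finite F \<and> (\<forall>a b. a \<le> b \<and> {a..b} \<inter> F = {} \<longrightarrow> f a = f b))"
  have "finite F \<and> (\<forall>a b. a \<le> b \<and> {a..b} \<inter> F = {} \<longrightarrow> f a = f b)"
    unfolding F_def by (rule someI_ex) (use assms in \<open>simp add: piecewise_const_def\<close>)
  then have F: "finite F" "\<And>a b. a \<le> b \<Longrightarrow> {a..b} \<inter> F = {} \<Longrightarrow> f a = f b" by auto
  obtain d where d: "d > 0" "\<And>y. y \<in> F \<Longrightarrow> y \<noteq> x \<Longrightarrow> d \<le> dist x y"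
    using finite_set_avoid[OF F(1), of x] by blast
  have avoid: "y \<notin> F" if "\<bar>y - x\<bar> < d" "y \<noteq> x" for y
    using d(2)[of y] that by (auto simp: dist_real_def)
  have eq: "f y = f z" if "y \<le> z" "x - d < y" "z < x + d" "z < x \<or> x < y \<or> x \<notin> F" for y z
  proof (rule F(2)[OF that(1)])
    have "w \<notin> F" if w: "y \<le> w" "w \<le> z" for w
    proof (cases "w = x")
      case True
      then have "\<not> z < x" "\<not> x < y" using w by auto
      then show ?thesis using \<open>z < x \<or> x < y \<or> x \<notin> F\<close> True by blast
    next
      case False
      have "\<bar>w - x\<bar> < d" using w \<open>x - d < y\<close> \<open>z < x + d\<close> by linarith
      then show ?thesis using avoid False by blast
    qed
    then show "{y..z} \<inter> F = {}" by auto
  qed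
  have left: "f y = f (x - d / 2)" if "x - d < y" "y < x" for y
  proof (cases "y \<le> x - d / 2")
    case True
    then show ?thesis by (rule eq) (use that d(1) in auto)
  next
    case False
    then have "f (x - d / 2) = f y" by (intro eq) (use that d(1) in auto)
    then show ?thesis ..
  qed
  have right: "f y = f (x + d / 2)" if "x < y" "y < x + d" for y
  proof (cases "y \<le> x + d / 2")
    case True
    then show ?thesis by (rule eq) (use that d(1) in auto)
  next
    case False
    then have "f (x + d / 2) = f y" by (intro eq) (use that d(1) in auto)
    then show ?thesis ..
  qed
  have Ll: "Lim (at_left x) f = f (x - d / 2)" using d(1) left by (rule Lim_at_left_const)
  have Lr: "Lim (at_right x) f = f (x + d / 2)" using d(1) right by (rule Lim_at_right_const)
  show thesis
  proof (rule that[OF d(1)])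
    show "f y = Lim (at_left x) f" if "x - d < y" "y < x" for y unfolding Ll using that by (rule left)
    show "f y = Lim (at_right x) f" if "x < y" "y < x + d" for y unfolding Lr using that by (rule right)
  next
    assume ne: "Lim (at_left x) f \<noteq> f x \<or> Lim (at_right x) f \<noteq> f x"
    have "x \<in> F"
    proof (rule ccontr)
      assume "x \<notin> F"
      then show False
        using eq[of x "x + d / 2"] eq[of "x - d / 2" x] d(1) ne unfolding Ll Lr by simp
    qed
    then show "x \<in> (SOME F. finite F \<and> (\<forall>a b. a \<le> b \<and> {a..b} \<inter> F = {} \<longrightarrow> f a = f b))"
      unfolding F_def .
  qed
qed

lemma finite_ups_downs:
  assumes "piecewise_const f"
  shows "finite (ups f)" "finite (downs f)"
proof -
  let ?F = "SOME F. finite F \<and> (\<forall>a b. a \<le> b \<and> {a..b} \<inter> F = {} \<longrightarrow> f a = f b)"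
  have "finite ?F \<and> (\<forall>a b. a \<le> b \<and> {a..b} \<inter> ?F = {} \<longrightarrow> f a = f b)"
    by (rule someI_ex) (use assms in \<open>simp add: piecewise_const_def\<close>)
  moreover have "x \<in> ?F" if "x \<in> ups f \<or> x \<in> downs f" for x
    by (rule piecewise_const_local[OF assms, of x]) (use that in \<open>auto simp: ups_def downs_def\<close>)
  ultimately show "finite (ups f)" "finite (downs f)" by (meson finite_subset subsetI)+
qed

text \<open>Upper semicontinuity explains the asymmetry: the line is already higher at an up-step
  and still higher at a down-step.\<close>

definition net_steps :: "real set \<Rightarrow> real set \<Rightarrow> real \<Rightarrow> int" where
  "net_steps A B x = int (card {y\<in>A. y \<le> x}) - int (card {y\<in>B. y < x})"

lemma net_steps_local:
  assumes "finite A" "finite B"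
  obtains d where "d > 0"
    "\<And>y. x - d < y \<Longrightarrow> y < x \<Longrightarrow> net_steps A B y = net_steps A B x - of_bool (x \<in> A)"
    "\<And>y. x < y \<Longrightarrow> y < x + d \<Longrightarrow> net_steps A B y = net_steps A B x - of_bool (x \<in> B)"
proof -
  obtain d where d: "d > 0" "\<And>y. y \<in> A \<union> B \<Longrightarrow> y \<noteq> x \<Longrightarrow> d \<le> dist x y"
    using finite_set_avoid[of "A \<union> B" x] assms by auto
  have avoid: "y \<notin> A" "y \<notin> B" if "\<bar>y - x\<bar> < d" "y \<noteq> x" for y
    using d(2)[of y] that by (auto simp: dist_real_def)
  show thesis
  proof (rule that[OF d(1)])
    fix y assume y: "x - d < y" "y < x"
    have no: "z \<notin> A" "z \<notin> B" if "y \<le> z" "z < x" for z using avoid[of z] that y by auto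
    have "{z\<in>A. z \<le> x} = {z\<in>A. z \<le> y} \<union> (if x \<in> A then {x} else {})"
      using no y by (auto simp: order_le_less) (metis less_imp_le not_le order_le_less)+
    moreover have "{z\<in>B. z < x} = {z\<in>B. z < y}" using no(2) y by (auto simp: not_le[symmetric])
    ultimately show "net_steps A B y = net_steps A B x - of_bool (x \<in> A)"
      using y assms unfolding net_steps_def by (auto simp: card_Un_disjoint card_insert_if)
  next
    fix y assume y: "x < y" "y < x + d"
    have no: "z \<notin> A" "z \<notin> B" if "x < z" "z \<le> y" for z using avoid[of z] that y by auto
    have "{z\<in>B. z < y} = {z\<in>B. z < x} \<union> (if x \<in> B then {x} else {})"
      using no y by (auto simp: order_le_less) (metis less_imp_le not_le order_le_less)+
    moreover have "{z\<in>A. z \<le> y} = {z\<in>A. z \<le> x}" using no(1) y by (auto simp: not_le[symmetric])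
    ultimately show "net_steps A B y = net_steps A B x - of_bool (x \<in> B)"
      using y assms unfolding net_steps_def by (auto simp: card_Un_disjoint card_insert_if)
  qed
qed

lemma net_steps_bot:
  assumes "finite A" "finite B"
  shows "\<forall>\<^sub>F x in at_bot. net_steps A B x = 0"
proof -
  define m where "m = Min (insert 0 (A \<union> B))"
  have m: "m \<le> y" if "y \<in> A \<union> B" for y unfolding m_def using assms that by (intro Min_le) auto
  have "net_steps A B x = 0" if "x \<le> m - 1" for x
  proof -
    have e: "{y\<in>A. y \<le> x} = {}" "{y\<in>B. y < x} = {}" using m that by force+
    show ?thesis unfolding net_steps_def e by simp
  qed
  then show ?thesis by (auto simp: eventually_at_bot_linorder intro!: exI[of _ "m - 1"])
qed

text \<open>The difference of both sides is locally constant.\<close>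
lemma height_line_net_steps:
  assumes h: "height_line f" and bot: "\<forall>\<^sub>F x in at_bot. f x = l"
  shows "f x = l + net_steps (ups f) (downs f) x"
proof -
  have pc: "piecewise_const f" using h unfolding height_line_def by blast
  define D where "D x = f x - net_steps (ups f) (downs f) x" for x
  have "D constant_on UNIV"
  proof (rule locally_constant_imp_constant)
    fix x
    obtain d1 where d1: "d1 > 0" "\<And>y. x - d1 < y \<Longrightarrow> y < x \<Longrightarrow> f y = Lim (at_left x) f"
      "\<And>y. x < y \<Longrightarrow> y < x + d1 \<Longrightarrow> f y = Lim (at_right x) f"
      by (rule piecewise_const_local[OF pc, of x], rule that) blast+
    obtain d2 where d2: "d2 > 0"
      "\<And>y. x - d2 < y \<Longrightarrow> y < x \<Longrightarrow> net_steps (ups f) (downs f) y = net_steps (ups f) (downs f) x - of_bool (x \<in> ups f)"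
      "\<And>y. x < y \<Longrightarrow> y < x + d2 \<Longrightarrow> net_steps (ups f) (downs f) y = net_steps (ups f) (downs f) x - of_bool (x \<in> downs f)"
      by (rule net_steps_local[OF finite_ups_downs[OF pc], of x], rule that) blast+
    have "f x - Lim (at_left x) f \<in> {0, 1}" "f x - Lim (at_right x) f \<in> {0, 1}"
      using h unfolding height_line_def by blast+
    then have L: "Lim (at_left x) f = f x - of_bool (x \<in> ups f)" "Lim (at_right x) f = f x - of_bool (x \<in> downs f)"
      unfolding ups_def downs_def by auto
    have *: "D y = D x" if y: "dist y x < min d1 d2" for y
    proof (cases y x rule: linorder_cases)
      case less
      then have "x - d1 < y" "x - d2 < y" using y by (auto simp: dist_real_def)
      then show ?thesis using d1(2)[OF _ less] d2(2)[OF _ less] unfolding D_def L by simp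
    next
      case greater
      then have "y < x + d1" "y < x + d2" using y by (auto simp: dist_real_def)
      then show ?thesis using d1(3)[OF greater] d2(3)[OF greater] unfolding D_def L by simp
    qed simp
    show "\<exists>T. openin (top_of_set UNIV) T \<and> x \<in> T \<and> (\<forall>y\<in>T. D y = D x)"
    proof (intro exI[of _ "ball x (min d1 d2)"] conjI ballI)
      show "x \<in> ball x (min d1 d2)" using d1(1) d2(1) by simp
    qed (auto intro: * simp: dist_commute)
  qed simp
  then obtain c where c: "\<And>x. D x = c" unfolding constant_on_def by auto
  have "\<forall>\<^sub>F x in at_bot. D x = l"
    using bot net_steps_bot[OF finite_ups_downs[OF pc]] by eventually_elim (simp add: D_def)
  then have "c = l" using c by (simp add: eventually_const_iff)
  then show ?thesis using c[of x] unfolding D_def by simp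
qed

lemma eventually_at_right_0I:
  fixes d :: real
  assumes "d > 0" "\<And>e. 0 < e \<Longrightarrow> e < d \<Longrightarrow> Q e \<longleftrightarrow> C"
  shows "(\<forall>\<^sub>F e in at_right 0. Q e) \<longleftrightarrow> C"
proof -
  have "\<forall>\<^sub>F e in at_right 0. Q e \<longleftrightarrow> C"
    using assms by (auto simp: eventually_at_right_field intro!: exI[of _ d])
  then have "(\<forall>\<^sub>F e in at_right 0. Q e) \<longleftrightarrow> (\<forall>\<^sub>F e in at_right (0::real). C)" by (rule eventually_subst)
  then show ?thesis by (simp add: eventually_const_iff)
qed

text \<open>Light-cone coordinates: an up-step moves along a line of constant \<open>s + x\<close>, a down-step along a
  line of constant \<open>s - x\<close>.\<close>
definition light_cone :: "real \<times> real \<Rightarrow> real \<times> real" where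
  "light_cone = (\<lambda>(x, s). (s + x, s - x))"

lemma light_cone_iff: "(s + x, s - x) \<in> light_cone ` N \<longleftrightarrow> (x, s) \<in> N"
proof
  assume "(s + x, s - x) \<in> light_cone ` N"
  then obtain x' s' where "(x', s') \<in> N" "s + x = s' + x'" "s - x = s' - x'"
    unfolding light_cone_def by auto
  moreover from this have "x' = x" "s' = s" by linarith+
  ultimately show "(x, s) \<in> N" by simp
qed (force simp: light_cone_def)

lemma light_cone_iff': "(u, v) \<in> light_cone ` N \<longleftrightarrow> ((u - v) / 2, (u + v) / 2) \<in> N"
  using light_cone_iff[of "(u + v) / 2" "(u - v) / 2" N] by (simp add: field_simps)

section \<open>The chain length obeys the dynamics\<close>

text \<open>Positivity of both coordinates is the forward cone
  \<open>\<bar>x\<bar> < s\<close>.\<close>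

definition good :: "(real \<times> real) set \<Rightarrow> bool" where
  "good P \<longleftrightarrow> generic P \<and> (\<forall>p\<in>P. 0 < fst p \<and> 0 < snd p)"

lemma good_generic: "good P \<Longrightarrow> generic P" by (simp add: good_def)

lemma good_rect_empty: "good P \<Longrightarrow> a \<le> 0 \<or> b \<le> 0 \<Longrightarrow> P \<inter> {..a} \<times> {..b} = {}"
  unfolding good_def by fastforce

lemma good_shadow: "good P \<Longrightarrow> good (shadow P)"
  unfolding good_def using generic_shadow shadow_points by (fastforce intro: less_trans)

lemma good_layer: "good P \<Longrightarrow> good (layer P k)"
  by (induction k) (auto simp: layer_Suc good_shadow)

definition line_height :: "int \<Rightarrow> (real \<times> real) set \<Rightarrow> real \<Rightarrow> real \<Rightarrow> int" where
  "line_height l P s x = l + int (len (P \<inter> {..s + x} \<times> {..s - x}))"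

context
  fixes P :: "(real \<times> real) set"
  assumes gen: "generic P"
begin

lemma Lim_line_height:
  "Lim (at_left x) (line_height l P s) = l + int (len (P \<inter> {..<s + x} \<times> {..s - x}))"
  "Lim (at_right x) (line_height l P s) = l + int (len (P \<inter> {..s + x} \<times> {..<s - x}))"
proof -
  obtain d where d: "d > 0" "gapped P (s + x) (s - x) d" by (rule gap[OF gen])
  note rg = rect_gap[OF d(2)]
  have "line_height l P s y = l + int (len (P \<inter> {..<s + x} \<times> {..s - x}))" if "x - d < y" "y < x" for y
    using rg(2)[of "s + x" "s + y" "s - y" "s - x - d"] that unfolding line_height_def by simp
  with d(1) show "Lim (at_left x) (line_height l P s) = l + int (len (P \<inter> {..<s + x} \<times> {..s - x}))"
    by (rule Lim_at_left_const)
  have "line_height l P s y = l + int (len (P \<inter> {..s + x} \<times> {..<s - x}))" if "x < y" "y < x + d" for y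
    using rg(3)[of "s + y" "s + x - d" "s - x" "s - y"] that unfolding line_height_def by simp
  with d(1) show "Lim (at_right x) (line_height l P s) = l + int (len (P \<inter> {..s + x} \<times> {..<s - x}))"
    by (rule Lim_at_right_const)
qed

lemma ups_line_height: "x \<in> ups (line_height l P s) \<longleftrightarrow> up_at P (s + x) (s - x)"
  using len_at_le(1,2)[OF gen, of "s + x" "s - x"] unfolding ups_def mem_Collect_eq Lim_line_height up_at_def
  by (auto simp: line_height_def)

lemma downs_line_height: "x \<in> downs (line_height l P s) \<longleftrightarrow> down_at P (s + x) (s - x)"
  using len_at_le(3,4)[OF gen, of "s + x" "s - x"] unfolding downs_def mem_Collect_eq Lim_line_height down_at_def
  by (auto simp: line_height_def)

lemma line_height_right:
  "(\<forall>\<^sub>F e in at_right 0. x - e \<in> ups (line_height l P (s + e))) \<longleftrightarrow> x \<in> ups (line_height l P s)"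
  "(\<forall>\<^sub>F e in at_right 0. x + e \<in> downs (line_height l P (s + e))) \<longleftrightarrow> x \<in> downs (line_height l P s)"
  "up_arrives (line_height l P) x s \<longleftrightarrow> up_before P (s + x) (s - x)"
  "down_arrives (line_height l P) x s \<longleftrightarrow> down_before P (s + x) (s - x)"
proof -
  obtain d where d: "d > 0" "gapped P (s + x) (s - x) d" by (rule gap[OF gen])
  note rg = rect_gap[OF d(2)]
  \<comment> \<open>Along the path of a step its own coordinate is fixed while the other one changes
    by \<open>2 * e\<close>, hence half the gap.\<close>
  have d2: "d / 2 > 0" using d(1) by simp
  show "(\<forall>\<^sub>F e in at_right 0. x - e \<in> ups (line_height l P (s + e))) \<longleftrightarrow> x \<in> ups (line_height l P s)"
  proof (rule eventually_at_right_0I[OF d2])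
    fix e :: real assume e: "0 < e" "e < d / 2"
    have eq: "s + e + (x - e) = s + x" "s + e - (x - e) = s - x + 2 * e" by auto
    have rg1: "P \<inter> {..s + x} \<times> {..s - x + 2 * e} = P \<inter> {..s + x} \<times> {..s - x}"
      by (rule rg(1)[of "s + x" "s + x - d" "s - x + 2 * e" "s - x - d"]) (use e in auto)
    have rg2: "P \<inter> {..<s + x} \<times> {..s - x + 2 * e} = P \<inter> {..<s + x} \<times> {..s - x}"
      by (rule rg(7)[of "s + x" "s + x - d" "s - x + 2 * e" "s - x - d"]) (use e in auto)
    show "x - e \<in> ups (line_height l P (s + e)) \<longleftrightarrow> x \<in> ups (line_height l P s)"
      unfolding ups_line_height up_at_def eq rg1 rg2 ..
  qed
  show "(\<forall>\<^sub>F e in at_right 0. x + e \<in> downs (line_height l P (s + e))) \<longleftrightarrow> x \<in> downs (line_height l P s)"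
  proof (rule eventually_at_right_0I[OF d2])
    fix e :: real assume e: "0 < e" "e < d / 2"
    have eq: "s + e + (x + e) = s + x + 2 * e" "s + e - (x + e) = s - x" by auto
    have rg1: "P \<inter> {..s + x + 2 * e} \<times> {..s - x} = P \<inter> {..s + x} \<times> {..s - x}"
      by (rule rg(1)[of "s + x + 2 * e" "s + x - d" "s - x" "s - x - d"]) (use e in auto)
    have rg2: "P \<inter> {..s + x + 2 * e} \<times> {..<s - x} = P \<inter> {..s + x} \<times> {..<s - x}"
      by (rule rg(9)[of "s + x + 2 * e" "s + x - d" "s - x" "s - x - d"]) (use e in auto)
    show "x + e \<in> downs (line_height l P (s + e)) \<longleftrightarrow> x \<in> downs (line_height l P s)"
      unfolding downs_line_height down_at_def eq rg1 rg2 ..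
  qed
  show "up_arrives (line_height l P) x s \<longleftrightarrow> up_before P (s + x) (s - x)"
    unfolding up_arrives_def
  proof (rule eventually_at_right_0I[OF d2])
    fix e :: real assume e: "0 < e" "e < d / 2"
    have eq: "s - e + (x + e) = s + x" "s - e - (x + e) = s - x - 2 * e" by auto
    have rg1: "P \<inter> {..s + x} \<times> {..s - x - 2 * e} = P \<inter> {..s + x} \<times> {..<s - x}"
      by (rule rg(3)[of "s + x" "s + x - d" "s - x" "s - x - 2 * e"]) (use e in auto)
    have rg2: "P \<inter> {..<s + x} \<times> {..s - x - 2 * e} = P \<inter> {..<s + x} \<times> {..<s - x}"
      by (rule rg(8)[of "s + x" "s + x - d" "s - x" "s - x - 2 * e"]) (use e in auto)
    show "x + e \<in> ups (line_height l P (s - e)) \<longleftrightarrow> up_before P (s + x) (s - x)"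
      unfolding ups_line_height up_at_def up_before_def eq rg1 rg2 ..
  qed
  show "down_arrives (line_height l P) x s \<longleftrightarrow> down_before P (s + x) (s - x)"
    unfolding down_arrives_def
  proof (rule eventually_at_right_0I[OF d2])
    fix e :: real assume e: "0 < e" "e < d / 2"
    have eq: "s - e + (x - e) = s + x - 2 * e" "s - e - (x - e) = s - x" by auto
    have rg1: "P \<inter> {..s + x - 2 * e} \<times> {..s - x} = P \<inter> {..<s + x} \<times> {..s - x}"
      by (rule rg(2)[of "s + x" "s + x - 2 * e" "s - x" "s - x - d"]) (use e in auto)
    have rg2: "P \<inter> {..s + x - 2 * e} \<times> {..<s - x} = P \<inter> {..<s + x} \<times> {..<s - x}"
      by (rule rg(10)[of "s + x" "s + x - 2 * e" "s - x" "s - x - d"]) (use e in auto)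
    show "x - e \<in> downs (line_height l P (s - e)) \<longleftrightarrow> down_before P (s + x) (s - x)"
      unfolding downs_line_height down_at_def down_before_def eq rg1 rg2 ..
  qed
qed

lemma height_line_line_height:
  assumes pos: "\<And>p. p \<in> P \<Longrightarrow> 0 < fst p \<and> 0 < snd p"
  shows "height_line (line_height l P s)"
proof -
  let ?R = "P \<inter> {..2 * s} \<times> {..2 * s}"
  \<comment> \<open>By positivity a point matters at time \<open>s\<close> only if both of its
    coordinates are at most \<open>2 * s\<close>; \<open>F\<close> holds the positions of the rays
    of these points.\<close>
  define F where "F = (\<lambda>p. fst p - s) ` ?R \<union> (\<lambda>p. s - snd p) ` ?R"
  have "finite F" unfolding F_def using finite_rects(1)[OF gen] by simp
  moreover have "line_height l P s a = line_height l P s b" if ab: "a \<le> b" "{a..b} \<inter> F = {}" for a b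
  proof -
    have "(u, v) \<in> {..s + a} \<times> {..s - a} \<longleftrightarrow> (u, v) \<in> {..s + b} \<times> {..s - b}" if uv: "(u, v) \<in> P" for u v
    proof (cases "u \<le> 2 * s \<and> v \<le> 2 * s")
      case True
      then have "u - s \<in> F" "s - v \<in> F" using uv unfolding F_def by force+
      then have "u - s \<notin> {a..b}" "s - v \<notin> {a..b}" using ab by blast+
      then show ?thesis using ab(1) by auto
    next
      case False
      then show ?thesis using pos[OF uv] by auto
    qed
    then have "P \<inter> {..s + a} \<times> {..s - a} = P \<inter> {..s + b} \<times> {..s - b}" by auto
    then show ?thesis unfolding line_height_def by simp
  qed
  ultimately have "piecewise_const (line_height l P s)" unfolding piecewise_const_def by blast
  moreover have "line_height l P s x - Lim (at_left x) (line_height l P s) \<in> {0, 1}"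
      "line_height l P s x - Lim (at_right x) (line_height l P s) \<in> {0, 1}" for x
    using len_at_le(1-4)[OF gen, of "s + x" "s - x"] unfolding Lim_line_height by (auto simp: line_height_def)
  ultimately show ?thesis unfolding height_line_def by blast
qed

end

lemma line_evolution_line_height:
  assumes good: "good (light_cone ` N)"
  shows "line_evolution l N (line_height l (light_cone ` N))"
proof -
  let ?P = "light_cone ` N"
  have gen: "generic ?P" and pos: "\<And>p. p \<in> ?P \<Longrightarrow> 0 < fst p \<and> 0 < snd p"
    using good unfolding good_def by blast+
  have flat: "line_height l ?P s x = l" if "x \<le> - s \<or> s \<le> x" for s x
    using good_rect_empty[OF good, of "s + x" "s - x"] that unfolding line_height_def by auto
  show ?thesis
    unfolding line_evolution_def line_height_right[OF gen] unfolding ups_line_height[OF gen] downs_line_height[OF gen]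
  proof (intro conjI allI impI)
    show "line_height l ?P 0 x = l" for x using flat[of x 0] by linarith
    show "height_line (line_height l ?P s)" for s by (rule height_line_line_height[OF gen pos])
    show "\<forall>\<^sub>F x in at_bot. line_height l ?P s x = l" for s
      using flat[of _ s] by (auto simp: eventually_at_bot_linorder)
    show "up_at ?P (s + x) (s - x) \<longleftrightarrow> (x, s) \<in> N \<or> up_before ?P (s + x) (s - x) \<and> \<not> down_before ?P (s + x) (s - x)" for s x
      using up_at_iff[OF gen] light_cone_iff by simp
    show "down_at ?P (s + x) (s - x) \<longleftrightarrow> (x, s) \<in> N \<or> down_before ?P (s + x) (s - x) \<and> \<not> up_before ?P (s + x) (s - x)" for s x
      using down_at_iff[OF gen] light_cone_iff by simp
  qed auto
qed

lemma annihilations_line_height: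
  assumes "good P"
  shows "light_cone ` annihilations (line_height l P) = shadow P"
proof -
  have gen: "generic P" using assms by (rule good_generic)
  have "(u, v) \<in> light_cone ` annihilations (line_height l P) \<longleftrightarrow> (u, v) \<in> shadow P" for u v
  proof -
    have "0 < u \<and> 0 < v" if "(u, v) \<in> shadow P" using good_shadow[OF assms] that unfolding good_def by force
    moreover have "(u + v) / 2 + (u - v) / 2 = u" "(u + v) / 2 - (u - v) / 2 = v" by (simp_all add: field_simps)
    ultimately show ?thesis
      unfolding light_cone_iff' annihilations_def mem_Collect_eq prod.case line_height_right(3,4)[OF gen]
      by (auto simp: shadow_def)
  qed
  then show ?thesis by auto
qed

section \<open>Uniqueness of the evolution\<close>

text \<open>Induction over the reals, backwards in time. At the infimum of the times from which on
  \<open>Q\<close> has held, \<open>right\<close> gives \<open>Q\<close> itself, and without a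
  nucleation there \<open>left\<close> would extend the interval further back.\<close>

lemma trace_back:
  fixes Q Nuc :: "real \<Rightarrow> bool"
  assumes right: "\<And>s. s \<ge> 0 \<Longrightarrow> (\<forall>\<^sub>F e in at_right 0. Q (s + e)) \<Longrightarrow> Q s"
    and left: "\<And>s. s > 0 \<Longrightarrow> Q s \<Longrightarrow> Nuc s \<or> (\<forall>\<^sub>F e in at_right 0. Q (s - e))"
    and zero: "\<not> Q 0" and s: "0 \<le> s" "Q s"
  obtains s0 where "0 < s0" "s0 \<le> s" "Nuc s0" "\<And>r. s0 \<le> r \<Longrightarrow> r \<le> s \<Longrightarrow> Q r"
proof -
  define A where "A = {r. 0 \<le> r \<and> r \<le> s \<and> (\<forall>r'. r \<le> r' \<and> r' \<le> s \<longrightarrow> Q r')}"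
  have sA: "s \<in> A" unfolding A_def using s by (auto dest: antisym)
  have bdd: "bdd_below A" unfolding A_def by (rule bdd_belowI[of _ 0]) auto
  define m where "m = Inf A"
  have ms: "m \<le> s" unfolding m_def by (rule cInf_lower[OF sA bdd])
  have m0: "0 \<le> m" unfolding m_def by (rule cInf_greatest) (use sA in \<open>auto simp: A_def\<close>)
  have after: "Q r" if "m < r" "r \<le> s" for r
  proof -
    have "A \<noteq> {}" using sA by blast
    then obtain a where "a \<in> A" "a < r" using cInf_lessD[of A r] \<open>m < r\<close> unfolding m_def by blast
    then show ?thesis using that unfolding A_def by auto
  qed
  have Qm: "Q m"
  proof (cases "m = s")
    case False
    then have "m < s" using ms by simp
    have "\<forall>\<^sub>F e in at_right 0. Q (m + e)"
      by (rule eventually_at_rightI[of _ "s - m"]) (use after \<open>m < s\<close> in auto)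
    then show ?thesis by (rule right[OF m0])
  qed (use s in simp)
  have "m > 0" using m0 Qm zero by (cases "m = 0") auto
  have "Nuc m"
  proof (rule ccontr)
    assume "\<not> Nuc m"
    then obtain d where d: "d > 0" "\<And>e. 0 < e \<Longrightarrow> e < d \<Longrightarrow> Q (m - e)"
      using left[OF \<open>m > 0\<close> Qm] unfolding eventually_at_right_field by auto
    define a where "a = m - min d m / 2"
    have a: "0 \<le> a" "a < m" "m - d < a" unfolding a_def using d(1) \<open>m > 0\<close> by (auto simp: min_def field_simps)
    have "Q r" if "a \<le> r" "r \<le> s" for r
    proof (cases r m rule: linorder_cases)
      case less
      then show ?thesis using d(2)[of "m - r"] that a by simp
    qed (use after Qm that in auto)
    then have "a \<in> A" unfolding A_def using a ms by auto
    then have "m \<le> a" unfolding m_def by (rule cInf_lower[OF _ bdd])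
    then show False using a by simp
  qed
  moreover have "Q r" if "m \<le> r" "r \<le> s" for r using after[of r] Qm that by (cases "r = m") auto
  ultimately show thesis using that \<open>m > 0\<close> ms by blast
qed

text \<open>The infimum of the times at which \<open>Q\<close> fails is itself such a time, as
  \<open>Q\<close> would otherwise persist beyond it.\<close>

lemma first_loss:
  fixes Q :: "real \<Rightarrow> bool"
  assumes right: "\<And>s. s \<ge> 0 \<Longrightarrow> Q s \<Longrightarrow> (\<forall>\<^sub>F e in at_right 0. Q (s + e))"
    and s: "0 \<le> s0" "s0 \<le> s" "Q s0" "\<not> Q s"
  shows "\<exists>s1>s0. s1 \<le> s \<and> \<not> Q s1 \<and> (\<forall>r. s0 \<le> r \<and> r < s1 \<longrightarrow> Q r)"
proof -
  define A where "A = {r. s0 \<le> r \<and> r \<le> s \<and> \<not> Q r}"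
  have sA: "s \<in> A" unfolding A_def using s by auto
  have bdd: "bdd_below A" unfolding A_def by (rule bdd_belowI[of _ s0]) auto
  define m where "m = Inf A"
  have ms: "m \<le> s" unfolding m_def by (rule cInf_lower[OF sA bdd])
  have m0: "s0 \<le> m" unfolding m_def by (rule cInf_greatest) (use sA in \<open>auto simp: A_def\<close>)
  have before: "Q r" if "s0 \<le> r" "r < m" for r
  proof (rule ccontr)
    assume "\<not> Q r"
    then have "r \<in> A" unfolding A_def using that ms by auto
    then show False using cInf_lower[OF _ bdd] that unfolding m_def by fastforce
  qed
  have "\<not> Q m"
  proof
    assume "Q m"
    then have "\<forall>\<^sub>F e in at_right 0. Q (m + e)" using right m0 s by auto
    then obtain d where d: "d > 0" "\<And>e. 0 < e \<Longrightarrow> e < d \<Longrightarrow> Q (m + e)"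
      unfolding eventually_at_right_field by auto
    have "m + d \<le> Inf A"
    proof (rule cInf_greatest)
      fix r assume r: "r \<in> A"
      then have "m \<le> r" unfolding m_def by (rule cInf_lower[OF _ bdd])
      moreover have "r \<noteq> m" using r \<open>Q m\<close> unfolding A_def by auto
      moreover have "\<not> r < m + d" if "m < r" using d(2)[of "r - m"] r that unfolding A_def by auto
      ultimately show "m + d \<le> r" by linarith
    qed (use sA in auto)
    then show False using d(1) unfolding m_def by simp
  qed
  moreover have "s0 < m" using \<open>\<not> Q m\<close> s(3) m0 by (cases "s0 = m") auto
  ultimately show ?thesis using ms before by blast
qed

context
  fixes l :: int and N :: "(real \<times> real) set" and g :: "real \<Rightarrow> real \<Rightarrow> int"
  assumes ev: "line_evolution l N g"
begin

lemma evolution_start: "x \<notin> ups (g 0)" "x \<notin> downs (g 0)"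
proof -
  have "g 0 = (\<lambda>_. l)" using ev unfolding line_evolution_def by auto
  moreover have "Lim (at_left x) (\<lambda>_. l) = l" "Lim (at_right x) (\<lambda>_. l) = l"
    by (auto intro: tendsto_Lim)
  ultimately show "x \<notin> ups (g 0)" "x \<notin> downs (g 0)" unfolding ups_def downs_def by auto
qed

lemma evolution_right:
  assumes "s \<ge> 0"
  shows "x \<in> ups (g s) \<longleftrightarrow> (\<forall>\<^sub>F e in at_right 0. x - e \<in> ups (g (s + e)))"
    "x \<in> downs (g s) \<longleftrightarrow> (\<forall>\<^sub>F e in at_right 0. x + e \<in> downs (g (s + e)))"
  using ev assms unfolding line_evolution_def by blast+

lemma evolution_steps:
  assumes "s > 0"
  shows "x \<in> ups (g s) \<longleftrightarrow> (x, s) \<in> N \<or> up_arrives g x s \<and> \<not> down_arrives g x s"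
    "x \<in> downs (g s) \<longleftrightarrow> (x, s) \<in> N \<or> down_arrives g x s \<and> \<not> up_arrives g x s"
  using ev assms unfolding line_evolution_def by blast+

lemma trace_up:
  assumes "s \<ge> 0" "x \<in> ups (g s)"
  obtains s0 where "0 < s0" "s0 \<le> s" "(s + x - s0, s0) \<in> N" "\<And>r. s0 \<le> r \<Longrightarrow> r \<le> s \<Longrightarrow> s + x - r \<in> ups (g r)"
proof (rule trace_back[where Q = "\<lambda>r. s + x - r \<in> ups (g r)" and Nuc = "\<lambda>r. (s + x - r, r) \<in> N" and s = s])
  show "s + x - r \<in> ups (g r)" if "0 \<le> r" "\<forall>\<^sub>F e in at_right 0. s + x - (r + e) \<in> ups (g (r + e))" for r
    using that evolution_right(1)[of r "s + x - r"] by (simp add: diff_diff_eq)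
  show "(s + x - r, r) \<in> N \<or> (\<forall>\<^sub>F e in at_right 0. s + x - (r - e) \<in> ups (g (r - e)))"
    if "0 < r" "s + x - r \<in> ups (g r)" for r
    using that evolution_steps(1)[of r "s + x - r"] unfolding up_arrives_def by (auto simp: algebra_simps)
qed (use assms evolution_start that in auto)

lemma trace_down:
  assumes "s \<ge> 0" "x \<in> downs (g s)"
  obtains s0 where "0 < s0" "s0 \<le> s" "(s0 - (s - x), s0) \<in> N" "\<And>r. s0 \<le> r \<Longrightarrow> r \<le> s \<Longrightarrow> r - (s - x) \<in> downs (g r)"
proof (rule trace_back[where Q = "\<lambda>r. r - (s - x) \<in> downs (g r)" and Nuc = "\<lambda>r. (r - (s - x), r) \<in> N" and s = s])
  show "r - (s - x) \<in> downs (g r)" if "0 \<le> r" "\<forall>\<^sub>F e in at_right 0. r + e - (s - x) \<in> downs (g (r + e))" for r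
    using that evolution_right(2)[of r "r - (s - x)"] by (simp add: algebra_simps)
  show "(r - (s - x), r) \<in> N \<or> (\<forall>\<^sub>F e in at_right 0. r - e - (s - x) \<in> downs (g (r - e)))"
    if "0 < r" "r - (s - x) \<in> downs (g r)" for r
    using that evolution_steps(2)[of r "r - (s - x)"] unfolding down_arrives_def by (auto simp: algebra_simps)
qed (use assms evolution_start that in auto)

text \<open>On its ray, an up-step can vanish only at the arrival of a down-step; \<open>s1\<close>
  is the first time at which it is missing.\<close>

lemma lose_up:
  assumes "0 < s0" "s0 \<le> s" "(s + x - s0, s0) \<in> N" "x \<notin> ups (g s)"
  obtains s1 where "s0 < s1" "s1 \<le> s" "down_arrives g (s + x - s1) s1"
proof -
  have Q0: "s + x - s0 \<in> ups (g s0)" using evolution_steps(1)[of s0] assms by blast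
  have "\<forall>\<^sub>F e in at_right 0. s + x - (r + e) \<in> ups (g (r + e))" if "0 \<le> r" "s + x - r \<in> ups (g r)" for r
    using that evolution_right(1)[of r "s + x - r"] by (simp add: diff_diff_eq)
  then have "\<exists>s1>s0. s1 \<le> s \<and> s + x - s1 \<notin> ups (g s1) \<and> (\<forall>r. s0 \<le> r \<and> r < s1 \<longrightarrow> s + x - r \<in> ups (g r))"
    by (rule first_loss[where Q = "\<lambda>r. s + x - r \<in> ups (g r)"]) (use assms Q0 in auto)
  then obtain s1 where s1: "s0 < s1" "s1 \<le> s" "s + x - s1 \<notin> ups (g s1)"
      "\<And>r. s0 \<le> r \<Longrightarrow> r < s1 \<Longrightarrow> s + x - r \<in> ups (g r)"
    by blast
  have "up_arrives g (s + x - s1) s1" unfolding up_arrives_def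
  proof (rule eventually_at_rightI[of _ "s1 - s0"])
    fix e assume "e \<in> {0<..<s1 - s0}"
    moreover have "s + x - s1 + e = s + x - (s1 - e)" by simp
    ultimately show "s + x - s1 + e \<in> ups (g (s1 - e))" using s1(4)[of "s1 - e"] by (metis greaterThanLessThan_iff
          diff_less_eq less_diff_eq less_add_same_cancel1 add.commute less_imp_le)
  qed (use s1 in auto)
  then have "down_arrives g (s + x - s1) s1" using evolution_steps(1)[of s1 "s + x - s1"] s1 assms by auto
  then show thesis using that s1 by blast
qed

lemma lose_down:
  assumes "0 < s0" "s0 \<le> s" "(s0 - (s - x), s0) \<in> N" "x \<notin> downs (g s)"
  obtains s1 where "s0 < s1" "s1 \<le> s" "up_arrives g (s1 - (s - x)) s1"
proof -
  have Q0: "s0 - (s - x) \<in> downs (g s0)" using evolution_steps(2)[of s0] assms by blast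
  have "\<forall>\<^sub>F e in at_right 0. r + e - (s - x) \<in> downs (g (r + e))" if "0 \<le> r" "r - (s - x) \<in> downs (g r)" for r
    using that evolution_right(2)[of r "r - (s - x)"] by (simp add: algebra_simps)
  then have "\<exists>s1>s0. s1 \<le> s \<and> s1 - (s - x) \<notin> downs (g s1) \<and> (\<forall>r. s0 \<le> r \<and> r < s1 \<longrightarrow> r - (s - x) \<in> downs (g r))"
    by (rule first_loss[where Q = "\<lambda>r. r - (s - x) \<in> downs (g r)"]) (use assms Q0 in auto)
  then obtain s1 where s1: "s0 < s1" "s1 \<le> s" "s1 - (s - x) \<notin> downs (g s1)"
      "\<And>r. s0 \<le> r \<Longrightarrow> r < s1 \<Longrightarrow> r - (s - x) \<in> downs (g r)"
    by blast
  have "down_arrives g (s1 - (s - x)) s1" unfolding down_arrives_def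
  proof (rule eventually_at_rightI[of _ "s1 - s0"])
    fix e assume "e \<in> {0<..<s1 - s0}"
    moreover have "s1 - (s - x) - e = s1 - e - (s - x)" by simp
    ultimately show "s1 - (s - x) - e \<in> downs (g (s1 - e))" using s1(4)[of "s1 - e"] by (metis greaterThanLessThan_iff
          diff_less_eq less_diff_eq less_add_same_cancel1 add.commute less_imp_le)
  qed (use s1 in auto)
  then have "up_arrives g (s1 - (s - x)) s1" using evolution_steps(2)[of s1 "s1 - (s - x)"] s1 assms by auto
  then show thesis using that s1 by blast
qed

end

text \<open>A disagreement of the up-steps of two evolutions with the same nucleations is caused by an earlier
  disagreement of their down-steps, just before a crossing time.\<close>
lemma up_disagreement:
  assumes ev: "line_evolution l N g" "line_evolution l N g'" and gen: "generic (light_cone ` N)"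
    and s: "0 \<le> s" and x: "x \<in> ups (g s)" "x \<notin> ups (g' s)"
  obtains s' x' s0 s1 r r' where "0 \<le> s'" "s' < s1" "s1 \<le> s" "x' \<in> downs (g' s')" "x' \<notin> downs (g s')"
    "(r, s0) \<in> N" "s0 \<le> s" "\<exists>s2\<le>s. (r', s2) \<in> N \<and> s2 - r' + s0 + r = 2 * s1"
proof -
  obtain s0 where s0: "0 < s0" "s0 \<le> s" "(s + x - s0, s0) \<in> N" "\<And>r. s0 \<le> r \<Longrightarrow> r \<le> s \<Longrightarrow> s + x - r \<in> ups (g r)"
    using trace_up[OF ev(1) s x(1)] by metis
  obtain s1 where s1: "s0 < s1" "s1 \<le> s" "down_arrives g' (s + x - s1) s1"
    using lose_up[OF ev(2) s0(1-3) x(2)] by metis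
  \<comment> \<open>The ray has its only nucleation at \<open>s0\<close>. So in \<open>g\<close>,
    where the step survives \<open>s1\<close>, no down-step arrives there, although one does in
    \<open>g'\<close>.\<close>
  have "(s + x - s1, s1) \<notin> N"
  proof
    assume "(s + x - s1, s1) \<in> N"
    then have "(s1 + (s + x - s1), s1 - (s + x - s1)) \<in> light_cone ` N" "(s0 + (s + x - s0), s0 - (s + x - s0)) \<in> light_cone ` N"
      using s0(3) light_cone_iff by blast+
    then have "(s + x, 2 * s1 - (s + x)) \<in> light_cone ` N" "(s + x, 2 * s0 - (s + x)) \<in> light_cone ` N"
      by (simp_all add: algebra_simps)
    then have "2 * s1 - (s + x) = 2 * s0 - (s + x)" by (rule fst_unique[OF gen, rotated])
    then show False using s1(1) by simp
  qed
  then have "\<not> down_arrives g (s + x - s1) s1"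
    using s0(4)[of s1] s1 s0(1) evolution_steps(1)[OF ev(1), of s1 "s + x - s1"] by auto
  moreover obtain d where d: "d > 0" "\<And>e. 0 < e \<Longrightarrow> e < d \<Longrightarrow> s + x - s1 - e \<in> downs (g' (s1 - e))"
    using s1(3) unfolding down_arrives_def eventually_at_right_field by auto
  ultimately obtain e where e: "0 < e" "e < min d s1" "s + x - s1 - e \<notin> downs (g (s1 - e))"
    using s0(1) s1(1) unfolding down_arrives_def eventually_at_right_field
    by (metis less_trans min_less_iff_conj)
  define s' where "s' = s1 - e"
  define x' where "x' = s + x - s1 - e"
  have s': "0 \<le> s'" "s' < s1" using e unfolding s'_def by auto
  have x': "x' \<in> downs (g' s')" "x' \<notin> downs (g s')" using e d(2)[of e] unfolding s'_def x'_def by auto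
  obtain s2 where s2: "s2 \<le> s'" "(s2 - (s' - x'), s2) \<in> N"
    using trace_down[OF ev(2) s'(1) x'(1)] by metis
  show thesis
  proof (rule that[OF s' s1(2) x' s0(3,2)])
    \<comment> \<open>\<open>2 * s1\<close> is the \<open>u\<close>-coordinate of the nucleation of
      the up-step plus the \<open>v\<close>-coordinate of that of the down-step, so
      \<open>s1\<close> is the crossing time of two rays from nucleations.\<close>
    show "\<exists>s2'\<le>s. (s2 - (s' - x'), s2') \<in> N \<and> s2' - (s2 - (s' - x')) + s0 + (s + x - s0) = 2 * s1"
      using s2 s' s1 by (intro exI[of _ s2]) (auto simp: s'_def x'_def)
  qed
qed

lemma down_disagreement:
  assumes ev: "line_evolution l N g" "line_evolution l N g'" and gen: "generic (light_cone ` N)"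
    and s: "0 \<le> s" and x: "x \<in> downs (g s)" "x \<notin> downs (g' s)"
  obtains s' x' s0 s1 r r' where "0 \<le> s'" "s' < s1" "s1 \<le> s" "x' \<in> ups (g' s')" "x' \<notin> ups (g s')"
    "(r, s0) \<in> N" "s0 \<le> s" "\<exists>s2\<le>s. (r', s2) \<in> N \<and> s2 + r' + s0 - r = 2 * s1"
proof -
  obtain s0 where s0: "0 < s0" "s0 \<le> s" "(s0 - (s - x), s0) \<in> N" "\<And>r. s0 \<le> r \<Longrightarrow> r \<le> s \<Longrightarrow> r - (s - x) \<in> downs (g r)"
    using trace_down[OF ev(1) s x(1)] by metis
  obtain s1 where s1: "s0 < s1" "s1 \<le> s" "up_arrives g' (s1 - (s - x)) s1"
    using lose_down[OF ev(2) s0(1-3) x(2)] by metis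
  have "(s1 - (s - x), s1) \<notin> N"
  proof
    assume "(s1 - (s - x), s1) \<in> N"
    then have "(s1 + (s1 - (s - x)), s1 - (s1 - (s - x))) \<in> light_cone ` N" "(s0 + (s0 - (s - x)), s0 - (s0 - (s - x))) \<in> light_cone ` N"
      using s0(3) light_cone_iff by blast+
    then have "(2 * s1 - (s - x), s - x) \<in> light_cone ` N" "(2 * s0 - (s - x), s - x) \<in> light_cone ` N"
      by (simp_all add: algebra_simps)
    then have "2 * s1 - (s - x) = 2 * s0 - (s - x)" by (rule snd_unique[OF gen, rotated])
    then show False using s1(1) by simp
  qed
  then have "\<not> up_arrives g (s1 - (s - x)) s1"
    using s0(4)[of s1] s1 s0(1) evolution_steps(2)[OF ev(1), of s1 "s1 - (s - x)"] by auto
  moreover obtain d where d: "d > 0" "\<And>e. 0 < e \<Longrightarrow> e < d \<Longrightarrow> s1 - (s - x) + e \<in> ups (g' (s1 - e))"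
    using s1(3) unfolding up_arrives_def eventually_at_right_field by auto
  ultimately obtain e where e: "0 < e" "e < min d s1" "s1 - (s - x) + e \<notin> ups (g (s1 - e))"
    using s0(1) s1(1) unfolding up_arrives_def eventually_at_right_field
    by (metis less_trans min_less_iff_conj)
  define s' where "s' = s1 - e"
  define x' where "x' = s1 - (s - x) + e"
  have s': "0 \<le> s'" "s' < s1" using e unfolding s'_def by auto
  have x': "x' \<in> ups (g' s')" "x' \<notin> ups (g s')" using e d(2)[of e] unfolding s'_def x'_def by auto
  obtain s2 where s2: "s2 \<le> s'" "(s' + x' - s2, s2) \<in> N"
    using trace_up[OF ev(2) s'(1) x'(1)] by metis
  show thesis
  proof (rule that[OF s' s1(2) x' s0(3,2)])
    show "\<exists>s2'\<le>s. (s' + x' - s2, s2') \<in> N \<and> s2' + (s' + x' - s2) + s0 - (s0 - (s - x)) = 2 * s1"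
      using s2 s' s1 by (intro exI[of _ s2]) (auto simp: s'_def x'_def)
  qed
qed

lemma good_finite_before:
  assumes "good (light_cone ` N)"
  shows "finite {p\<in>N. snd p \<le> T}"
proof -
  have "light_cone ` {p\<in>N. snd p \<le> T} \<subseteq> light_cone ` N \<inter> {..2 * T} \<times> {..2 * T}"
  proof
    fix q assume "q \<in> light_cone ` {p\<in>N. snd p \<le> T}"
    then obtain x s where q: "q = (s + x, s - x)" "(x, s) \<in> N" "s \<le> T" unfolding light_cone_def by auto
    then have "q \<in> light_cone ` N" using light_cone_iff by blast
    moreover from this have "0 < fst q \<and> 0 < snd q" using assms unfolding good_def by blast
    ultimately show "q \<in> light_cone ` N \<inter> {..2 * T} \<times> {..2 * T}" using q by auto
  qed
  then have "finite (light_cone ` {p\<in>N. snd p \<le> T})"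
    using finite_rects(1)[OF good_generic[OF assms]] by (rule finite_subset)
  moreover have "inj light_cone" unfolding light_cone_def by (rule injI) auto
  ultimately show ?thesis by (meson finite_imageD inj_on_subset subset_UNIV)
qed

text \<open>Descent: a disagreement at time \<open>r\<close> comes from one of the opposite kind at
  an earlier \<open>s'\<close>, with a crossing time in between. The finite set \<open>K\<close>
  contains these crossing times, so the number of them up to \<open>r\<close> decreases.\<close>

lemma evolution_steps_unique:
  assumes "line_evolution l N g" "line_evolution l N g'" and good: "good (light_cone ` N)" and "0 \<le> s"
  shows "ups (g s) = ups (g' s) \<and> downs (g s) = downs (g' s)"
proof -
  define T where "T = s"
  define NT where "NT = {p\<in>N. snd p \<le> T}"
  define K where "K = (\<lambda>(p, q). (snd q - fst q + snd p + fst p) / 2) ` (NT \<times> NT)"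
  have finK: "finite K" unfolding K_def NT_def using good_finite_before[OF good] by auto
  have K: "s1 \<in> K" if "(a, b) \<in> N" "b \<le> T" "(c, d) \<in> N" "d \<le> T" "d - c + b + a = 2 * s1" for a b c d s1
  proof -
    have "((a, b), (c, d)) \<in> NT \<times> NT" using that unfolding NT_def by auto
    then have "(\<lambda>(p, q). (snd q - fst q + snd p + fst p) / 2) ((a, b), (c, d)) \<in> K" unfolding K_def by (rule imageI)
    then show ?thesis using that(5) by simp
  qed
  have gen: "generic (light_cone ` N)" using good by (rule good_generic)
  have card_less: "card {k\<in>K. k \<le> s'} < card {k\<in>K. k \<le> r}" if "s1 \<in> K" "s' < s1" "s1 \<le> r" for s1 s' r
  proof (rule psubset_card_mono)
    have "s1 \<in> {k\<in>K. k \<le> r}" "s1 \<notin> {k\<in>K. k \<le> s'}" "{k\<in>K. k \<le> s'} \<subseteq> {k\<in>K. k \<le> r}" using that by auto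
    then show "{k\<in>K. k \<le> s'} \<subset> {k\<in>K. k \<le> r}" by blast
  qed (use finK in simp)
  have *: "(x \<in> ups (g r) \<longleftrightarrow> x \<in> ups (g' r)) \<and> (x \<in> downs (g r) \<longleftrightarrow> x \<in> downs (g' r))"
    if "line_evolution l N g" "line_evolution l N g'" "0 \<le> r" "r \<le> T" for r x g g'
    using that
  proof (induction "card {k\<in>K. k \<le> r}" arbitrary: r x g g' rule: less_induct)
    case less
    have up: False if ev: "line_evolution l N g" "line_evolution l N g'" and x: "x \<in> ups (g r)" "x \<notin> ups (g' r)" for g g' x
    proof -
      obtain s' x' s0 s1 a c where *: "0 \<le> s'" "s' < s1" "s1 \<le> r" "x' \<in> downs (g' s')" "x' \<notin> downs (g s')"
        "(a, s0) \<in> N" "s0 \<le> r" "\<exists>s2\<le>r. (c, s2) \<in> N \<and> s2 - c + s0 + a = 2 * s1"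
        using up_disagreement[OF ev gen less.prems(3) x] by metis
      then have "s1 \<in> K" using K less.prems(4) by (meson order_trans)
      then have "card {k\<in>K. k \<le> s'} < card {k\<in>K. k \<le> r}" using *(2,3) by (rule card_less)
      then show False using less.hyps[OF _ ev *(1)] * less.prems(4) by (meson less_imp_le order_trans)
    qed
    have down: False if ev: "line_evolution l N g" "line_evolution l N g'" and x: "x \<in> downs (g r)" "x \<notin> downs (g' r)" for g g' x
    proof -
      obtain s' x' s0 s1 a c where *: "0 \<le> s'" "s' < s1" "s1 \<le> r" "x' \<in> ups (g' s')" "x' \<notin> ups (g s')"
        "(a, s0) \<in> N" "s0 \<le> r" "\<exists>s2\<le>r. (c, s2) \<in> N \<and> s2 + c + s0 - a = 2 * s1"
        using down_disagreement[OF ev gen less.prems(3) x] by metis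
      then obtain s2 where "s2 \<le> r" "(c, s2) \<in> N" "s2 + c + s0 - a = 2 * s1" by blast
      then have "s1 \<in> K" using K[of c s2 a s0 s1] less.prems(4) * by simp
      then have "card {k\<in>K. k \<le> s'} < card {k\<in>K. k \<le> r}" using *(2,3) by (rule card_less)
      then show False using less.hyps[OF _ ev *(1)] * less.prems(4) by (meson less_imp_le order_trans)
    qed
    show ?case using up down less.prems(1,2) by blast
  qed
  show ?thesis using *[OF assms(1,2,4)] unfolding T_def by blast
qed

lemma line_evolution_unique:
  assumes ev: "line_evolution l N g" "line_evolution l N g'" and "good (light_cone ` N)" and "0 \<le> s"
  shows "g s = g' s"
proof
  fix x
  have "height_line (g s)" "height_line (g' s)" "\<forall>\<^sub>F x in at_bot. g s x = l" "\<forall>\<^sub>F x in at_bot. g' s x = l"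
    using ev \<open>0 \<le> s\<close> unfolding line_evolution_def by blast+
  then show "g s x = g' s x"
    using height_line_net_steps[of "g s" l x] height_line_net_steps[of "g' s" l x] evolution_steps_unique[OF assms] by simp
qed

text \<open>An annihilation has positive time and is decided just before it, where only nonnegative
  times are involved.\<close>

lemma annihilations_cong:
  assumes "\<And>s. 0 \<le> s \<Longrightarrow> g s = g' s"
  shows "annihilations g = annihilations g'"
proof -
  have "up_arrives g x s \<longleftrightarrow> up_arrives g' x s" "down_arrives g x s \<longleftrightarrow> down_arrives g' x s" if "s > 0" for x s
  proof -
    have "\<forall>\<^sub>F e in at_right 0. g (s - e) = g' (s - e)"
      by (rule eventually_at_rightI[of _ s]) (use that assms in auto)
    then have ev: "\<forall>\<^sub>F e in at_right 0. x + e \<in> ups (g (s - e)) \<longleftrightarrow> x + e \<in> ups (g' (s - e))"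
      "\<forall>\<^sub>F e in at_right 0. x - e \<in> downs (g (s - e)) \<longleftrightarrow> x - e \<in> downs (g' (s - e))"
      by (auto elim: eventually_mono)
    show "up_arrives g x s \<longleftrightarrow> up_arrives g' x s" "down_arrives g x s \<longleftrightarrow> down_arrives g' x s"
      unfolding up_arrives_def down_arrives_def by (rule ev[THEN eventually_subst])+
  qed
  then show ?thesis unfolding annihilations_def by auto
qed

definition rsk_lines :: "(real \<times> real) set \<Rightarrow> real \<Rightarrow> line_config" where
  "rsk_lines P s k = line_height (- int k) (layer P k) s"

lemma rsk_evolution_rsk_lines:
  assumes good: "good (light_cone ` N)"
  shows "rsk_evolution N (rsk_lines (light_cone ` N))"
  unfolding rsk_evolution_def
proof (intro conjI allI)
  show "line_evolution 0 N (\<lambda>s. rsk_lines (light_cone ` N) s 0)"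
    using line_evolution_line_height[OF good, of 0] unfolding rsk_lines_def by simp
  fix k
  have goodk: "good (layer (light_cone ` N) k)" by (rule good_layer[OF good])
  define M where "M = annihilations (\<lambda>s. rsk_lines (light_cone ` N) s k)"
  have "light_cone ` M = layer (light_cone ` N) (Suc k)"
    unfolding M_def rsk_lines_def layer_Suc by (rule annihilations_line_height[OF goodk])
  then show "line_evolution (- int (Suc k)) M (\<lambda>s. rsk_lines (light_cone ` N) s (Suc k))"
    using line_evolution_line_height[of M "- int (Suc k)"] good_layer[OF good, of "Suc k"]
    unfolding rsk_lines_def by simp
qed

text \<open>Induction down the lines: equal lines have equal annihilations, so the lines below them
  have equal nucleations.\<close>

lemma rsk_evolution_unique:
  assumes good: "good (light_cone ` N)" and rsk: "rsk_evolution N h" and "0 \<le> s"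
  shows "h s = rsk_lines (light_cone ` N) s"
proof -
  have rsk': "rsk_evolution N (rsk_lines (light_cone ` N))" using good by (rule rsk_evolution_rsk_lines)
  have "\<forall>s\<ge>0. h s k = rsk_lines (light_cone ` N) s k" for k
  proof (induction k)
    case 0
    show ?case using line_evolution_unique[OF _ _ good] rsk rsk' unfolding rsk_evolution_def by blast
  next
    case (Suc k)
    let ?h' = "rsk_lines (light_cone ` N)"
    have eq: "annihilations (\<lambda>s. h s k) = annihilations (\<lambda>s. ?h' s k)"
      using Suc by (intro annihilations_cong) auto
    have "light_cone ` annihilations (\<lambda>s. ?h' s k) = layer (light_cone ` N) (Suc k)"
      unfolding rsk_lines_def layer_Suc by (rule annihilations_line_height[OF good_layer[OF good]])
    then have "good (light_cone ` annihilations (\<lambda>s. ?h' s k))" using good_layer[OF good] by simp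
    moreover have "line_evolution (- int (Suc k)) (annihilations (\<lambda>s. ?h' s k)) (\<lambda>s. h s (Suc k))"
      "line_evolution (- int (Suc k)) (annihilations (\<lambda>s. ?h' s k)) (\<lambda>s. ?h' s (Suc k))"
      using rsk rsk' unfolding rsk_evolution_def eq[symmetric] by (blast, simp only: eq)
    ultimately show ?case using line_evolution_unique by blast
  qed
  then show ?thesis using \<open>0 \<le> s\<close> by auto
qed

section \<open>Step configurations\<close>

text \<open>The sum of the light-cone coordinates is twice the time, so these are the space-time
  points up to time \<open>t\<close>.\<close>

definition past :: "real \<Rightarrow> (real \<times> real) set" where
  "past t = {p. fst p + snd p \<le> 2 * t}"

lemma lower_past: "lower (past t)"
  unfolding lower_def past_def by auto

lemma good_past:
  assumes "good P"
  shows "finite (P \<inter> past t)" "good (P \<inter> past t)"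
proof -
  have "P \<inter> past t \<subseteq> P \<inter> {..2 * t} \<times> {..2 * t}"
    using assms unfolding good_def past_def by force
  then show fin: "finite (P \<inter> past t)"
    using finite_rects(1)[OF good_generic[OF assms]] by (rule finite_subset)
  have "inj_on fst P" "inj_on snd P" using assms unfolding good_def generic_def by auto
  then have "generic (P \<inter> past t)" using fin by (intro generic_finite) (auto intro: inj_on_subset)
  then show "good (P \<inter> past t)" using assms unfolding good_def by auto
qed

lemma rsk_lines_past: "rsk_lines (P \<inter> past t) t = rsk_lines P t"
proof (intro ext)
  fix k x
  have "layer (P \<inter> past t) k \<inter> past t = layer P k \<inter> past t"
    by (rule layer_lower[OF lower_past]) auto
  moreover have "{..t + x} \<times> {..t - x} \<subseteq> past t" unfolding past_def by auto
  ultimately have "layer (P \<inter> past t) k \<inter> {..t + x} \<times> {..t - x} = layer P k \<inter> {..t + x} \<times> {..t - x}" by blast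
  then show "rsk_lines (P \<inter> past t) t k x = rsk_lines P t k x"
    unfolding rsk_lines_def line_height_def by simp
qed

text \<open>A ray that has met layer \<open>k\<close> but not layer \<open>k + 1\<close> by time
  \<open>t\<close> carries a step of line \<open>k\<close>.\<close>

lemma ups_rsk_lines:
  assumes "good P" "finite P"
  shows "x \<in> ups (rsk_lines P t k) \<longleftrightarrow> row_label P (past t) (t + x) = Suc k"
proof -
  have gen: "generic P" using assms(1) by (rule good_generic)
  have "(\<exists>v\<le>t - x. (t + x, v) \<in> Q) \<longleftrightarrow> t + x \<in> fst ` (Q \<inter> past t)" for Q
  proof -
    have "t + x \<in> fst ` (Q \<inter> past t) \<longleftrightarrow> (\<exists>v. (t + x, v) \<in> Q \<and> t + x + v \<le> 2 * t)"
      unfolding past_def by force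
    moreover have "t + x + v \<le> 2 * t \<longleftrightarrow> v \<le> t - x" for v by linarith
    ultimately show ?thesis by auto
  qed
  then have "x \<in> ups (rsk_lines P t k) \<longleftrightarrow> t + x \<in> fst ` (layer P k \<inter> past t) \<and> t + x \<notin> fst ` (layer P (Suc k) \<inter> past t)"
    unfolding rsk_lines_def ups_line_height[OF generic_layer[OF gen]] up_at_shadow[OF generic_layer[OF gen]] layer_Suc
    by blast
  then show ?thesis unfolding less_row_label[OF gen assms(2) lower_past, symmetric] by linarith
qed

lemma downs_rsk_lines:
  assumes "good P" "finite P"
  shows "x \<in> downs (rsk_lines P t k) \<longleftrightarrow> col_label P (past t) (t - x) = Suc k"
proof -
  have gen: "generic P" using assms(1) by (rule good_generic)
  have "(\<exists>u\<le>t + x. (u, t - x) \<in> Q) \<longleftrightarrow> t - x \<in> snd ` (Q \<inter> past t)" for Q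
  proof -
    have "t - x \<in> snd ` (Q \<inter> past t) \<longleftrightarrow> (\<exists>u. (u, t - x) \<in> Q \<and> u + (t - x) \<le> 2 * t)"
      unfolding past_def by force
    moreover have "u + (t - x) \<le> 2 * t \<longleftrightarrow> u \<le> t + x" for u by linarith
    ultimately show ?thesis by auto
  qed
  then have "x \<in> downs (rsk_lines P t k) \<longleftrightarrow> t - x \<in> snd ` (layer P k \<inter> past t) \<and> t - x \<notin> snd ` (layer P (Suc k) \<inter> past t)"
    unfolding rsk_lines_def downs_line_height[OF generic_layer[OF gen]] down_at_shadow[OF generic_layer[OF gen]] layer_Suc
    by blast
  then show ?thesis unfolding less_col_label[OF gen assms(2) lower_past, symmetric] by linarith
qed

lemma rsk_lines_Lambda:
  assumes good: "good P"
  shows "rsk_lines P t \<in> Lambda t"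
proof -
  have gen: "generic (layer P k)" for k using good generic_layer good_generic by blast
  have pos: "0 < fst p \<and> 0 < snd p" if "p \<in> layer P k" for p k
    using good_layer[OF good] that unfolding good_def by blast
  have hl: "height_line (rsk_lines P t k)" for k
    unfolding rsk_lines_def by (rule height_line_line_height[OF gen pos])
  have flat: "rsk_lines P t k x = - int k" if "\<bar>x\<bar> \<ge> t" for k x
  proof -
    have "t + x \<le> 0 \<or> t - x \<le> 0" using that by linarith
    then have "layer P k \<inter> {..t + x} \<times> {..t - x} = {}" by (rule good_rect_empty[OF good_layer[OF good]])
    then show ?thesis unfolding rsk_lines_def line_height_def by simp
  qed
  have less: "rsk_lines P t (Suc k) x < rsk_lines P t k x" for k x
    using len_shadow_le[OF gen, of k "t + x" "t - x"] unfolding rsk_lines_def line_height_def layer_Suc by simp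
  \<comment> \<open>From layer \<open>K\<close> on, no point is left that could act up to time
    \<open>t\<close>.\<close>
  define K where "K = card (P \<inter> {..2 * t} \<times> {..2 * t})"
  have "k < K" if x: "x \<in> ups (rsk_lines P t k) \<union> downs (rsk_lines P t k)" for k x
  proof (rule ccontr)
    assume "\<not> k < K"
    then have emp: "layer P k \<inter> {..2 * t} \<times> {..2 * t} = {}"
      unfolding K_def using good by (intro layer_empty good_generic) auto
    obtain u v where uv: "(u, v) \<in> layer P k" "u \<le> t + x" "v \<le> t - x"
      using x up_at_point[OF gen] down_at_point[OF gen]
      unfolding rsk_lines_def ups_line_height[OF gen] downs_line_height[OF gen] Un_iff by blast
    then have "u \<le> 2 * t" "v \<le> 2 * t" using pos[OF uv(1)] by auto
    then show False using emp uv(1) by auto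
  qed
  then have "{(k, x). x \<in> ups (rsk_lines P t k) \<union> downs (rsk_lines P t k)} \<subseteq>
      (SIGMA k:{..<K}. ups (rsk_lines P t k) \<union> downs (rsk_lines P t k))" by auto
  moreover have "finite (SIGMA k:{..<K}. ups (rsk_lines P t k) \<union> downs (rsk_lines P t k))"
    using finite_ups_downs hl unfolding height_line_def by blast
  ultimately have "finite {(k, x). x \<in> ups (rsk_lines P t k) \<union> downs (rsk_lines P t k)}" by (rule finite_subset)
  then show ?thesis unfolding Lambda_def using hl flat less by auto
qed

section \<open>Intrinsic description of step configurations\<close>

definition positions :: "(nat \<Rightarrow> nat) \<Rightarrow> (step_index \<Rightarrow> real) \<Rightarrow> nat \<Rightarrow> step_kind \<Rightarrow> real set" where
  "positions n y k s = (\<lambda>j. y (k, s, j)) ` {..<n k}"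

lemma finite_positions [simp]: "finite (positions n y k s)"
  by (simp add: positions_def)

text \<open>As the base levels of consecutive integer lines differ by one, their strict order
  becomes a weak inequality between net steps.\<close>

definition configuration :: "real \<Rightarrow> (nat \<Rightarrow> nat) \<Rightarrow> (step_index \<Rightarrow> real) \<Rightarrow> bool" where
  "configuration t n y \<longleftrightarrow>
     (\<forall>i\<in>step_index n. \<bar>y i\<bar> < t) \<and>
     (\<forall>k s j j'. j < j' \<and> j' < n k \<longrightarrow> y (k, s, j) < y (k, s, j')) \<and>
     (\<forall>k x. net_steps (positions n y (Suc k) Up) (positions n y (Suc k) Down) x
        \<le> net_steps (positions n y k Up) (positions n y k Down) x)"

lemma configuration_inj:
  assumes "configuration t n y"
  shows "inj_on (\<lambda>j. y (k, s, j)) {..<n k}" "card (positions n y k s) = n k"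
proof -
  show inj: "inj_on (\<lambda>j. y (k, s, j)) {..<n k}"
    using assms unfolding configuration_def
    by (intro linorder_inj_onI) (fastforce simp: less_le)+
  then show "card (positions n y k s) = n k" unfolding positions_def by (simp add: card_image)
qed

lemma sorted_positions:
  assumes "\<And>j j'. j < j' \<Longrightarrow> j' < n k \<Longrightarrow> y (k, s, j) < y (k, s, j')" "j < n k"
  shows "sorted_list_of_set (positions n y k s) ! j = y (k, s, j)"
proof -
  let ?xs = "map (\<lambda>j. y (k, s, j)) [0..<n k]"
  have "sorted_wrt (<) ?xs" using assms(1) by (auto simp: sorted_wrt_iff_nth_less)
  then have "sorted ?xs" "distinct ?xs" by (simp_all add: strict_sorted_iff)
  then have "sorted_list_of_set (set ?xs) = ?xs" by (rule sorted_list_of_set.idem_if_sorted_distinct)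
  moreover have "set ?xs = positions n y k s" unfolding positions_def by (auto simp: atLeast0LessThan)
  ultimately show ?thesis using assms(2) by simp
qed

lemma step_map_eqI:
  assumes "\<And>k. ups (h k) = positions n y k Up" "\<And>k. downs (h k) = positions n y k Down"
    and conf: "configuration t n y" and ext: "y \<in> extensional (step_index n)"
  shows "step_map h = (n, y)"
proof -
  have n: "(\<lambda>k. card (ups (h k))) = n" using configuration_inj(2)[OF conf] assms(1) by simp
  have steps: "steps s (h k) = positions n y k s" for s k
    using assms(1,2) unfolding steps_def by (cases s) auto
  have "(\<lambda>(k, s, j) \<in> step_index n. sorted_list_of_set (steps s (h k)) ! j) = y"
  proof
    fix i :: step_index
    obtain k s j where i: "i = (k, s, j)" by (cases i) auto
    show "(\<lambda>(k, s, j) \<in> step_index n. sorted_list_of_set (steps s (h k)) ! j) i = y i"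
    proof (cases "i \<in> step_index n")
      case True
      then have "j < n k" unfolding i step_index_def by simp
      then have "sorted_list_of_set (steps s (h k)) ! j = y (k, s, j)"
        unfolding steps using conf by (intro sorted_positions) (auto simp: configuration_def)
      then show ?thesis using True unfolding i by simp
    next
      case False
      then show ?thesis using extensional_arb[OF ext False] by simp
    qed
  qed
  then show ?thesis unfolding step_map_def Let_def n by simp
qed

lemma net_steps_Lim:
  assumes "finite A" "finite B"
  shows "Lim (at_left x) (\<lambda>x. c + net_steps A B x) = c + net_steps A B x - of_bool (x \<in> A)"
    and "Lim (at_right x) (\<lambda>x. c + net_steps A B x) = c + net_steps A B x - of_bool (x \<in> B)"
proof -
  obtain d where d: "d > 0"
    "\<And>y. x - d < y \<Longrightarrow> y < x \<Longrightarrow> net_steps A B y = net_steps A B x - of_bool (x \<in> A)"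
    "\<And>y. x < y \<Longrightarrow> y < x + d \<Longrightarrow> net_steps A B y = net_steps A B x - of_bool (x \<in> B)"
    by (rule net_steps_local[OF assms, of x], rule that) blast+
  have "c + net_steps A B y = c + net_steps A B x - of_bool (x \<in> A)" if "x - d < y" "y < x" for y
    unfolding d(2)[OF that] by simp
  with d(1) show "Lim (at_left x) (\<lambda>x. c + net_steps A B x) = c + net_steps A B x - of_bool (x \<in> A)"
    by (rule Lim_at_left_const)
  have "c + net_steps A B y = c + net_steps A B x - of_bool (x \<in> B)" if "x < y" "y < x + d" for y
    unfolding d(3)[OF that] by simp
  with d(1) show "Lim (at_right x) (\<lambda>x. c + net_steps A B x) = c + net_steps A B x - of_bool (x \<in> B)"
    by (rule Lim_at_right_const)
qed

lemma height_line_of_steps: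
  assumes fin: "finite A" "finite B"
  shows "height_line (\<lambda>x. c + net_steps A B x)" "ups (\<lambda>x. c + net_steps A B x) = A"
    "downs (\<lambda>x. c + net_steps A B x) = B"
proof -
  have "net_steps A B a = net_steps A B b" if ab: "a \<le> b" "{a..b} \<inter> (A \<union> B) = {}" for a b
  proof -
    have "z \<notin> A" "z \<notin> B" if "a \<le> z" "z \<le> b" for z using ab that by auto
    then have "z \<in> A \<Longrightarrow> z \<le> a \<longleftrightarrow> z \<le> b" "z \<in> B \<Longrightarrow> z < a \<longleftrightarrow> z < b" for z
      using ab(1) by (meson le_cases order_trans, meson less_imp_le not_less order_less_le_trans)
    then have "{y\<in>A. y \<le> a} = {y\<in>A. y \<le> b}" "{y\<in>B. y < a} = {y\<in>B. y < b}" by blast+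
    then show ?thesis unfolding net_steps_def by simp
  qed
  then have "piecewise_const (\<lambda>x. c + net_steps A B x)"
    unfolding piecewise_const_def using fin by (intro exI[of _ "A \<union> B"]) auto
  then show "height_line (\<lambda>x. c + net_steps A B x)"
    unfolding height_line_def net_steps_Lim[OF fin] by auto
  show "ups (\<lambda>x. c + net_steps A B x) = A" "downs (\<lambda>x. c + net_steps A B x) = B"
    unfolding ups_def downs_def net_steps_Lim[OF fin] by auto
qed

text \<open>Lines far enough down have no steps and sit at their base level; the strict order then
  forces each line above up by at least one more level.\<close>

lemma Lambda_ge:
  assumes h: "h \<in> Lambda t"
  shows "- int k \<le> h k x"
proof -
  have fin: "finite {(k, x). x \<in> ups (h k) \<union> downs (h k)}" using h unfolding Lambda_def by blast
  have flat: "h k y = - int k" if "\<bar>y\<bar> \<ge> t" for k y using h that unfolding Lambda_def by blast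
  have bot: "\<forall>\<^sub>F y in at_bot. h k y = - int k" for k
    using flat by (auto simp: eventually_at_bot_linorder intro!: exI[of _ "- \<bar>t\<bar>"])
  have "finite (fst ` {(k, x). x \<in> ups (h k) \<union> downs (h k)})" using fin by simp
  then obtain K where K0: "\<forall>k \<in> fst ` {(k, x). x \<in> ups (h k) \<union> downs (h k)}. k < K"
    by (meson finite_nat_set_iff_bounded)
  have K: "k < K" if "x \<in> ups (h k) \<union> downs (h k)" for k x
  proof -
    have "k \<in> fst ` {(k, x). x \<in> ups (h k) \<union> downs (h k)}" using that by (intro image_eqI[of _ _ "(k, x)"]) auto
    then show ?thesis using K0 by blast
  qed
  have eq: "h k x = - int k" if "K \<le> k" for k x
  proof -
    have "ups (h k) = {}" "downs (h k) = {}" using K that by force+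
    moreover have "height_line (h k)" using h unfolding Lambda_def by blast
    ultimately show ?thesis using height_line_net_steps[OF _ bot, of k x] by (simp add: net_steps_def)
  qed
  have dec: "h (Suc k) x < h k x" for k using h unfolding Lambda_def by blast
  have "- int (K - i) \<le> h (K - i) x" for i
  proof (induction i)
    case (Suc i)
    show ?case
    proof (cases "i < K")
      case True
      then have "Suc (K - Suc i) = K - i" by simp
      then have "h (K - i) x < h (K - Suc i) x" using dec[of "K - Suc i"] by simp
      then show ?thesis using Suc True by (simp add: of_nat_diff)
    next
      case False
      then show ?thesis using Suc by simp
    qed
  qed (simp add: eq)
  from this[of "K - k"] show ?thesis using eq[of k x] by (cases "k \<le> K") auto
qed

text \<open>At \<open>\<bar>x\<bar> \<ge> t\<close> the line is at its base level, so a step would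
  bring a one-sided limit below it, against \<open>Lambda_ge\<close>. This also covers
  \<open>\<bar>x\<bar> = t\<close>, where flatness says nothing about the inner side.\<close>

lemma Lambda_steps:
  assumes h: "h \<in> Lambda t" and x: "x \<in> ups (h k) \<union> downs (h k)"
  shows "\<bar>x\<bar> < t"
proof (rule ccontr)
  assume "\<not> \<bar>x\<bar> < t"
  then have t: "t \<le> \<bar>x\<bar>" by simp
  have flat: "h k y = - int k" if "\<bar>y\<bar> \<ge> t" for y using h that unfolding Lambda_def by blast
  have pc: "piecewise_const (h k)" using h unfolding Lambda_def height_line_def by blast
  obtain d where d: "d > 0" "\<And>y. x - d < y \<Longrightarrow> y < x \<Longrightarrow> h k y = Lim (at_left x) (h k)"
    "\<And>y. x < y \<Longrightarrow> y < x + d \<Longrightarrow> h k y = Lim (at_right x) (h k)"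
    by (rule piecewise_const_local[OF pc, of x], rule that) blast+
  have "- int k \<le> Lim (at_left x) (h k)" "- int k \<le> Lim (at_right x) (h k)"
    using d(2)[of "x - d / 2"] d(3)[of "x + d / 2"] Lambda_ge[OF h, of k] d(1)
    by (metis add_less_cancel_left diff_strict_left_mono field_sum_of_halves less_add_same_cancel1 diff_less_eq half_gt_zero_iff)+
  then show False using x flat[OF t] unfolding ups_def downs_def by auto
qed

lemma step_map_Lambda:
  assumes h: "h \<in> Lambda t" and eq: "step_map h = (n, y)"
  shows "ups (h k) = positions n y k Up" "downs (h k) = positions n y k Down"
    "configuration t n y" "y \<in> extensional (step_index n)" "finite {k. n k \<noteq> 0}"
    "h k x = - int k + net_steps (positions n y k Up) (positions n y k Down) x"
proof -
  have hl: "height_line (h k)" for k using h unfolding Lambda_def by blast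
  then have fin: "finite (ups (h k))" "finite (downs (h k))" for k
    using finite_ups_downs unfolding height_line_def by blast+
  have flat: "h k y = - int k" if "\<bar>y\<bar> \<ge> t" for k y using h that unfolding Lambda_def by blast
  have bot: "\<forall>\<^sub>F y in at_bot. h k y = - int k" for k
    using flat by (auto simp: eventually_at_bot_linorder intro!: exI[of _ "- \<bar>t\<bar>"])
  have net: "h k x = - int k + net_steps (ups (h k)) (downs (h k)) x" for k x
    by (rule height_line_net_steps[OF hl bot])
  have n: "n k = card (ups (h k))" for k using eq unfolding step_map_def Let_def by auto
  have y: "y = (\<lambda>(k, s, j) \<in> step_index n. sorted_list_of_set (steps s (h k)) ! j)"
    using eq unfolding step_map_def Let_def by auto
  \<comment> \<open>At \<open>\<bar>t\<bar>\<close> all steps are passed and the line is back at its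
    base level, so up-steps and down-steps balance.\<close>
  have n': "card (downs (h k)) = n k" for k
  proof -
    have "{y\<in>ups (h k). y \<le> \<bar>t\<bar>} = ups (h k)" "{y\<in>downs (h k). y < \<bar>t\<bar>} = downs (h k)"
      using Lambda_steps[OF h, of _ k] by force+
    then show ?thesis using net[of k "\<bar>t\<bar>"] flat[of "\<bar>t\<bar>" k] unfolding n net_steps_def by simp
  qed
  have finS: "finite (steps s (h k))" and cardS: "card (steps s (h k)) = n k" for s k
    using fin n n' unfolding steps_def by (cases s; simp)+
  have y_nth: "y (k, s, j) = sorted_list_of_set (steps s (h k)) ! j" if "j < n k" for k s j
    unfolding y using that by (simp add: step_index_def)
  have pos: "positions n y k s = steps s (h k)" for k s
  proof -
    have "positions n y k s = (\<lambda>j. sorted_list_of_set (steps s (h k)) ! j) ` {..<n k}"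
      unfolding positions_def using y_nth by (intro image_cong) auto
    also have "\<dots> = set (sorted_list_of_set (steps s (h k)))"
      using cardS[of s k] by (auto simp: in_set_conv_nth image_iff)
    finally show ?thesis using finS by simp
  qed
  show up: "ups (h k) = positions n y k Up" and down: "downs (h k) = positions n y k Down" for k
    unfolding pos steps_def by simp_all
  show "h k x = - int k + net_steps (positions n y k Up) (positions n y k Down) x" for k x
    using net[of k x] unfolding up down .
  then have net': "h k x = - int k + net_steps (positions n y k Up) (positions n y k Down) x" for k x .
  show "y \<in> extensional (step_index n)" unfolding y by simp
  have "finite (fst ` {(k, x). x \<in> ups (h k) \<union> downs (h k)})" using h unfolding Lambda_def by blast
  moreover have "{k. n k \<noteq> 0} \<subseteq> fst ` {(k, x). x \<in> ups (h k) \<union> downs (h k)}"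
  proof
    fix k assume "k \<in> {k. n k \<noteq> 0}"
    then obtain x where "x \<in> ups (h k)" unfolding n by (auto simp: card_eq_0_iff)
    then show "k \<in> fst ` {(k, x). x \<in> ups (h k) \<union> downs (h k)}" by (intro image_eqI[of _ _ "(k, x)"]) auto
  qed
  ultimately show "finite {k. n k \<noteq> 0}" by (rule finite_subset[rotated])
  show "configuration t n y" unfolding configuration_def
  proof (intro conjI allI impI ballI)
    fix i assume "i \<in> step_index n"
    then obtain k s j where i: "i = (k, s, j)" "j < n k" unfolding step_index_def by auto
    then have "y i \<in> steps s (h k)" unfolding pos[symmetric] positions_def by auto
    then show "\<bar>y i\<bar> < t" using Lambda_steps[OF h] unfolding steps_def by (cases s) auto
  next
    fix k s j j' assume "j < j' \<and> j' < n k"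
    then show "y (k, s, j) < y (k, s, j')"
      using y_nth[of j k s] y_nth[of j' k s] cardS[of s k]
        sorted_wrt_nth_less[OF strict_sorted_list_of_set, of j j' "steps s (h k)"] by simp
  next
    fix k x
    have "h (Suc k) x < h k x" using h unfolding Lambda_def by blast
    then show "net_steps (positions n y (Suc k) Up) (positions n y (Suc k) Down) x
        \<le> net_steps (positions n y k Up) (positions n y k Down) x" unfolding net' by simp
  qed
qed

lemma configuration_Gamma:
  assumes conf: "configuration t n y" and ext: "y \<in> extensional (step_index n)" and n: "finite {k. n k \<noteq> 0}"
  shows "(n, y) \<in> Gamma t"
proof -
  define h :: line_config where "h k x = - int k + net_steps (positions n y k Up) (positions n y k Down) x" for k x
  have h: "h k = (\<lambda>x. - int k + net_steps (positions n y k Up) (positions n y k Down) x)" for k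
    unfolding h_def by simp
  have ud: "ups (h k) = positions n y k Up" "downs (h k) = positions n y k Down" "height_line (h k)" for k
    unfolding h by (rule height_line_of_steps; simp)+
  have small: "\<bar>z\<bar> < t" if "z \<in> positions n y k s" for z k s
    using that conf unfolding positions_def configuration_def step_index_def by force
  have "{(k, x). x \<in> ups (h k) \<union> downs (h k)} \<subseteq> (SIGMA k:{k. n k \<noteq> 0}. positions n y k Up \<union> positions n y k Down)"
    unfolding ud by (auto simp: positions_def)
  moreover have "finite (SIGMA k:{k. n k \<noteq> 0}. positions n y k Up \<union> positions n y k Down)"
    using n by (intro finite_SigmaI) auto
  ultimately have "finite {(k, x). x \<in> ups (h k) \<union> downs (h k)}" by (rule finite_subset)
  moreover have "h (Suc k) x < h k x" for k x
  proof -
    have "net_steps (positions n y (Suc k) Up) (positions n y (Suc k) Down) x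
        \<le> net_steps (positions n y k Up) (positions n y k Down) x" using conf unfolding configuration_def by blast
    then show ?thesis unfolding h_def by simp
  qed
  moreover have "h k x = - int k" if "\<bar>x\<bar> \<ge> t" for k x
  proof (cases "x \<ge> 0")
    case True
    then have "{z\<in>positions n y k Up. z \<le> x} = positions n y k Up" "{z\<in>positions n y k Down. z < x} = positions n y k Down"
      using small that by force+
    then show ?thesis unfolding h_def net_steps_def using configuration_inj(2)[OF conf] by simp
  next
    case False
    then have e: "{z\<in>positions n y k Up. z \<le> x} = {}" "{z\<in>positions n y k Down. z < x} = {}"
      using small that by force+
    show ?thesis unfolding h_def net_steps_def e by simp
  qed
  ultimately have "h \<in> Lambda t" unfolding Lambda_def using ud(3) by auto
  moreover have "step_map h = (n, y)" using ud(1,2) conf ext by (rule step_map_eqI)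
  ultimately show ?thesis unfolding Gamma_def by (metis imageI)
qed

lemma Gamma_iff:
  "(n, y) \<in> Gamma t \<longleftrightarrow> configuration t n y \<and> y \<in> extensional (step_index n) \<and> finite {k. n k \<noteq> 0}"
proof
  assume "(n, y) \<in> Gamma t"
  then obtain h where "h \<in> Lambda t" "step_map h = (n, y)" unfolding Gamma_def by force
  then show "configuration t n y \<and> y \<in> extensional (step_index n) \<and> finite {k. n k \<noteq> 0}"
    using step_map_Lambda(3-5)[of h t n y] by blast
qed (use configuration_Gamma in blast)

lemma finite_step_index: "finite {k. n k \<noteq> 0} \<Longrightarrow> finite (step_index n)"
proof -
  assume n: "finite {k. n k \<noteq> 0}"
  have kinds: "(UNIV :: step_kind set) = {Up, Down}" using step_kind.exhaust by auto
  have "step_index n = (SIGMA k:{k. n k \<noteq> 0}. UNIV \<times> {..<n k})" unfolding step_index_def by auto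
  then show ?thesis using n by (auto intro!: finite_SigmaI simp: kinds)
qed

section \<open>Point sets and step configurations\<close>

lemma strict_mono_on_lessD: "strict_mono_on A f \<Longrightarrow> x \<in> A \<Longrightarrow> y \<in> A \<Longrightarrow> (f x < f y \<longleftrightarrow> x < (y::real)) \<and> (f x \<le> f y \<longleftrightarrow> x \<le> y)"
  for f :: "real \<Rightarrow> real"
  by (simp add: strict_mono_on_less strict_mono_on_less_eq)

lemma inj_map_prod_image:
  fixes \<phi> \<psi> :: "real \<Rightarrow> real"
  assumes "strict_mono_on U \<phi>" "strict_mono_on V \<psi>" "P \<subseteq> U \<times> V" "inj_on fst P" "inj_on snd P"
  shows "inj_on fst (map_prod \<phi> \<psi> ` P)" "inj_on snd (map_prod \<phi> \<psi> ` P)"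
proof -
  have "inj_on \<phi> U" "inj_on \<psi> V" using assms(1,2)[THEN strict_mono_on_imp_inj_on] .
  note inj = this
  show "inj_on fst (map_prod \<phi> \<psi> ` P)"
  proof (rule inj_on_imageI, rule inj_onI)
    fix p q assume pq: "p \<in> P" "q \<in> P" and "(fst \<circ> map_prod \<phi> \<psi>) p = (fst \<circ> map_prod \<phi> \<psi>) q"
    then have "\<phi> (fst p) = \<phi> (fst q)" by simp
    then have "fst p = fst q" using inj_onD[OF inj(1)] pq assms(3) by (metis mem_Times_iff subsetD)
    then show "p = q" using inj_onD[OF assms(4)] pq by blast
  qed
  show "inj_on snd (map_prod \<phi> \<psi> ` P)"
  proof (rule inj_on_imageI, rule inj_onI)
    fix p q assume pq: "p \<in> P" "q \<in> P" and "(snd \<circ> map_prod \<phi> \<psi>) p = (snd \<circ> map_prod \<phi> \<psi>) q"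
    then have "\<psi> (snd p) = \<psi> (snd q)" by simp
    then have "snd p = snd q" using inj_onD[OF inj(2)] pq assms(3) by (metis mem_Times_iff subsetD)
    then show "p = q" using inj_onD[OF assms(5)] pq by blast
  qed
qed

text \<open>Strictly increasing changes of the two coordinates preserve every comparison between
  points and grid, hence the lengths that define the shadow.\<close>

lemma shadow_image:
  assumes fin: "finite P" and inj: "inj_on fst P" "inj_on snd P" and P: "P \<subseteq> U \<times> V"
    and mono: "strict_mono_on U \<phi>" "strict_mono_on V \<psi>"
  shows "shadow (map_prod \<phi> \<psi> ` P) = map_prod \<phi> \<psi> ` shadow P"
proof -
  let ?F = "map_prod \<phi> \<psi>"
  have gen: "generic P" using fin inj by (rule generic_finite)
  have gen': "generic (?F ` P)" using fin inj_map_prod_image[OF mono P inj] by (intro generic_finite) auto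
  have len: "len (?F ` Q) = len Q" if "Q \<subseteq> P" for Q
  proof (rule len_image)
    show "strict_mono_on (fst ` Q) \<phi>" "strict_mono_on (snd ` Q) \<psi>"
      using mono that P by (auto intro!: monotone_on_subset[OF mono(1)] monotone_on_subset[OF mono(2)])
    show "finite Q" using that fin finite_subset by blast
  qed
  have iff: "(\<phi> u, \<psi> v) \<in> shadow (?F ` P) \<longleftrightarrow> (u, v) \<in> shadow P" if uv: "u \<in> U" "v \<in> V" for u v
  proof -
    have *: "\<phi> x < \<phi> u \<longleftrightarrow> x < u" "\<phi> x \<le> \<phi> u \<longleftrightarrow> x \<le> u" "\<psi> y < \<psi> v \<longleftrightarrow> y < v" "\<psi> y \<le> \<psi> v \<longleftrightarrow> y \<le> v"
      if "(x, y) \<in> P" for x y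
      using that P uv mono by (auto simp: strict_mono_on_lessD)
    have "?F ` P \<inter> {..<\<phi> u} \<times> {..<\<psi> v} = ?F ` (P \<inter> {..<u} \<times> {..<v})"
      "?F ` P \<inter> {..\<phi> u} \<times> {..<\<psi> v} = ?F ` (P \<inter> {..u} \<times> {..<v})"
      "?F ` P \<inter> {..<\<phi> u} \<times> {..\<psi> v} = ?F ` (P \<inter> {..<u} \<times> {..v})"
      using * by (auto simp: image_iff; force)+
    then show ?thesis unfolding shadow_def up_before_def down_before_def by (simp add: len)
  qed
  have sub: "shadow P \<subseteq> U \<times> V" using layer_subset[OF gen P, of "Suc 0"] by (simp add: layer_Suc)
  have "(a, b) \<in> ?F ` shadow P" if ab: "(a, b) \<in> shadow (?F ` P)" for a b
  proof -
    obtain a' b' where "(a, b') \<in> ?F ` P" "(a', b) \<in> ?F ` P" using shadow_points[OF gen' ab] by blast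
    then obtain u v where "a = \<phi> u" "b = \<psi> v" "u \<in> U" "v \<in> V" using P by auto
    then show ?thesis using iff[of u v] ab by auto
  qed
  moreover have "?F p \<in> shadow (?F ` P)" if "p \<in> shadow P" for p
    using iff[of "fst p" "snd p"] sub that by (cases p) auto
  ultimately show ?thesis by auto
qed

lemma layer_image:
  assumes fin: "finite P" and inj: "inj_on fst P" "inj_on snd P" and P: "P \<subseteq> U \<times> V"
    and mono: "strict_mono_on U \<phi>" "strict_mono_on V \<psi>"
  shows "layer (map_prod \<phi> \<psi> ` P) k = map_prod \<phi> \<psi> ` layer P k"
proof (induction k)
  case (Suc k)
  have gen: "generic P" using fin inj by (rule generic_finite)
  have "layer P k \<subseteq> fst ` P \<times> snd ` P" by (rule layer_subset[OF gen]) force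
  then have "finite (layer P k)" using fin by (meson finite_SigmaI finite_imageI finite_subset)
  moreover have "inj_on fst (layer P k)" "inj_on snd (layer P k)" using generic_layer[OF gen] unfolding generic_def by auto
  ultimately show ?case unfolding layer_Suc Suc
    by (rule shadow_image[OF _ _ _ layer_subset[OF gen P] mono])
qed simp

definition up_index :: "(nat \<Rightarrow> nat) \<Rightarrow> step_index set" where
  "up_index n = {(k, s, j). s = Up \<and> j < n k}"
definition down_index :: "(nat \<Rightarrow> nat) \<Rightarrow> step_index set" where
  "down_index n = {(k, s, j). s = Down \<and> j < n k}"

lemma step_index_split: "step_index n = up_index n \<union> down_index n" "up_index n \<inter> down_index n = {}"
  unfolding step_index_def up_index_def down_index_def using step_kind.exhaust by auto

lemma up_positions: "(\<exists>k. x \<in> positions n y k Up) \<longleftrightarrow> x \<in> y ` up_index n"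
  unfolding positions_def up_index_def by force
lemma down_positions: "(\<exists>k. x \<in> positions n y k Down) \<longleftrightarrow> x \<in> y ` down_index n"
  unfolding positions_def down_index_def by force

lemma shift_image:
  fixes u v t :: real
  shows "u - t \<in> f ` A \<longleftrightarrow> u \<in> (\<lambda>i. t + f i) ` A" "t - v \<in> f ` A \<longleftrightarrow> v \<in> (\<lambda>i. t - f i) ` A"
  unfolding image_iff by (rule bex_cong[OF refl], force simp: algebra_simps)+

text \<open>At time \<open>t\<close> an up-step at \<open>x\<close> sits on the ray
  \<open>u = t + x\<close> and a down-step on the ray \<open>v = t - x\<close>.\<close>

lemma labels_of_step_map:
  assumes good: "good Q" and eq: "step_map (rsk_lines Q t) = (n, y)"
  shows "row_label (Q \<inter> past t) (past t) (t + x) = Suc k \<longleftrightarrow> x \<in> positions n y k Up"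
    and "col_label (Q \<inter> past t) (past t) (t - x) = Suc k \<longleftrightarrow> x \<in> positions n y k Down"
    and "fst ` (Q \<inter> past t) = (\<lambda>i. t + y i) ` up_index n"
    and "snd ` (Q \<inter> past t) = (\<lambda>i. t - y i) ` down_index n"
proof -
  let ?Q = "Q \<inter> past t"
  note Q = good_past[OF good, of t]
  have gen: "generic ?Q" using Q(2) by (rule good_generic)
  have L: "rsk_lines ?Q t \<in> Lambda t" by (rule rsk_lines_Lambda[OF Q(2)])
  have eq': "step_map (rsk_lines ?Q t) = (n, y)" using eq unfolding rsk_lines_past .
  show row: "row_label ?Q (past t) (t + x) = Suc k \<longleftrightarrow> x \<in> positions n y k Up" for x k
    using step_map_Lambda(1)[OF L eq'] ups_rsk_lines[OF Q(2,1), of x t k] by auto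
  show col: "col_label ?Q (past t) (t - x) = Suc k \<longleftrightarrow> x \<in> positions n y k Down" for x k
    using step_map_Lambda(2)[OF L eq'] downs_rsk_lines[OF Q(2,1), of x t k] by auto
  have "u \<in> fst ` ?Q \<longleftrightarrow> u \<in> (\<lambda>i. t + y i) ` up_index n" for u
  proof -
    have "u \<in> fst ` ?Q \<longleftrightarrow> 0 < row_label ?Q (past t) u"
      unfolding less_row_label[OF gen Q(1) lower_past] by simp
    also have "\<dots> \<longleftrightarrow> (\<exists>k. row_label ?Q (past t) u = Suc k)" by (simp add: gr0_conv_Suc)
    also have "\<dots> \<longleftrightarrow> (\<exists>k. u - t \<in> positions n y k Up)" using row[of "u - t"] by simp
    finally show ?thesis unfolding up_positions shift_image(1) .
  qed
  then show "fst ` ?Q = (\<lambda>i. t + y i) ` up_index n" by blast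
  have "v \<in> snd ` ?Q \<longleftrightarrow> v \<in> (\<lambda>i. t - y i) ` down_index n" for v
  proof -
    have "v \<in> snd ` ?Q \<longleftrightarrow> 0 < col_label ?Q (past t) v"
      unfolding less_col_label[OF gen Q(1) lower_past] by simp
    also have "\<dots> \<longleftrightarrow> (\<exists>k. col_label ?Q (past t) v = Suc k)" by (simp add: gr0_conv_Suc)
    also have "\<dots> \<longleftrightarrow> (\<exists>k. t - v \<in> positions n y k Down)" using col[of "t - v"] by simp
    finally show ?thesis unfolding down_positions shift_image(2) .
  qed
  then show "snd ` ?Q = (\<lambda>i. t - y i) ` down_index n" by blast
qed

text \<open>The configuration fixes the label of every ray, a ray without a step having label 0, and
  \<open>rsk_unique\<close> recovers the points from the labels.\<close>

lemma points_unique: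
  assumes good: "good P" "good Q" and eq: "step_map (rsk_lines P t) = step_map (rsk_lines Q t)"
  shows "P \<inter> past t = Q \<inter> past t"
proof -
  obtain n y where ny: "step_map (rsk_lines P t) = (n, y)" "step_map (rsk_lines Q t) = (n, y)"
    using eq by (metis surj_pair)
  note lP = labels_of_step_map[OF good(1) ny(1)] and lQ = labels_of_step_map[OF good(2) ny(2)]
  note P = good_past[OF good(1), of t] and Q = good_past[OF good(2), of t]
  have same: "a = b" if "\<And>k. a = Suc k \<longleftrightarrow> b = Suc k" for a b :: nat
    using that by (metis not0_implies_Suc)
  have r: "row_label (P \<inter> past t) (past t) u = row_label (Q \<inter> past t) (past t) u" for u
  proof (rule same)
    show "row_label (P \<inter> past t) (past t) u = Suc k \<longleftrightarrow> row_label (Q \<inter> past t) (past t) u = Suc k" for k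
      using lP(1)[of "u - t" k] lQ(1)[of "u - t" k] by simp
  qed
  have c: "col_label (P \<inter> past t) (past t) v = col_label (Q \<inter> past t) (past t) v" for v
  proof (rule same)
    show "col_label (P \<inter> past t) (past t) v = Suc k \<longleftrightarrow> col_label (Q \<inter> past t) (past t) v = Suc k" for k
      using lP(2)[of "t - v" k] lQ(2)[of "t - v" k] by simp
  qed
  have inj: "inj_on fst (P \<inter> past t)" "inj_on snd (P \<inter> past t)" "inj_on fst (Q \<inter> past t)" "inj_on snd (Q \<inter> past t)"
    using P(2) Q(2) unfolding good_def generic_def by auto
  have sub: "R \<subseteq> past t \<inter> fst ` R \<times> snd ` R" if "R \<subseteq> past t" for R using that by force
  have eqs: "fst ` (Q \<inter> past t) = fst ` (P \<inter> past t)" "snd ` (Q \<inter> past t) = snd ` (P \<inter> past t)"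
    unfolding lP(3,4) lQ(3,4) by auto
  show ?thesis
  proof (rule rsk_unique[where U = "fst ` (P \<inter> past t)" and V = "snd ` (P \<inter> past t)", OF _ _ lower_past])
    show "P \<inter> past t \<subseteq> past t \<inter> fst ` (P \<inter> past t) \<times> snd ` (P \<inter> past t)" by (rule sub) simp
    show "Q \<inter> past t \<subseteq> past t \<inter> fst ` (P \<inter> past t) \<times> snd ` (P \<inter> past t)"
      unfolding eqs[symmetric] by (rule sub) simp
  qed (use P(1) inj r c in auto)
qed

lemma separate_finite:
  fixes A B :: "real set"
  assumes "finite A" "finite B" "\<And>a b. a \<in> A \<Longrightarrow> b \<in> B \<Longrightarrow> a < b"
  obtains x where "\<And>a. a \<in> A \<Longrightarrow> a < x" "\<And>b. b \<in> B \<Longrightarrow> x < b"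
proof (cases "A = {}")
  case True
  show thesis
  proof (cases "B = {}")
    case False
    then show ?thesis using that[of "Min B - 1"] assms(2) True by (metis Min_le diff_less_eq empty_iff
          less_add_one order_less_le_trans)
  qed (use True that in auto)
next
  case A: False
  show thesis
  proof (cases "B = {}")
    case True
    have "a < Max A + 1" if "a \<in> A" for a using Max_ge[OF assms(1) that] by linarith
    then show ?thesis using that True by blast
  next
    case False
    have "Max A < Min B" using assms A False by simp
    then obtain x where x: "Max A < x" "x < Min B" using dense by blast
    have "a < x" if "a \<in> A" for a using Max_ge[OF assms(1) that] x by linarith
    moreover have "x < b" if "b \<in> B" for b using Min_le[OF assms(2) that] x by linarith
    ultimately show ?thesis using that by blast
  qed
qed

text \<open>The steps label the rays, and the order of the lines at each position becomes the order
  at each cut in \<open>valid_labels\<close>. Distinct positions make the line of a ray well defined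
  and keep up-steps apart from down-steps.\<close>

lemma points_exist:
  assumes Gam: "(n, y) \<in> Gamma t" and inj: "inj_on y (step_index n)"
  obtains P where "good P" "P \<subseteq> past t" "step_map (rsk_lines P t) = (n, y)"
proof -
  have conf: "configuration t n y" and ext: "y \<in> extensional (step_index n)" and n: "finite {k. n k \<noteq> 0}"
    using Gam unfolding Gamma_iff by auto
  define U where "U = (\<lambda>i. t + y i) ` up_index n"
  define V where "V = (\<lambda>i. t - y i) ` down_index n"
  have fin: "finite (up_index n)" "finite (down_index n)"
    using finite_step_index[OF n] unfolding step_index_split by auto
  then have finU: "finite U" "finite V" unfolding U_def V_def by auto
  define a where "a u = (if u \<in> U then Suc (SOME k. u - t \<in> positions n y k Up) else 0)" for u
  define b where "b v = (if v \<in> V then Suc (SOME k. t - v \<in> positions n y k Down) else 0)" for v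
  have uniq: "k = k' \<and> s = s'" if z: "z \<in> positions n y k s" "z \<in> positions n y k' s'" for z k k' s s'
  proof -
    obtain j j' where j: "j < n k" "z = y (k, s, j)" "j' < n k'" "z = y (k', s', j')"
      using z unfolding positions_def by auto
    then have "(k, s, j) = (k', s', j')"
      by (intro inj_onD[OF inj]) (auto simp: step_index_def)
    then show ?thesis by simp
  qed
  have U: "u \<in> U \<longleftrightarrow> (\<exists>k. u - t \<in> positions n y k Up)" for u
    unfolding up_positions U_def shift_image(1) ..
  have V: "v \<in> V \<longleftrightarrow> (\<exists>k. t - v \<in> positions n y k Down)" for v
    unfolding down_positions V_def shift_image(2) ..
  have a: "a u = Suc k \<longleftrightarrow> u - t \<in> positions n y k Up" for u k
  proof
    assume "a u = Suc k"
    then have "u \<in> U" "k = (SOME k. u - t \<in> positions n y k Up)" unfolding a_def by (auto split: if_splits)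
    then show "u - t \<in> positions n y k Up" using U someI_ex[of "\<lambda>k. u - t \<in> positions n y k Up"] by simp
  next
    assume k: "u - t \<in> positions n y k Up"
    then have "u \<in> U" using U by blast
    moreover have "(SOME k. u - t \<in> positions n y k Up) = k"
      using k uniq by (intro some_equality) auto
    ultimately show "a u = Suc k" unfolding a_def by simp
  qed
  have b: "b v = Suc k \<longleftrightarrow> t - v \<in> positions n y k Down" for v k
  proof
    assume "b v = Suc k"
    then have "v \<in> V" "k = (SOME k. t - v \<in> positions n y k Down)" unfolding b_def by (auto split: if_splits)
    then show "t - v \<in> positions n y k Down" using V someI_ex[of "\<lambda>k. t - v \<in> positions n y k Down"] by simp
  next
    assume k: "t - v \<in> positions n y k Down"
    then have "v \<in> V" using V by blast
    moreover have "(SOME k. t - v \<in> positions n y k Down) = k"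
      using k uniq by (intro some_equality) auto
    ultimately show "b v = Suc k" unfolding b_def by simp
  qed
  have setU: "{u\<in>U. R u \<and> a u = Suc k} = (\<lambda>z. t + z) ` {z\<in>positions n y k Up. R (t + z)}" for R k
    using a U by (force simp: image_iff)
  have setV: "{v\<in>V. R v \<and> b v = Suc k} = (\<lambda>z. t - z) ` {z\<in>positions n y k Down. R (t - z)}" for R k
    using b V by (force simp: image_iff)
  have cardU: "card {u\<in>U. R u \<and> a u = Suc k} = card {z\<in>positions n y k Up. R (t + z)}" for R k
    unfolding setU by (rule card_image) (auto simp: inj_on_def)
  have cardV: "card {v\<in>V. R v \<and> b v = Suc k} = card {z\<in>positions n y k Down. R (t - z)}" for R k
    unfolding setV by (rule card_image) (auto simp: inj_on_def)
  have valid: "valid_labels U V (past t) a b" unfolding valid_labels_def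
  proof (intro conjI allI impI)
    fix m :: nat assume "1 \<le> m"
    then obtain k where k: "m = Suc k" by (cases m) auto
    show "card {u\<in>U. a u = m} = card {v\<in>V. b v = m}"
      using cardU[of "\<lambda>_. True" k] cardV[of "\<lambda>_. True" k] configuration_inj(2)[OF conf] unfolding k by simp
  next
    fix p q and m :: nat assume cut: "is_cut U V (past t) p q" and "1 \<le> m"
    then obtain k where k: "m = Suc k" by (cases m) auto
    \<comment> \<open>\<open>A\<close> and \<open>B\<close> are the steps to the left and to the
      right of the cut. All of \<open>A\<close> comes before all of \<open>B\<close>, so an actual
      position \<open>x\<close> fits in between, and the cut counts are net steps at
      \<open>x\<close>.\<close>
    define A where "A = (\<lambda>u. u - t) ` {u\<in>U. u \<le> p} \<union> (\<lambda>v. t - v) ` {v\<in>V. q < v}"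
    define B where "B = (\<lambda>u. u - t) ` {u\<in>U. p < u} \<union> (\<lambda>v. t - v) ` {v\<in>V. v \<le> q}"
    have "c < d" if "c \<in> A" "d \<in> B" for c d
    proof -
      consider u u' where "c = u - t" "u \<le> p" "d = u' - t" "p < u'" |
        u v where "c = u - t" "u \<in> U" "u \<le> p" "d = t - v" "v \<in> V" "v \<le> q" |
        u v where "c = t - v" "v \<in> V" "q < v" "d = u - t" "u \<in> U" "p < u" |
        v v' where "c = t - v" "q < v" "d = t - v'" "v' \<le> q"
        using \<open>c \<in> A\<close> \<open>d \<in> B\<close> unfolding A_def B_def by blast
      then show ?thesis
      proof cases
        case 2
        then have "(u, v) \<in> past t" using cut unfolding is_cut_def by blast
        then have "u - t \<le> t - v" unfolding past_def by simp
        moreover obtain k k' where "u - t \<in> positions n y k Up" "t - v \<in> positions n y k' Down"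
          using 2 U V by blast
        \<comment> \<open>Membership in \<open>past t\<close> gives only a weak inequality;
          distinctness of the positions makes it strict.\<close>
        then have "u - t \<noteq> t - v" using uniq by (metis step_kind.distinct(1))
        ultimately show ?thesis using 2 by simp
      next
        case 3
        then have "(u, v) \<notin> past t" using cut unfolding is_cut_def by blast
        then show ?thesis using 3 unfolding past_def by simp
      qed auto
    qed
    moreover have "finite A" "finite B" unfolding A_def B_def using finU by auto
    ultimately obtain x where x: "\<And>c. c \<in> A \<Longrightarrow> c < x" "\<And>d. d \<in> B \<Longrightarrow> x < d"
      using separate_finite[of A B] by metis
    have eU: "t + z \<le> p \<longleftrightarrow> z \<le> x" if "z \<in> positions n y k Up" for z k
    proof -
      have "t + z \<in> U" using U[of "t + z"] that by auto
      then have "z \<in> A \<and> t + z \<le> p \<or> z \<in> B \<and> p < t + z" unfolding A_def B_def by force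
      then show ?thesis using x by force
    qed
    have eV: "q < t - z \<longleftrightarrow> z < x" if "z \<in> positions n y k Down" for z k
    proof -
      have "t - z \<in> V" using V[of "t - z"] that by auto
      then have "z \<in> A \<and> q < t - z \<or> z \<in> B \<and> t - z \<le> q" unfolding A_def B_def by force
      then show ?thesis using x by force
    qed
    have "cut_count U V a b p q (Suc k) = net_steps (positions n y k Up) (positions n y k Down) x" for k
      unfolding cut_count_def net_steps_def cardU cardV using eU[of _ k] eV[of _ k]
      by (simp cong: conj_cong)
    moreover have "net_steps (positions n y (Suc k) Up) (positions n y (Suc k) Down) x
        \<le> net_steps (positions n y k Up) (positions n y k Down) x"
      using conf unfolding configuration_def by blast
    ultimately show "cut_count U V a b p q (Suc m) \<le> cut_count U V a b p q m" unfolding k by simp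
  qed
  obtain P where P: "P \<subseteq> past t \<inter> U \<times> V" "inj_on fst P" "inj_on snd P"
    "\<And>u. u \<in> U \<Longrightarrow> row_label P (past t) u = a u" "\<And>v. v \<in> V \<Longrightarrow> col_label P (past t) v = b v"
    using rsk_exists[OF finU lower_past valid] by blast
  have finP: "finite P" using P(1) finU by (meson finite_Int finite_SigmaI finite_subset)
  have gen: "generic P" using finP P(2,3) by (rule generic_finite)
  have "0 < u" if "u \<in> U" for u
  proof -
    obtain i where i: "u = t + y i" "i \<in> up_index n" using \<open>u \<in> U\<close> unfolding U_def by auto
    then have "\<bar>y i\<bar> < t" using conf unfolding configuration_def step_index_split by blast
    then show ?thesis using i(1) by linarith
  qed
  moreover have "0 < v" if "v \<in> V" for v
  proof -
    obtain i where i: "v = t - y i" "i \<in> down_index n" using \<open>v \<in> V\<close> unfolding V_def by auto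
    then have "\<bar>y i\<bar> < t" using conf unfolding configuration_def step_index_split by blast
    then show ?thesis using i(1) by linarith
  qed
  ultimately have good: "good P" using gen P(1) unfolding good_def by force
  have PUV: "P \<subseteq> U \<times> V" using P(1) by blast
  have "ups (rsk_lines P t k) = positions n y k Up" for k
  proof -
    have "row_label P (past t) (t + x) = Suc k \<longleftrightarrow> x \<in> positions n y k Up" for x
    proof (cases "t + x \<in> U")
      case False
      then have "\<not> 0 < row_label P (past t) (t + x)"
        unfolding less_row_label[OF gen finP lower_past] using PUV by auto
      then show ?thesis using False U[of "t + x"] by auto
    qed (use P(4) a in auto)
    then show ?thesis using ups_rsk_lines[OF good finP] by auto
  qed
  moreover have "downs (rsk_lines P t k) = positions n y k Down" for k
  proof -
    have "col_label P (past t) (t - x) = Suc k \<longleftrightarrow> x \<in> positions n y k Down" for x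
    proof (cases "t - x \<in> V")
      case False
      then have "\<not> 0 < col_label P (past t) (t - x)"
        unfolding less_col_label[OF gen finP lower_past] using PUV by auto
      then show ?thesis using False V[of "t - x"] by auto
    qed (use P(5) b in auto)
    then show ?thesis using downs_rsk_lines[OF good finP] by auto
  qed
  ultimately have "step_map (rsk_lines P t) = (n, y)" using conf ext by (rule step_map_eqI)
  then show thesis using that good P(1) by blast
qed

text \<open>Each point lies on one up-step ray and one down-step ray, and genericity makes this
  correspondence a bijection.\<close>

lemma points_matching:
  assumes good: "good P" and P: "P \<subseteq> past t" and eq: "step_map (rsk_lines P t) = (n, y)"
    and inj: "inj_on y (step_index n)"
  obtains \<tau> where "bij_betw \<tau> (up_index n) (down_index n)" "P = (\<lambda>i. (t + y i, t - y (\<tau> i))) ` up_index n"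
proof -
  have PP: "P \<inter> past t = P" using P by blast
  have fst: "fst ` P = (\<lambda>i. t + y i) ` up_index n" and snd: "snd ` P = (\<lambda>i. t - y i) ` down_index n"
    using labels_of_step_map(3,4)[OF good eq] unfolding PP by auto
  have gen: "generic P" using good by (rule good_generic)
  have yinj: "i = i'" if "y i = y i'" "i \<in> step_index n" "i' \<in> step_index n" for i i'
    using inj_onD[OF inj that] .
  have "\<exists>j. j \<in> down_index n \<and> (t + y i, t - y j) \<in> P" if "i \<in> up_index n" for i
  proof -
    have "t + y i \<in> fst ` P" unfolding fst using that by blast
    then obtain v where v: "(t + y i, v) \<in> P" by force
    then have "v \<in> snd ` P" by force
    then show ?thesis unfolding snd using v by blast
  qed
  then obtain \<tau> where \<tau>: "\<And>i. i \<in> up_index n \<Longrightarrow> \<tau> i \<in> down_index n \<and> (t + y i, t - y (\<tau> i)) \<in> P" by metis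
  have "inj_on \<tau> (up_index n)"
  proof (rule inj_onI)
    fix i i' assume i: "i \<in> up_index n" "i' \<in> up_index n" "\<tau> i = \<tau> i'"
    then have "t + y i = t + y i'" using \<tau>[of i] \<tau>[of i'] snd_unique[OF gen] by metis
    then show "i = i'" using yinj i unfolding step_index_split by auto
  qed
  moreover have "j \<in> \<tau> ` up_index n" if j: "j \<in> down_index n" for j
  proof -
    have "t - y j \<in> snd ` P" unfolding snd using j by blast
    then obtain u where u: "(u, t - y j) \<in> P" by force
    then have "u \<in> fst ` P" by force
    then obtain i where i: "u = t + y i" "i \<in> up_index n" unfolding fst by blast
    have "t - y (\<tau> i) = t - y j" using fst_unique[OF gen u, of "t - y (\<tau> i)"] \<tau>[OF i(2)] i(1) by simp
    then have "\<tau> i = j" using yinj[of "\<tau> i" j] \<tau>[OF i(2)] j unfolding step_index_split by auto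
    then show ?thesis using i(2) by blast
  qed
  ultimately have "bij_betw \<tau> (up_index n) (down_index n)"
    unfolding bij_betw_def using \<tau> by blast
  moreover have "P = (\<lambda>i. (t + y i, t - y (\<tau> i))) ` up_index n"
  proof
    show "P \<subseteq> (\<lambda>i. (t + y i, t - y (\<tau> i))) ` up_index n"
    proof
      fix p assume p: "p \<in> P"
      then have "fst p \<in> fst ` P" by blast
      then obtain i where i: "fst p = t + y i" "i \<in> up_index n" unfolding fst by blast
      then have "snd p = t - y (\<tau> i)"
        using fst_unique[OF gen, of "t + y i" "t - y (\<tau> i)" "snd p"] \<tau>[OF i(2)] p by (metis prod.collapse)
      then have "p = (t + y i, t - y (\<tau> i))" using i(1) by (simp add: prod_eq_iff)
      then show "p \<in> (\<lambda>i. (t + y i, t - y (\<tau> i))) ` up_index n" using i(2) by (rule image_eqI)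
    qed
  qed (use \<tau> in auto)
  ultimately show thesis by (rule that)
qed

section \<open>Boxes with a fixed order of the steps\<close>

text \<open>The sets are ordered among each other as wholes, so all choices of one position from
  each have the same relative order.\<close>

definition separated :: "real \<Rightarrow> 'i set \<Rightarrow> ('i \<Rightarrow> real set) \<Rightarrow> bool" where
  "separated t I X \<longleftrightarrow> (\<forall>i\<in>I. X i \<subseteq> {-t<..<t}) \<and>
     (\<forall>i\<in>I. \<forall>j\<in>I. i \<noteq> j \<longrightarrow> (\<forall>x\<in>X i. \<forall>y\<in>X j. x < y) \<or> (\<forall>x\<in>X i. \<forall>y\<in>X j. y < x))"

lemma separated_order:
  assumes "separated t I X" "y \<in> PiE I X" "z \<in> PiE I X" "i \<in> I" "j \<in> I"
  shows "y i < y j \<longleftrightarrow> z i < z j"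
proof (cases "i = j")
  case False
  then have "(\<forall>a\<in>X i. \<forall>b\<in>X j. a < b) \<or> (\<forall>a\<in>X i. \<forall>b\<in>X j. b < a)"
    using assms unfolding separated_def by blast
  moreover have "y i \<in> X i" "z i \<in> X i" "y j \<in> X j" "z j \<in> X j"
    using PiE_mem[OF assms(2)] PiE_mem[OF assms(3)] assms(4,5) by blast+
  ultimately show ?thesis by (meson less_asym)
qed simp

lemma separated_inj:
  assumes "separated t I X" "y \<in> PiE I X"
  shows "inj_on y I"
proof (rule inj_onI, rule ccontr)
  fix i j assume ij: "i \<in> I" "j \<in> I" "y i = y j" "i \<noteq> j"
  then have "(\<forall>a\<in>X i. \<forall>b\<in>X j. a < b) \<or> (\<forall>a\<in>X i. \<forall>b\<in>X j. b < a)"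
    using assms unfolding separated_def by blast
  moreover have "y i \<in> X i" "y j \<in> X j" using PiE_mem[OF assms(2)] ij(1,2) by blast+
  ultimately show False using ij(3) by (metis less_irrefl)
qed

text \<open>Only the order of the positions enters the construction. The increasing maps
  \<open>\<phi>\<close> and \<open>\<psi>\<close> take the rays of \<open>y\<close> to those of
  \<open>z\<close>, carry layers to layers, and preserve \<open>past t\<close>, because two rays
  cross by time \<open>t\<close> exactly if the up-step is not to the right of the
  down-step.\<close>

lemma transport_points:
  assumes sep: "separated t (step_index n) X" and y: "y \<in> PiE (step_index n) X" and z: "z \<in> PiE (step_index n) X"
    and good: "good P" and P: "P \<subseteq> past t" and eq: "step_map (rsk_lines P t) = (n, y)"
    and \<tau>: "bij_betw \<tau> (up_index n) (down_index n)" and P_eq: "P = (\<lambda>i. (t + y i, t - y (\<tau> i))) ` up_index n"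
  defines "Q \<equiv> (\<lambda>i. (t + z i, t - z (\<tau> i))) ` up_index n"
  shows "good Q" "Q \<subseteq> past t" "step_map (rsk_lines Q t) = (n, z)"
proof -
  let ?I = "step_index n"
  have L: "rsk_lines P t \<in> Lambda t" by (rule rsk_lines_Lambda[OF good])
  have conf: "configuration t n y" and n: "finite {k. n k \<noteq> 0}"
    using step_map_Lambda(3,5)[OF L eq] by auto
  have fin: "finite (up_index n)" "finite (down_index n)"
    using finite_step_index[OF n] unfolding step_index_split by auto
  have up: "i \<in> ?I" if "i \<in> up_index n" for i using that unfolding step_index_split by blast
  have down: "i \<in> ?I" if "i \<in> down_index n" for i using that unfolding step_index_split by blast
  have \<tau>I: "\<tau> i \<in> down_index n" if "i \<in> up_index n" for i using \<tau> that unfolding bij_betw_def by blast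
  have ord: "y i < y j \<longleftrightarrow> z i < z j" if "i \<in> ?I" "j \<in> ?I" for i j using separated_order[OF sep y z that] .
  have yinj: "inj_on y ?I" using sep y by (rule separated_inj)
  have zinj: "inj_on z ?I" using sep z by (rule separated_inj)
  define U where "U = (\<lambda>i. t + y i) ` up_index n"
  define V where "V = (\<lambda>i. t - y i) ` down_index n"
  define \<phi> where "\<phi> u = t + z (inv_into (up_index n) (\<lambda>i. t + y i) u)" for u
  define \<psi> where "\<psi> v = t - z (inv_into (down_index n) (\<lambda>i. t - y i) v)" for v
  have inj: "inj_on (\<lambda>i. t + y i) (up_index n)" "inj_on (\<lambda>i. t - y i) (down_index n)"
    using yinj up down unfolding inj_on_def by simp_all
  have \<phi>: "\<phi> (t + y i) = t + z i" if "i \<in> up_index n" for i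
    unfolding \<phi>_def using inv_into_f_f[OF inj(1) that] by simp
  have \<psi>: "\<psi> (t - y i) = t - z i" if "i \<in> down_index n" for i
    unfolding \<psi>_def using inv_into_f_f[OF inj(2) that] by simp
  have mono: "strict_mono_on U \<phi>" "strict_mono_on V \<psi>"
    unfolding U_def V_def by (intro strict_mono_onI; force simp: \<phi> \<psi> ord up down)+
  have PUV: "P \<subseteq> U \<times> V" unfolding P_eq U_def V_def using \<tau>I by auto
  have QP: "Q = map_prod \<phi> \<psi> ` P"
    unfolding Q_def P_eq image_image using \<phi> \<psi> \<tau>I by (intro image_cong) auto
  have finP: "finite P" unfolding P_eq using fin by simp
  have injP: "inj_on fst P" "inj_on snd P" using good unfolding good_def generic_def by auto
  have finQ: "finite Q" unfolding Q_def using fin by simp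
  have genQ: "generic Q" unfolding QP using finP inj_map_prod_image[OF mono PUV injP]
    by (intro generic_finite) auto
  have zt: "\<bar>z i\<bar> < t" if "i \<in> ?I" for i
  proof -
    have "z i \<in> {-t<..<t}" using sep z that unfolding separated_def by (meson PiE_mem subsetD)
    then show ?thesis by auto
  qed
  show goodQ: "good Q" unfolding good_def
  proof (intro conjI ballI genQ)
    fix p assume "p \<in> Q"
    then obtain i where "p = (t + z i, t - z (\<tau> i))" "i \<in> up_index n" unfolding Q_def by blast
    then show "0 < fst p" "0 < snd p" using zt[of i] zt[of "\<tau> i"] \<tau>I up down by auto
  qed
  have pastiff: "(\<phi> u, \<psi> v) \<in> past t \<longleftrightarrow> (u, v) \<in> past t" if uv: "u \<in> U" "v \<in> V" for u v
  proof -
    obtain i j where ij: "u = t + y i" "i \<in> up_index n" "v = t - y j" "j \<in> down_index n"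
      using uv unfolding U_def V_def by blast
    then show ?thesis using ord[of j i] up down unfolding past_def by (simp add: \<phi> \<psi> not_less[symmetric])
  qed
  show Qpast: "Q \<subseteq> past t"
  proof -
    have "map_prod \<phi> \<psi> p \<in> past t" if "p \<in> P" for p
      using pastiff[of "fst p" "snd p"] that P PUV by (cases p) auto
    then show ?thesis unfolding QP by (rule image_subsetI)
  qed
  have layerQ: "layer Q k = map_prod \<phi> \<psi> ` layer P k" for k
    unfolding QP by (rule layer_image[OF finP injP PUV mono])
  have layerP: "layer P k \<subseteq> U \<times> V" for k by (rule layer_subset[OF good_generic[OF good] PUV])
  have past_image: "layer Q k \<inter> past t = map_prod \<phi> \<psi> ` (layer P k \<inter> past t)" for k
    unfolding layerQ using layerP[of k] pastiff by auto
  have inj\<phi>: "inj_on \<phi> U" "inj_on \<psi> V" using mono strict_mono_on_imp_inj_on by auto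
  have mem: "\<phi> u \<in> fst ` (layer Q k \<inter> past t) \<longleftrightarrow> u \<in> fst ` (layer P k \<inter> past t)" if "u \<in> U" for u k
  proof -
    have "fst ` (layer Q k \<inter> past t) = \<phi> ` fst ` (layer P k \<inter> past t)"
      unfolding past_image image_image by simp
    moreover have "fst ` (layer P k \<inter> past t) \<subseteq> U" using layerP[of k] by auto
    ultimately show ?thesis using inj_on_image_mem_iff[OF inj\<phi>(1) that] by simp
  qed
  have mem': "\<psi> v \<in> snd ` (layer Q k \<inter> past t) \<longleftrightarrow> v \<in> snd ` (layer P k \<inter> past t)" if "v \<in> V" for v k
  proof -
    have "snd ` (layer Q k \<inter> past t) = \<psi> ` snd ` (layer P k \<inter> past t)"
      unfolding past_image image_image by simp
    moreover have "snd ` (layer P k \<inter> past t) \<subseteq> V" using layerP[of k] by auto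
    ultimately show ?thesis using inj_on_image_mem_iff[OF inj\<phi>(2) that] by simp
  qed
  have PP: "P \<inter> past t = P" using P by blast
  note labP = labels_of_step_map(1,2)[OF good eq, unfolded PP]
  have index_up: "x \<in> positions n x' k Up \<longleftrightarrow> (\<exists>j<n k. x = x' (k, Up, j))" for x x' k
    unfolding positions_def by auto
  have index_down: "x \<in> positions n x' k Down \<longleftrightarrow> (\<exists>j<n k. x = x' (k, Down, j))" for x x' k
    unfolding positions_def by auto
  have same_up: "y i \<in> positions n y k Up \<longleftrightarrow> z i \<in> positions n z k Up" if "i \<in> ?I" for i k
    unfolding index_up using inj_on_eq_iff[OF yinj that] inj_on_eq_iff[OF zinj that]
    by (intro ex_cong1 conj_cong refl) (auto simp: step_index_def)
  have same_down: "y i \<in> positions n y k Down \<longleftrightarrow> z i \<in> positions n z k Down" if "i \<in> ?I" for i k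
    unfolding index_down using inj_on_eq_iff[OF yinj that] inj_on_eq_iff[OF zinj that]
    by (intro ex_cong1 conj_cong refl) (auto simp: step_index_def)
  have up_posD: "\<exists>i\<in>up_index n. x = x' i" if "x \<in> positions n x' k Up" for x x' k
    using that up_positions[of x n x'] by blast
  have down_posD: "\<exists>i\<in>down_index n. x = x' i" if "x \<in> positions n x' k Down" for x x' k
    using that down_positions[of x n x'] by blast
  have ups: "ups (rsk_lines Q t k) = positions n z k Up" for k
  proof -
    have "row_label Q (past t) (t + x) = Suc k \<longleftrightarrow> x \<in> positions n z k Up" for x
    proof (cases "\<exists>i\<in>up_index n. x = z i")
      case True
      then obtain i where i: "i \<in> up_index n" "x = z i" by blast
      have "row_label Q (past t) (t + x) = row_label P (past t) (t + y i)"
        unfolding row_label_def i(2) \<phi>[OF i(1), symmetric] using mem[of "t + y i"] i(1) unfolding U_def by auto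
      then show ?thesis using labP(1)[of "y i" k] same_up[OF up[OF i(1)]] i(2) by simp
    next
      case False
      have "t + x \<notin> fst ` Q" unfolding Q_def using False by auto
      then have "\<not> 0 < row_label Q (past t) (t + x)"
        unfolding less_row_label[OF genQ finQ lower_past] by auto
      then show ?thesis using False up_posD[of x z k] by auto
    qed
    then show ?thesis using ups_rsk_lines[OF goodQ finQ] by auto
  qed
  have downs: "downs (rsk_lines Q t k) = positions n z k Down" for k
  proof -
    have "col_label Q (past t) (t - x) = Suc k \<longleftrightarrow> x \<in> positions n z k Down" for x
    proof (cases "\<exists>i\<in>down_index n. x = z i")
      case True
      then obtain i where i: "i \<in> down_index n" "x = z i" by blast
      have "col_label Q (past t) (t - x) = col_label P (past t) (t - y i)"
        unfolding col_label_def i(2) \<psi>[OF i(1), symmetric] using mem'[of "t - y i"] i(1) unfolding V_def by auto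
      then show ?thesis using labP(2)[of "y i" k] same_down[OF down[OF i(1)]] i(2) by simp
    next
      case False
      have "t - x \<notin> snd ` Q" unfolding Q_def using False \<tau>I by auto
      then have "\<not> 0 < col_label Q (past t) (t - x)"
        unfolding less_col_label[OF genQ finQ lower_past] by auto
      then show ?thesis using False down_posD[of x z k] by auto
    qed
    then show ?thesis using downs_rsk_lines[OF goodQ finQ] by auto
  qed
  have LQ: "rsk_lines Q t \<in> Lambda t" by (rule rsk_lines_Lambda[OF goodQ])
  obtain n' z' where nz: "step_map (rsk_lines Q t) = (n', z')" by (metis surj_pair)
  have strict: "z (k, s, j) < z (k, s, j')" if "j < j'" "j' < n k" for k s j j'
  proof -
    have "y (k, s, j) < y (k, s, j')" using conf that unfolding configuration_def by blast
    then show ?thesis using ord[of "(k, s, j)" "(k, s, j')"] that by (simp add: step_index_def)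
  qed
  have net: "rsk_lines Q t k x = - int k + net_steps (positions n z k Up) (positions n z k Down) x" for k x
    using step_map_Lambda(1,2,6)[OF LQ nz] unfolding ups downs by simp
  have "configuration t n z" unfolding configuration_def
  proof (intro conjI ballI allI impI)
    show "net_steps (positions n z (Suc k) Up) (positions n z (Suc k) Down) x
        \<le> net_steps (positions n z k Up) (positions n z k Down) x" for k x
    proof -
      have "rsk_lines Q t (Suc k) x < rsk_lines Q t k x" using LQ unfolding Lambda_def by blast
      then show ?thesis unfolding net by simp
    qed
  qed (use zt strict in auto)
  moreover have "z \<in> extensional ?I" using z by (auto simp: PiE_def)
  ultimately show "step_map (rsk_lines Q t) = (n, z)" using ups downs by (intro step_map_eqI)
qed

text \<open>All configurations of the box come from the same matching \<open>\<tau>\<close>, and by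
  uniqueness their points up to time \<open>t\<close> are one per rectangle. Conversely, one point
  in each rectangle and none elsewhere is the transported point set of some configuration of the
  box.\<close>

lemma box_event:
  assumes sep: "separated t (step_index n) X" and y: "y \<in> PiE (step_index n) X" and Gam: "(n, y) \<in> Gamma t"
  shows "\<exists>\<tau>. bij_betw \<tau> (up_index n) (down_index n) \<and>
    (\<forall>i\<in>up_index n. (\<lambda>x. t + x) ` X i \<times> (\<lambda>x. t - x) ` X (\<tau> i) \<subseteq> past t) \<and>
    (\<forall>Q. good Q \<longrightarrow> (step_map (rsk_lines Q t) \<in> {n} \<times> PiE (step_index n) X \<longleftrightarrow>
      (\<forall>i\<in>up_index n. card (Q \<inter> (\<lambda>x. t + x) ` X i \<times> (\<lambda>x. t - x) ` X (\<tau> i)) = 1) \<and>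
      Q \<inter> past t \<subseteq> (\<Union>i\<in>up_index n. (\<lambda>x. t + x) ` X i \<times> (\<lambda>x. t - x) ` X (\<tau> i)))) \<and>
    {n} \<times> PiE (step_index n) X \<subseteq> Gamma t"
proof -
  let ?I = "step_index n"
  have yinj: "inj_on y ?I" using sep y by (rule separated_inj)
  obtain P where P: "good P" "P \<subseteq> past t" "step_map (rsk_lines P t) = (n, y)"
    by (rule points_exist[OF Gam yinj])
  obtain \<tau> where \<tau>: "bij_betw \<tau> (up_index n) (down_index n)" and P_eq: "P = (\<lambda>i. (t + y i, t - y (\<tau> i))) ` up_index n"
    by (rule points_matching[OF P yinj])
  define R where "R i = (\<lambda>x. t + x) ` X i \<times> (\<lambda>x. t - x) ` X (\<tau> i)" for i
  have up: "i \<in> ?I" if "i \<in> up_index n" for i using that unfolding step_index_split by blast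
  have down: "i \<in> ?I" if "i \<in> down_index n" for i using that unfolding step_index_split by blast
  have \<tau>I: "\<tau> i \<in> down_index n" if "i \<in> up_index n" for i using \<tau> that unfolding bij_betw_def by blast
  note transport = transport_points[OF sep y _ P \<tau> P_eq]
  have disj: "i = j" if x: "x \<in> X i" "x \<in> X j" "i \<in> ?I" "j \<in> ?I" for x i j
  proof (rule ccontr)
    assume "i \<noteq> j"
    then have "(\<forall>a\<in>X i. \<forall>b\<in>X j. a < b) \<or> (\<forall>a\<in>X i. \<forall>b\<in>X j. b < a)"
      using sep x unfolding separated_def by blast
    then show False using x(1,2) by (metis less_irrefl)
  qed
  have Rpast: "R i \<subseteq> past t" if i: "i \<in> up_index n" for i
  proof -
    have ne: "i \<noteq> \<tau> i" using i \<tau>I[OF i] step_index_split(2)[of n] by (metis disjoint_iff)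
    have mem: "y i \<in> X i" "y (\<tau> i) \<in> X (\<tau> i)" using PiE_mem[OF y] up[OF i] down[OF \<tau>I[OF i]] by blast+
    have "(t + y i, t - y (\<tau> i)) \<in> past t" using P(2) i unfolding P_eq by blast
    then have le: "y i \<le> y (\<tau> i)" unfolding past_def by simp
    \<comment> \<open>The pair \<open>y i\<close>, \<open>y (\<tau> i)\<close> has the up-step on
      the left; separation extends this to the whole rectangle.\<close>
    have "(\<forall>a\<in>X i. \<forall>b\<in>X (\<tau> i). a < b) \<or> (\<forall>a\<in>X i. \<forall>b\<in>X (\<tau> i). b < a)"
      using sep up[OF i] down[OF \<tau>I[OF i]] ne unfolding separated_def by blast
    then have "\<forall>a\<in>X i. \<forall>b\<in>X (\<tau> i). a < b" using mem le by (meson not_less)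
    then show ?thesis unfolding R_def past_def by force
  qed
  have event: "step_map (rsk_lines Q t) \<in> {n} \<times> PiE ?I X \<longleftrightarrow>
      (\<forall>i\<in>up_index n. card (Q \<inter> R i) = 1) \<and> Q \<inter> past t \<subseteq> (\<Union>i\<in>up_index n. R i)" if Q: "good Q" for Q
  proof
    assume "step_map (rsk_lines Q t) \<in> {n} \<times> PiE ?I X"
    then obtain z where z: "z \<in> PiE ?I X" "step_map (rsk_lines Q t) = (n, z)" by blast
    let ?P = "(\<lambda>i. (t + z i, t - z (\<tau> i))) ` up_index n"
    note tr = transport[OF z(1)]
    have "Q \<inter> past t = ?P \<inter> past t"
      by (rule points_unique[OF Q tr(1)]) (simp add: z(2) tr(3))
    then have QP: "Q \<inter> past t = ?P" using tr(2) by blast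
    have zX: "z i \<in> X i" if "i \<in> ?I" for i using PiE_mem[OF z(1) that] .
    have "Q \<inter> R i = {(t + z i, t - z (\<tau> i))}" if i: "i \<in> up_index n" for i
    proof -
      have "Q \<inter> R i = ?P \<inter> R i" using QP Rpast[OF i] by blast
      also have "\<dots> = {(t + z i, t - z (\<tau> i))}"
      proof -
        have "i' = i" if "i' \<in> up_index n" "(t + z i', t - z (\<tau> i')) \<in> R i" for i'
          using that disj[of "z i'" i' i] zX[OF up[OF that(1)]] up i unfolding R_def by auto
        moreover have "(t + z i, t - z (\<tau> i)) \<in> R i" unfolding R_def using zX up i down \<tau>I by blast
        ultimately show ?thesis using i by blast
      qed
      finally show ?thesis .
    qed
    moreover have "Q \<inter> past t \<subseteq> (\<Union>i\<in>up_index n. R i)"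
      unfolding QP R_def using zX up down \<tau>I by blast
    ultimately show "(\<forall>i\<in>up_index n. card (Q \<inter> R i) = 1) \<and> Q \<inter> past t \<subseteq> (\<Union>i\<in>up_index n. R i)" by simp
  next
    assume ev: "(\<forall>i\<in>up_index n. card (Q \<inter> R i) = 1) \<and> Q \<inter> past t \<subseteq> (\<Union>i\<in>up_index n. R i)"
    then have "\<forall>i\<in>up_index n. \<exists>q. Q \<inter> R i = {q}" by (metis card_1_singletonE)
    then obtain q where q: "\<And>i. i \<in> up_index n \<Longrightarrow> Q \<inter> R i = {q i}" by metis
    define \<sigma> where "\<sigma> = inv_into (up_index n) \<tau>"
    have \<sigma>: "\<sigma> (\<tau> i) = i" if "i \<in> up_index n" for i
      unfolding \<sigma>_def using \<tau> that by (simp add: bij_betw_def)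
    have \<tau>\<sigma>: "\<tau> (\<sigma> j) = j" "\<sigma> j \<in> up_index n" if "j \<in> down_index n" for j
      unfolding \<sigma>_def using \<tau> that by (auto simp: bij_betw_def f_inv_into_f inv_into_into)
    \<comment> \<open>The chosen points give the up-steps by their first coordinates and, read
      through \<open>\<sigma>\<close>, the down-steps by their second ones.\<close>
    define z where "z = (\<lambda>i\<in>?I. if i \<in> up_index n then fst (q i) - t else t - snd (q (\<sigma> i)))"
    have qR: "q i \<in> R i" if "i \<in> up_index n" for i using q[OF that] by blast
    have zup: "z i = fst (q i) - t" if "i \<in> up_index n" for i unfolding z_def using that up by simp
    have zdown: "z i = t - snd (q (\<sigma> i))" if "i \<in> down_index n" for i
    proof -
      have "i \<notin> up_index n" using that step_index_split(2)[of n] by blast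
      then show ?thesis unfolding z_def using that down by simp
    qed
    have z: "z \<in> PiE ?I X"
    proof (rule PiE_I)
      fix i assume "i \<in> ?I"
      then consider "i \<in> up_index n" | "i \<in> down_index n" unfolding step_index_split by blast
      then show "z i \<in> X i"
      proof cases
        case 1
        then show ?thesis using qR[OF 1] unfolding zup[OF 1] R_def by auto
      next
        case 2
        then show ?thesis using qR[OF \<tau>\<sigma>(2)[OF 2]] unfolding zdown[OF 2] R_def \<tau>\<sigma>(1)[OF 2] by auto
      qed
    qed (simp add: z_def)
    let ?P = "(\<lambda>i. (t + z i, t - z (\<tau> i))) ` up_index n"
    have qz: "(t + z i, t - z (\<tau> i)) = q i" if "i \<in> up_index n" for i
      unfolding zup[OF that] zdown[OF \<tau>I[OF that]] \<sigma>[OF that] by simp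
    then have P': "?P = q ` up_index n" by simp
    have "Q \<inter> past t = q ` up_index n"
    proof
      show "Q \<inter> past t \<subseteq> q ` up_index n"
      proof
        fix p assume p: "p \<in> Q \<inter> past t"
        then obtain i where i: "i \<in> up_index n" "p \<in> R i" using ev by blast
        then have "p = q i" using q[OF i(1)] p by blast
        then show "p \<in> q ` up_index n" using i(1) by blast
      qed
      show "q ` up_index n \<subseteq> Q \<inter> past t"
      proof (rule image_subsetI)
        fix i assume "i \<in> up_index n"
        then show "q i \<in> Q \<inter> past t" using q[of i] Rpast[of i] by blast
      qed
    qed
    then have QP: "Q \<inter> past t = ?P" unfolding P' .
    have "step_map (rsk_lines ?P t) = (n, z)" by (rule transport(3)[OF z])
    then have "step_map (rsk_lines Q t) = (n, z)" unfolding QP[symmetric] rsk_lines_past .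
    then show "step_map (rsk_lines Q t) \<in> {n} \<times> PiE ?I X" using z by simp
  qed
  have "(n, z) \<in> Gamma t" if "z \<in> PiE ?I X" for z
    using imageI[OF rsk_lines_Lambda[OF transport(1)[OF that], of t], of step_map]
    unfolding transport(3)[OF that] Gamma_def .
  then have Gam': "{n} \<times> PiE ?I X \<subseteq> Gamma t" by blast
  show ?thesis
  proof (intro exI[of _ \<tau>] conjI ballI allI impI)
    show "(\<lambda>x. t + x) ` X i \<times> (\<lambda>x. t - x) ` X (\<tau> i) \<subseteq> past t" if "i \<in> up_index n" for i
      by (rule Rpast[unfolded R_def, OF that])
    show "step_map (rsk_lines Q t) \<in> {n} \<times> PiE ?I X \<longleftrightarrow>
      (\<forall>i\<in>up_index n. card (Q \<inter> (\<lambda>x. t + x) ` X i \<times> (\<lambda>x. t - x) ` X (\<tau> i)) = 1) \<and>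
      Q \<inter> past t \<subseteq> (\<Union>i\<in>up_index n. (\<lambda>x. t + x) ` X i \<times> (\<lambda>x. t - x) ` X (\<tau> i))" if "good Q" for Q
      by (rule event[unfolded R_def, OF that])
  qed (rule \<tau> Gam')+
qed

section \<open>The configuration space as a measure space\<close>

text \<open>Just to the left of a point that is no step both functions keep their values, so a
  nearby rational decides; the steps are checked separately. This makes the order of the lines a
  countable condition.\<close>

lemma net_steps_rational:
  assumes fin: "finite A" "finite B" "finite A'" "finite B'"
    and rat: "\<And>q. net_steps A B (of_rat q) \<le> net_steps A' B' (of_rat q)"
    and pts: "\<And>z. z \<in> A \<union> B \<union> A' \<union> B' \<Longrightarrow> net_steps A B z \<le> net_steps A' B' z"
  shows "net_steps A B x \<le> net_steps A' B' x"
proof (cases "x \<in> A \<union> B \<union> A' \<union> B'")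
  case False
  obtain d where d: "d > 0"
    "\<And>y. x - d < y \<Longrightarrow> y < x \<Longrightarrow> net_steps A B y = net_steps A B x - of_bool (x \<in> A)"
    by (rule net_steps_local[OF fin(1,2), of x], rule that) blast+
  obtain d' where d': "d' > 0"
    "\<And>y. x - d' < y \<Longrightarrow> y < x \<Longrightarrow> net_steps A' B' y = net_steps A' B' x - of_bool (x \<in> A')"
    by (rule net_steps_local[OF fin(3,4), of x], rule that) blast+
  have "x - min d d' < x" using d(1) d'(1) by simp
  then obtain q where q: "q \<in> \<rat>" "x - min d d' < q" "q < x" using Rats_dense_in_real by blast
  then have "net_steps A B q = net_steps A B x" "net_steps A' B' q = net_steps A' B' x"
    using d(2)[of q] d'(2)[of q] False by auto
  moreover obtain q' where "q = of_rat q'" using q(1) by (rule Rats_cases)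
  ultimately show ?thesis using rat[of q'] by simp
qed (rule pts)

text \<open>\<open>net_steps\<close> takes sets of positions; the sum over indices depends
  measurably on \<open>y\<close> and agrees with it as long as the steps of one kind in a line do
  not coincide.\<close>

definition index_net :: "(nat \<Rightarrow> nat) \<Rightarrow> (step_index \<Rightarrow> real) \<Rightarrow> nat \<Rightarrow> real \<Rightarrow> real" where
  "index_net n y k x = (\<Sum>j<n k. of_bool (y (k, Up, j) \<le> x)) - (\<Sum>j<n k. of_bool (y (k, Down, j) < x))"

lemma index_net:
  assumes "inj_on (\<lambda>j. y (k, Up, j)) {..<n k}" "inj_on (\<lambda>j. y (k, Down, j)) {..<n k}"
  shows "index_net n y k x = real_of_int (net_steps (positions n y k Up) (positions n y k Down) x)"
proof -
  have sum: "(\<Sum>j<n k. of_bool (Q j)) = real (card {j\<in>{..<n k}. Q j})" for Q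
    by (simp add: of_bool_def sum.If_cases Int_def conj_commute)
  have "{z\<in>positions n y k Up. z \<le> x} = (\<lambda>j. y (k, Up, j)) ` {j\<in>{..<n k}. y (k, Up, j) \<le> x}"
    "{z\<in>positions n y k Down. z < x} = (\<lambda>j. y (k, Down, j)) ` {j\<in>{..<n k}. y (k, Down, j) < x}"
    unfolding positions_def by auto
  moreover have "card ((\<lambda>j. y (k, Up, j)) ` {j\<in>{..<n k}. Q j}) = card {j\<in>{..<n k}. Q j}" for Q
    by (rule card_image) (rule inj_on_subset[OF assms(1)], auto)
  moreover have "card ((\<lambda>j. y (k, Down, j)) ` {j\<in>{..<n k}. Q j}) = card {j\<in>{..<n k}. Q j}" for Q
    by (rule card_image) (rule inj_on_subset[OF assms(2)], auto)
  ultimately show ?thesis unfolding index_net_def sum net_steps_def by (simp only: of_int_diff of_int_of_nat_eq)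
qed

lemma configuration_countable:
  "configuration t n y \<longleftrightarrow>
     (\<forall>i\<in>step_index n. \<bar>y i\<bar> < t) \<and>
     (\<forall>k. \<forall>j'<n k. \<forall>j<j'. y (k, Up, j) < y (k, Up, j') \<and> y (k, Down, j) < y (k, Down, j')) \<and>
     (\<forall>k. (\<forall>q. index_net n y (Suc k) (of_rat q) \<le> index_net n y k (of_rat q)) \<and>
       (\<forall>i\<in>step_index n. index_net n y (Suc k) (y i) \<le> index_net n y k (y i)))" (is "?L \<longleftrightarrow> ?R1 \<and> ?R2 \<and> ?R3")
proof -
  have R2: "?R2 \<longleftrightarrow> (\<forall>k s j j'. j < j' \<and> j' < n k \<longrightarrow> y (k, s, j) < y (k, s, j'))"
  proof
    assume r: ?R2
    show "\<forall>k s j j'. j < j' \<and> j' < n k \<longrightarrow> y (k, s, j) < y (k, s, j')"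
    proof (intro allI impI)
      fix k s j j' assume "j < j' \<and> j' < n k"
      then show "y (k, s, j) < y (k, s, j')" using r by (cases s) auto
    qed
  qed blast
  have net: "index_net n y k x = real_of_int (net_steps (positions n y k Up) (positions n y k Down) x)" if R2: ?R2 for k x
  proof -
    have "y (k, Up, j) \<noteq> y (k, Up, j')" "y (k, Down, j) \<noteq> y (k, Down, j')" if "j < j'" "j' < n k" for j j'
      using R2 that by (metis less_irrefl)+
    then have "inj_on (\<lambda>j. y (k, Up, j)) {..<n k}" "inj_on (\<lambda>j. y (k, Down, j)) {..<n k}"
      unfolding inj_on_def by (metis lessThan_iff linorder_neqE_nat)+
    then show ?thesis by (rule index_net)
  qed
  have pos: "z \<in> y ` step_index n" if "z \<in> positions n y k s" for z k s
    using that unfolding positions_def step_index_def by auto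
  have "?R3 \<longleftrightarrow> (\<forall>k x. net_steps (positions n y (Suc k) Up) (positions n y (Suc k) Down) x
        \<le> net_steps (positions n y k Up) (positions n y k Down) x)" if R2: ?R2
  proof
    assume r: ?R3
    show "\<forall>k x. net_steps (positions n y (Suc k) Up) (positions n y (Suc k) Down) x
        \<le> net_steps (positions n y k Up) (positions n y k Down) x"
    proof (intro allI)
      fix k x
      have le: "net_steps (positions n y (Suc k) Up) (positions n y (Suc k) Down) z
        \<le> net_steps (positions n y k Up) (positions n y k Down) z"
        if "index_net n y (Suc k) z \<le> index_net n y k z" for z
        using that unfolding net[OF R2] by (simp only: of_int_le_iff)
      show "net_steps (positions n y (Suc k) Up) (positions n y (Suc k) Down) x
        \<le> net_steps (positions n y k Up) (positions n y k Down) x"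
      proof (rule net_steps_rational)
        fix z
        assume "z \<in> positions n y (Suc k) Up \<union> positions n y (Suc k) Down \<union> positions n y k Up \<union> positions n y k Down"
        then have "z \<in> y ` step_index n" using pos by (elim UnE) blast+
        then obtain i where i: "i \<in> step_index n" "z = y i" by blast
        show "net_steps (positions n y (Suc k) Up) (positions n y (Suc k) Down) z
          \<le> net_steps (positions n y k Up) (positions n y k Down) z"
          unfolding i(2) by (rule le) (use r i(1) in blast)
      qed (simp_all add: le r)
    qed
  qed (simp add: net[OF R2])
  then show ?thesis unfolding configuration_def R2[symmetric] by blast
qed

lemma space_step_lebesgue: "space (step_lebesgue n) = extensional (step_index n)"
  unfolding step_lebesgue_def by (simp add: space_PiM PiE_def)

lemma slice_Gamma_sets:
  assumes n: "finite {k. n k \<noteq> 0}"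
  shows "slice n (Gamma t) \<in> sets (step_lebesgue n)"
proof -
  let ?I = "step_index n"
  have fin: "finite ?I" by (rule finite_step_index[OF n])
  have comp: "(\<lambda>y. y (k, s, j)) \<in> borel_measurable (step_lebesgue n)" if "j < n k" for k s j
  proof -
    have "(k, s, j) \<in> ?I" using that by (simp add: step_index_def)
    then show ?thesis unfolding step_lebesgue_def using measurable_component_singleton[of "(k, s, j)" ?I "\<lambda>_. lborel"] by simp
  qed
  have comp': "(\<lambda>y. y i) \<in> borel_measurable (step_lebesgue n)" if "i \<in> ?I" for i
    unfolding step_lebesgue_def using measurable_component_singleton[OF that, of "\<lambda>_. lborel"] by simp
  have net: "(\<lambda>y. index_net n y k (f y)) \<in> borel_measurable (step_lebesgue n)"
    if [measurable]: "f \<in> borel_measurable (step_lebesgue n)" for f k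
  proof -
    have "(\<lambda>y. of_bool (y (k, Up, j) \<le> f y) :: real) \<in> borel_measurable (step_lebesgue n)"
      "(\<lambda>y. of_bool (y (k, Down, j) < f y) :: real) \<in> borel_measurable (step_lebesgue n)" if "j < n k" for j
    proof -
      note [measurable] = comp[OF that]
      show "(\<lambda>y. of_bool (y (k, Up, j) \<le> f y) :: real) \<in> borel_measurable (step_lebesgue n)"
        "(\<lambda>y. of_bool (y (k, Down, j) < f y) :: real) \<in> borel_measurable (step_lebesgue n)"
        unfolding of_bool_def by measurable
    qed
    then show ?thesis unfolding index_net_def by (intro borel_measurable_diff borel_measurable_sum) auto
  qed
  have "Measurable.pred (step_lebesgue n) (\<lambda>y. configuration t n y)"
    unfolding configuration_countable
  proof (intro pred_intros_logic)
    show "Measurable.pred (step_lebesgue n) (\<lambda>y. \<forall>i\<in>?I. \<bar>y i\<bar> < t)"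
    proof (rule pred_intros_finite(3)[OF fin])
      fix i assume "i \<in> ?I"
      note [measurable] = comp'[OF this]
      show "Measurable.pred (step_lebesgue n) (\<lambda>y. \<bar>y i\<bar> < t)" by measurable
    qed
    show "Measurable.pred (step_lebesgue n) (\<lambda>y. \<forall>k. \<forall>j'<n k. \<forall>j<j'. y (k, Up, j) < y (k, Up, j') \<and> y (k, Down, j) < y (k, Down, j'))"
    proof (intro pred_intros_countable(1) pred_intros_imp')
      fix k j' j assume j: "j' < n k" "j < j'"
      then have "j < n k" by simp
      note [measurable] = comp[OF j(1)] comp[OF this]
      show "Measurable.pred (step_lebesgue n) (\<lambda>y. y (k, Up, j) < y (k, Up, j') \<and> y (k, Down, j) < y (k, Down, j'))"
        by measurable
    qed
    show "Measurable.pred (step_lebesgue n) (\<lambda>y. \<forall>k. (\<forall>q. index_net n y (Suc k) (of_rat q) \<le> index_net n y k (of_rat q)) \<and>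
       (\<forall>i\<in>?I. index_net n y (Suc k) (y i) \<le> index_net n y k (y i)))"
    proof (intro pred_intros_countable(1) pred_intros_logic)
      fix k and q :: rat
        show "Measurable.pred (step_lebesgue n) (\<lambda>y. index_net n y (Suc k) (of_rat q) \<le> index_net n y k (of_rat q))"
          unfolding Measurable.pred_def by (intro borel_measurable_le net) simp_all
    next
      fix k
      show "Measurable.pred (step_lebesgue n) (\<lambda>y. \<forall>i\<in>?I. index_net n y (Suc k) (y i) \<le> index_net n y k (y i))"
      proof (rule pred_intros_finite(3)[OF fin])
        fix i assume "i \<in> ?I"
        then show "Measurable.pred (step_lebesgue n) (\<lambda>y. index_net n y (Suc k) (y i) \<le> index_net n y k (y i))"
          unfolding Measurable.pred_def by (intro borel_measurable_le net comp')
      qed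
    qed
  qed
  moreover have "slice n (Gamma t) = {y\<in>space (step_lebesgue n). configuration t n y}"
    unfolding slice_def Gamma_iff space_step_lebesgue using n by auto
  ultimately show ?thesis by simp
qed

definition step_numbers :: "(nat \<Rightarrow> nat) set" where
  "step_numbers = {n. finite {k. n k \<noteq> 0}}"

definition w_sets :: "real \<Rightarrow> step_config set set" where
  "w_sets t = {A. A \<subseteq> Gamma t \<and> (\<forall>n. finite {k. n k \<noteq> 0} \<longrightarrow> slice n A \<in> sets (step_lebesgue n))}"

definition w_mass :: "step_config set \<Rightarrow> ennreal" where
  "w_mass A = (\<integral>\<^sup>+n. emeasure (step_lebesgue n) (slice n A) \<partial>count_space step_numbers)"

lemma w_sets_Pow: "w_sets t \<subseteq> Pow (Gamma t)"
  unfolding w_sets_def by auto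

lemma sigma_algebra_w: "sigma_algebra (Gamma t) (w_sets t)"
  unfolding sigma_algebra_iff2
proof (intro conjI ballI allI impI)
  show "w_sets t \<subseteq> Pow (Gamma t)" by (rule w_sets_Pow)
  show "{} \<in> w_sets t" unfolding w_sets_def slice_def by auto
  fix A assume A: "A \<in> w_sets t"
  have "slice n (Gamma t - A) = slice n (Gamma t) - slice n A" for n unfolding slice_def by auto
  then show "Gamma t - A \<in> w_sets t" using A slice_Gamma_sets unfolding w_sets_def by auto
next
  fix A :: "nat \<Rightarrow> step_config set" assume A: "range A \<subseteq> w_sets t"
  have "slice n (\<Union>i. A i) = (\<Union>i. slice n (A i))" for n unfolding slice_def by auto
  moreover have "(\<Union>i. slice n (A i)) \<in> sets (step_lebesgue n)" if "finite {k. n k \<noteq> 0}" for n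
    using A that unfolding w_sets_def by (intro sets.countable_UN) auto
  ultimately show "(\<Union>i. A i) \<in> w_sets t" using A unfolding w_sets_def by auto
qed

lemma w_eq: "w t = measure_of (Gamma t) (w_sets t) w_mass"
  unfolding w_def w_sets_def w_mass_def[abs_def] step_numbers_def ..

lemma space_w: "space (w t) = Gamma t"
  unfolding w_eq using w_sets_Pow by (rule space_measure_of)

lemma sets_w: "sets (w t) = w_sets t"
  unfolding w_eq using w_sets_Pow
  by (simp add: sigma_algebra.sigma_sets_eq[OF sigma_algebra_w])

lemma emeasure_w:
  assumes "A \<in> w_sets t"
  shows "emeasure (w t) A = w_mass A"
  unfolding w_eq
proof (rule emeasure_measure_of_sigma[OF sigma_algebra_w _ _ assms])
  show "positive (w_sets t) w_mass" unfolding positive_def w_mass_def slice_def by simp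
  show "countably_additive (w_sets t) w_mass" unfolding countably_additive_def
  proof (intro allI impI)
    fix A :: "nat \<Rightarrow> step_config set"
    assume A: "range A \<subseteq> w_sets t" "disjoint_family A"
    have "(\<Sum>i. w_mass (A i)) = (\<integral>\<^sup>+n. (\<Sum>i. emeasure (step_lebesgue n) (slice n (A i))) \<partial>count_space step_numbers)"
      unfolding w_mass_def by (rule nn_integral_suminf[symmetric]) simp
    also have "\<dots> = w_mass (\<Union>i. A i)" unfolding w_mass_def
    proof (rule nn_integral_cong)
      fix n assume "n \<in> space (count_space step_numbers)"
      then have "range (\<lambda>i. slice n (A i)) \<subseteq> sets (step_lebesgue n)"
        using A unfolding w_sets_def step_numbers_def by auto
      moreover have "disjoint_family (\<lambda>i. slice n (A i))"
        using A(2) unfolding disjoint_family_on_def slice_def by blast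
      ultimately have "(\<Sum>i. emeasure (step_lebesgue n) (slice n (A i))) = emeasure (step_lebesgue n) (\<Union>i. slice n (A i))"
        by (rule suminf_emeasure)
      also have "(\<Union>i. slice n (A i)) = slice n (\<Union>i. A i)" unfolding slice_def by auto
      finally show "(\<Sum>i. emeasure (step_lebesgue n) (slice n (A i))) = emeasure (step_lebesgue n) (slice n (\<Union>i. A i))" .
    qed
    finally show "(\<Sum>i. w_mass (A i)) = w_mass (\<Union>i. A i)" .
  qed
qed

lemma countable_step_numbers: "countable step_numbers"
proof -
  have "countable {f :: nat \<Rightarrow> nat. finite {k. f k \<noteq> 0}}"
  proof -
    have "n \<in> range (\<lambda>xs :: nat list. \<lambda>k. if k < length xs then xs ! k else 0)" if n: "finite {k. n k \<noteq> 0}" for n :: "nat \<Rightarrow> nat"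
    proof -
      obtain K where K: "\<forall>k\<in>{k. n k \<noteq> 0}. k < K" using n finite_nat_set_iff_bounded by blast
      have "n = (\<lambda>k. if k < length (map n [0..<K]) then map n [0..<K] ! k else 0)"
        using K by (auto simp: fun_eq_iff)
      then show ?thesis by blast
    qed
    then have "{f :: nat \<Rightarrow> nat. finite {k. f k \<noteq> 0}} \<subseteq> range (\<lambda>xs :: nat list. \<lambda>k. if k < length xs then xs ! k else 0)"
      by blast
    then show ?thesis by (rule countable_subset) simp
  qed
  then show ?thesis unfolding step_numbers_def .
qed

section \<open>From matched points to the law of the steps\<close>

definition past_cone :: "real \<Rightarrow> (real \<times> real) set" where
  "past_cone t = past t \<inter> {p. 0 < fst p \<and> 0 < snd p}"

text \<open>The interface shared by the Poisson process, where \<open>c\<close> is the constant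
  \<open>exp (- (2 * t\<^sup>2))\<close>, and by \<open>m\<close> uniform points, where
  \<open>c m = m!\<close> and \<open>c\<close> vanishes elsewhere.\<close>

definition matching_law :: "'a measure \<Rightarrow> ('a \<Rightarrow> (real \<times> real) set) \<Rightarrow> real \<Rightarrow> (nat \<Rightarrow> ennreal) \<Rightarrow> bool" where
  "matching_law M N t c \<longleftrightarrow> (\<forall>\<omega>\<in>space M. good (N \<omega>)) \<and>
     (\<forall>(I :: step_index set) R. finite I \<and> disjoint_family_on R I \<and> (\<forall>i\<in>I. R i \<in> sets borel \<and> R i \<subseteq> past_cone t) \<longrightarrow>
        {\<omega>\<in>space M. (\<forall>i\<in>I. card (N \<omega> \<inter> R i) = 1) \<and> N \<omega> \<inter> past t \<subseteq> (\<Union>i\<in>I. R i)} \<in> sets M \<and>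
        emeasure M {\<omega>\<in>space M. (\<forall>i\<in>I. card (N \<omega> \<inter> R i) = 1) \<and> N \<omega> \<inter> past t \<subseteq> (\<Union>i\<in>I. R i)} =
          c (card I) * (\<Prod>i\<in>I. emeasure lborel (R i)))"

lemma shift_borel:
  fixes X :: "real set"
  assumes "X \<in> sets borel"
  shows "(\<lambda>x. t + x) ` X \<in> sets borel" "emeasure lborel ((\<lambda>x. t + x) ` X) = emeasure lborel X"
proof -
  have eq: "(\<lambda>x. t + x) ` X = (\<lambda>x. x - t) -` X \<inter> space borel" by (force simp: image_iff)
  show meas: "(\<lambda>x. t + x) ` X \<in> sets borel" unfolding eq using assms by measurable
  have "emeasure lborel ((\<lambda>x. t + x) ` X) = emeasure (distr lborel borel ((+) t)) ((\<lambda>x. t + x) ` X)"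
    by (simp add: lborel_distr_plus)
  also have "\<dots> = emeasure lborel ((+) t -` ((+) t ` X))" using meas by (subst emeasure_distr) auto
  also have "(+) t -` ((+) t ` X) = X" by auto
  finally show "emeasure lborel ((\<lambda>x. t + x) ` X) = emeasure lborel X" .
qed

lemma reflect_borel:
  fixes X :: "real set"
  assumes "X \<in> sets borel"
  shows "(\<lambda>x. t - x) ` X \<in> sets borel" "emeasure lborel ((\<lambda>x. t - x) ` X) = emeasure lborel X"
proof -
  have eq: "uminus ` X = uminus -` X \<inter> space borel" by (force simp: image_iff)
  have meas: "uminus ` X \<in> sets borel" unfolding eq using assms by measurable
  have "emeasure lborel (uminus ` X) = emeasure (distr lborel borel uminus) (uminus ` X)"
    by (simp add: lborel_distr_uminus)
  also have "\<dots> = emeasure lborel (uminus -` (uminus ` X))" using meas by (subst emeasure_distr) auto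
  also have "uminus -` (uminus ` X) = X" by auto
  finally have "emeasure lborel (uminus ` X) = emeasure lborel X" .
  moreover have "(\<lambda>x. t - x) ` X = (\<lambda>x. t + x) ` uminus ` X" by (simp add: image_image)
  ultimately show "(\<lambda>x. t - x) ` X \<in> sets borel" "emeasure lborel ((\<lambda>x. t - x) ` X) = emeasure lborel X"
    using shift_borel[OF meas] by simp_all
qed

interpretation step_product: product_sigma_finite "\<lambda>_ :: step_index. lborel :: real measure"
  by standard

lemma emeasure_step_box:
  assumes "finite (step_index n)" "\<And>i. i \<in> step_index n \<Longrightarrow> X i \<in> sets borel"
  shows "emeasure (step_lebesgue n) (PiE (step_index n) X) = (\<Prod>i\<in>step_index n. emeasure lborel (X i))"
  unfolding step_lebesgue_def using assms by (intro step_product.emeasure_PiM) auto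

definition cfg_event :: "'a measure \<Rightarrow> ('a \<Rightarrow> (real \<times> real) set) \<Rightarrow> real \<Rightarrow> (nat \<Rightarrow> nat) \<Rightarrow> (step_index \<Rightarrow> real) set \<Rightarrow> 'a set" where
  "cfg_event M N t n A = {\<omega>\<in>space M. step_map (rsk_lines (N \<omega>) t) \<in> {n} \<times> A}"

lemma cfg_event_iff: "\<omega> \<in> cfg_event M N t n A \<longleftrightarrow>
    \<omega> \<in> space M \<and> fst (step_map (rsk_lines (N \<omega>) t)) = n \<and> snd (step_map (rsk_lines (N \<omega>) t)) \<in> A"
  unfolding cfg_event_def mem_Times_iff by simp

definition good_event :: "'a measure \<Rightarrow> ('a \<Rightarrow> (real \<times> real) set) \<Rightarrow> real \<Rightarrow> (nat \<Rightarrow> ennreal) \<Rightarrow> (nat \<Rightarrow> nat) \<Rightarrow>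
    (step_index \<Rightarrow> real) set \<Rightarrow> bool" where
  "good_event M N t c n A \<longleftrightarrow> cfg_event M N t n A \<in> sets M \<and>
     emeasure M (cfg_event M N t n A) = c (card (up_index n)) * emeasure (step_lebesgue n) (A \<inter> slice n (Gamma t))"

text \<open>Rational end points make the family countable, while the boxes still cover every
  configuration with distinct positions.\<close>

definition rational_boxes :: "real \<Rightarrow> (nat \<Rightarrow> nat) \<Rightarrow> (step_index \<Rightarrow> real) set set" where
  "rational_boxes t n = (\<lambda>(a, b). PiE (step_index n) (\<lambda>i. {a i<..<b i})) `
     {(a, b). a \<in> PiE (step_index n) (\<lambda>_. \<rat>) \<and> b \<in> PiE (step_index n) (\<lambda>_. \<rat>) \<and>
        separated t (step_index n) (\<lambda>i. {a i<..<b i})}"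

lemma countable_rational_boxes:
  assumes n: "finite {k. n k \<noteq> 0}"
  shows "countable (rational_boxes t n)"
proof -
  have "countable (PiE (step_index n) (\<lambda>_. \<rat> :: real set))"
    by (rule countable_PiE[OF finite_step_index[OF n]]) (rule countable_rat)
  then have "countable (PiE (step_index n) (\<lambda>_. \<rat> :: real set) \<times> PiE (step_index n) (\<lambda>_. \<rat> :: real set))" by simp
  then show ?thesis unfolding rational_boxes_def
    by (intro countable_image) (rule countable_subset[rotated], assumption, auto)
qed

lemma rational_boxes_cover:
  assumes n: "finite {k. n k \<noteq> 0}" and y: "y \<in> slice n (Gamma t)" and inj: "inj_on y (step_index n)"
  shows "y \<in> \<Union>(rational_boxes t n)"
proof -
  let ?I = "step_index n"
  have fin: "finite ?I" by (rule finite_step_index[OF n])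
  have conf: "configuration t n y" and ext: "y \<in> extensional ?I" using y unfolding slice_def Gamma_iff by auto
  \<comment> \<open>The distances between steps and from the steps to the end points of the
    interval; neighbourhoods of radius below half of their minimum are disjoint and stay
    inside.\<close>
  define D where "D = insert 1 ((\<Union>i\<in>?I. (\<lambda>j. \<bar>y i - y j\<bar>) ` (?I - {i})) \<union> (\<lambda>i. t - \<bar>y i\<bar>) ` ?I)"
  have finD: "finite D" unfolding D_def using fin by auto
  have pos: "0 < x" if "x \<in> D" for x
    using that unfolding D_def
  proof (elim insertE UnE UN_E imageE)
    fix i j assume ij: "i \<in> ?I" "j \<in> ?I - {i}" "x = \<bar>y i - y j\<bar>"
    then have "y i \<noteq> y j" using inj_onD[OF inj, of i j] by blast
    then show ?thesis using ij by simp
  next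
    fix i assume "i \<in> ?I" "x = t - \<bar>y i\<bar>"
    then show ?thesis using conf unfolding configuration_def by simp
  qed simp
  define d where "d = Min D"
  have d: "0 < d" unfolding d_def using finD pos by (subst Min_gr_iff) (auto simp: D_def)
  have d1: "d \<le> \<bar>y i - y j\<bar>" if "i \<in> ?I" "j \<in> ?I" "i \<noteq> j" for i j
    unfolding d_def by (rule Min_le[OF finD]) (use that in \<open>unfold D_def, blast\<close>)
  have d2: "d \<le> t - \<bar>y i\<bar>" if "i \<in> ?I" for i
    unfolding d_def by (rule Min_le[OF finD]) (use that in \<open>unfold D_def, blast\<close>)
  have "\<exists>q\<in>\<rat>. y i - d / 2 < q \<and> q < y i" "\<exists>q\<in>\<rat>. y i < q \<and> q < y i + d / 2" for i
    using d by (auto intro!: Rats_dense_in_real)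
  then obtain a b where ab: "\<And>i. a i \<in> \<rat> \<and> y i - d / 2 < a i \<and> a i < y i" "\<And>i. b i \<in> \<rat> \<and> y i < b i \<and> b i < y i + d / 2"
    by metis
  let ?a = "restrict a ?I" and ?b = "restrict b ?I"
  have "separated t ?I (\<lambda>i. {?a i<..<?b i})" unfolding separated_def
  proof (intro conjI ballI impI)
    fix i assume i: "i \<in> ?I"
    show "{?a i<..<?b i} \<subseteq> {-t<..<t}"
      using d2[OF i] ab(1)[of i] ab(2)[of i] i d by (auto simp: abs_le_iff)
  next
    fix i j assume ij: "i \<in> ?I" "j \<in> ?I" "i \<noteq> j"
    have "b i < a j \<or> b j < a i"
      using d1[OF ij] ab(1)[of i] ab(2)[of i] ab(1)[of j] ab(2)[of j] by linarith
    then show "(\<forall>x\<in>{?a i<..<?b i}. \<forall>y\<in>{?a j<..<?b j}. x < y) \<or> (\<forall>x\<in>{?a i<..<?b i}. \<forall>y\<in>{?a j<..<?b j}. y < x)"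
      using ij by auto
  qed
  then have "PiE ?I (\<lambda>i. {?a i<..<?b i}) \<in> rational_boxes t n"
    unfolding rational_boxes_def using ab by (intro image_eqI[of _ _ "(?a, ?b)"]) auto
  moreover have "y \<in> PiE ?I (\<lambda>i. {?a i<..<?b i})" using ab ext by (auto simp: PiE_iff)
  ultimately show ?thesis by blast
qed

context
  fixes M :: "'a measure" and N :: "'a \<Rightarrow> (real \<times> real) set" and t :: real and c :: "nat \<Rightarrow> ennreal" and n :: "nat \<Rightarrow> nat"
  assumes law: "matching_law M N t c" and n: "finite {k. n k \<noteq> 0}" and c: "\<And>m. c m \<noteq> \<infinity>"
begin

abbreviation "cfg \<omega> \<equiv> step_map (rsk_lines (N \<omega>) t)"

lemma good_N: "\<omega> \<in> space M \<Longrightarrow> good (N \<omega>)"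
  using law unfolding matching_law_def by blast

lemma cfg_Gamma: "\<omega> \<in> space M \<Longrightarrow> cfg \<omega> \<in> Gamma t"
  unfolding Gamma_def by (intro imageI rsk_lines_Lambda good_N)

text \<open>A separated box is either disjoint from \<open>Gamma t\<close> or contained in it. In
  the second case \<open>box_event\<close> names the rectangles, and as \<open>\<tau>\<close> is a
  bijection, the product of their areas is the product of all side lengths of the box.\<close>

lemma good_event_box:
  assumes X: "\<And>i. i \<in> step_index n \<Longrightarrow> X i \<in> sets borel" and sep: "separated t (step_index n) X"
  shows "good_event M N t c n (PiE (step_index n) X)"
proof (cases "PiE (step_index n) X \<inter> slice n (Gamma t) = {}")
  case True
  have "\<omega> \<notin> cfg_event M N t n (PiE (step_index n) X)" for \<omega>
    using cfg_Gamma[of \<omega>] True unfolding cfg_event_def slice_def by auto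
  then have "cfg_event M N t n (PiE (step_index n) X) = {}" by blast
  then show ?thesis unfolding good_event_def True by simp
next
  case False
  let ?I = "step_index n"
  obtain y where y: "y \<in> PiE ?I X" "(n, y) \<in> Gamma t" using False unfolding slice_def by blast
  have fin: "finite ?I" by (rule finite_step_index[OF n])
  obtain \<tau> where "bij_betw \<tau> (up_index n) (down_index n) \<and>
    (\<forall>i\<in>up_index n. (\<lambda>x. t + x) ` X i \<times> (\<lambda>x. t - x) ` X (\<tau> i) \<subseteq> past t) \<and>
    (\<forall>Q. good Q \<longrightarrow> (step_map (rsk_lines Q t) \<in> {n} \<times> PiE ?I X \<longleftrightarrow>
      (\<forall>i\<in>up_index n. card (Q \<inter> (\<lambda>x. t + x) ` X i \<times> (\<lambda>x. t - x) ` X (\<tau> i)) = 1) \<and>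
      Q \<inter> past t \<subseteq> (\<Union>i\<in>up_index n. (\<lambda>x. t + x) ` X i \<times> (\<lambda>x. t - x) ` X (\<tau> i)))) \<and>
    {n} \<times> PiE ?I X \<subseteq> Gamma t"
    using box_event[OF sep y] ..
  note \<tau> = this[THEN conjunct1] this[THEN conjunct2, THEN conjunct1, rule_format]
    this[THEN conjunct2, THEN conjunct2, THEN conjunct1, rule_format] this[THEN conjunct2, THEN conjunct2, THEN conjunct2]
  define R where "R i = (\<lambda>x. t + x) ` X i \<times> (\<lambda>x. t - x) ` X (\<tau> i)" for i
  have up: "i \<in> ?I" if "i \<in> up_index n" for i using that unfolding step_index_split by blast
  have down: "\<tau> i \<in> ?I" if "i \<in> up_index n" for i
    using that bij_betw_apply[OF \<tau>(1)] unfolding step_index_split by blast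
  have XT: "X i \<subseteq> {-t<..<t}" if "i \<in> ?I" for i using sep that unfolding separated_def by blast
  have event: "cfg_event M N t n (PiE ?I X) = {\<omega>\<in>space M. (\<forall>i\<in>up_index n. card (N \<omega> \<inter> R i) = 1) \<and> N \<omega> \<inter> past t \<subseteq> (\<Union>i\<in>up_index n. R i)}"
    by (rule set_eqI) (use \<tau>(3)[OF good_N] in \<open>simp add: cfg_event_def R_def cong: conj_cong\<close>)
  have disj: "disjoint_family_on R (up_index n)"
    unfolding disjoint_family_on_def
  proof (intro ballI impI)
    fix i j assume ij: "i \<in> up_index n" "j \<in> up_index n" "i \<noteq> j"
    have "(\<forall>x\<in>X i. \<forall>y\<in>X j. x < y) \<or> (\<forall>x\<in>X i. \<forall>y\<in>X j. y < x)"
      using sep up[OF ij(1)] up[OF ij(2)] ij(3) unfolding separated_def by blast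
    then have "X i \<inter> X j = {}" by (metis disjoint_iff less_irrefl)
    then show "R i \<inter> R j = {}" unfolding R_def by auto
  qed
  have meas: "R i \<in> sets borel \<and> R i \<subseteq> past_cone t" if i: "i \<in> up_index n" for i
  proof
    have "(\<lambda>x. t + x) ` X i \<in> sets borel" "(\<lambda>x. t - x) ` X (\<tau> i) \<in> sets borel"
      using shift_borel(1) reflect_borel(1) X up[OF i] down[OF i] by blast+
    then show "R i \<in> sets borel" unfolding R_def by (subst borel_prod[symmetric]) (rule pair_measureI)
    have "0 < t + x \<and> 0 < t - x'" if "x \<in> X i" "x' \<in> X (\<tau> i)" for x x'
      using XT[OF up[OF i]] XT[OF down[OF i]] that by force
    then show "R i \<subseteq> past_cone t" using \<tau>(2)[OF i] unfolding past_cone_def R_def by auto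
  qed
  have emR: "emeasure lborel (R i) = emeasure lborel (X i) * emeasure lborel (X (\<tau> i))" if i: "i \<in> up_index n" for i
  proof -
    have "emeasure lborel (R i) = emeasure lborel ((\<lambda>x. t + x) ` X i) * emeasure lborel ((\<lambda>x. t - x) ` X (\<tau> i))"
      unfolding R_def lborel_prod[symmetric]
      using shift_borel(1)[OF X[OF up[OF i]]] reflect_borel(1)[OF X[OF down[OF i]]]
      by (intro lborel.emeasure_pair_measure_Times) auto
    then show ?thesis using shift_borel(2)[OF X[OF up[OF i]]] reflect_borel(2)[OF X[OF down[OF i]]] by simp
  qed
  have finu: "finite (up_index n)" "finite (down_index n)" using fin unfolding step_index_split by auto
  have "(\<Prod>i\<in>up_index n. emeasure lborel (R i)) =
      (\<Prod>i\<in>up_index n. emeasure lborel (X i)) * (\<Prod>i\<in>up_index n. emeasure lborel (X (\<tau> i)))"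
    using emR by (simp add: prod.distrib)
  also have "(\<Prod>i\<in>up_index n. emeasure lborel (X (\<tau> i))) = (\<Prod>i\<in>down_index n. emeasure lborel (X i))"
    by (rule prod.reindex_bij_betw[OF \<tau>(1)])
  also have "(\<Prod>i\<in>up_index n. emeasure lborel (X i)) * (\<Prod>i\<in>down_index n. emeasure lborel (X i)) =
      (\<Prod>i\<in>?I. emeasure lborel (X i))"
    unfolding step_index_split(1) using finu step_index_split(2) by (intro prod.union_disjoint[symmetric]) auto
  also have "\<dots> = emeasure (step_lebesgue n) (PiE ?I X)" using emeasure_step_box[OF fin X] by simp
  also have "PiE ?I X = PiE ?I X \<inter> slice n (Gamma t)" using \<tau>(4) unfolding slice_def by auto
  finally have prod: "(\<Prod>i\<in>up_index n. emeasure lborel (R i)) = emeasure (step_lebesgue n) (PiE ?I X \<inter> slice n (Gamma t))" .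
  show ?thesis unfolding good_event_def event prod[symmetric]
    using law finu(1) disj meas unfolding matching_law_def by blast
qed

lemma good_event_Union:
  fixes A :: "nat \<Rightarrow> (step_index \<Rightarrow> real) set"
  assumes "disjoint_family A" "\<And>i. good_event M N t c n (A i)" "\<And>i. A i \<in> sets (step_lebesgue n)"
  shows "good_event M N t c n (\<Union>i. A i)"
proof -
  let ?G = "slice n (Gamma t)" and ?c = "c (card (up_index n))"
  have ev: "cfg_event M N t n (\<Union>i. A i) = (\<Union>i. cfg_event M N t n (A i))" by (auto simp: cfg_event_iff)
  have sets: "range (\<lambda>i. cfg_event M N t n (A i)) \<subseteq> sets M" using assms(2) unfolding good_event_def by blast
  have disj: "disjoint_family (\<lambda>i. cfg_event M N t n (A i))"
    unfolding disjoint_family_on_def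
  proof (intro ballI impI)
    fix i j :: nat assume "i \<noteq> j"
    then have "A i \<inter> A j = {}" using assms(1) unfolding disjoint_family_on_def by blast
    then show "cfg_event M N t n (A i) \<inter> cfg_event M N t n (A j) = {}" by (auto simp: cfg_event_iff)
  qed
  have disj': "disjoint_family (\<lambda>i. A i \<inter> ?G)" using assms(1) unfolding disjoint_family_on_def by blast
  have sets': "range (\<lambda>i. A i \<inter> ?G) \<subseteq> sets (step_lebesgue n)" using assms(3) slice_Gamma_sets[OF n] by auto
  have "emeasure M (cfg_event M N t n (\<Union>i. A i)) = (\<Sum>i. emeasure M (cfg_event M N t n (A i)))"
    unfolding ev by (rule suminf_emeasure[OF sets disj, symmetric])
  also have "\<dots> = (\<Sum>i. ?c * emeasure (step_lebesgue n) (A i \<inter> ?G))"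
    using assms(2) unfolding good_event_def by simp
  also have "\<dots> = ?c * (\<Sum>i. emeasure (step_lebesgue n) (A i \<inter> ?G))" by (rule ennreal_suminf_cmult)
  also have "(\<Sum>i. emeasure (step_lebesgue n) (A i \<inter> ?G)) = emeasure (step_lebesgue n) (\<Union>i. A i \<inter> ?G)"
    by (rule suminf_emeasure[OF sets' disj'])
  also have "(\<Union>i. A i \<inter> ?G) = (\<Union>i. A i) \<inter> ?G" by blast
  finally show ?thesis unfolding good_event_def ev using sets by blast
qed

text \<open>Dynkin's argument inside one box: product subsets of it are again separated, and its
  finite measure permits complements.\<close>

lemma good_event_subset_box:
  assumes sep: "separated t (step_index n) (\<lambda>i. {a i<..<b i})" and A: "A \<in> sets (step_lebesgue n)"
  shows "good_event M N t c n (A \<inter> PiE (step_index n) (\<lambda>i. {a i<..<b i}))"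
proof -
  let ?I = "step_index n" and ?G = "slice n (Gamma t)" and ?c = "c (card (up_index n))"
  define B where "B = PiE ?I (\<lambda>i. {a i<..<b i})"
  have fin: "finite ?I" by (rule finite_step_index[OF n])
  have setsB: "B \<in> sets (step_lebesgue n)" unfolding B_def step_lebesgue_def
    by (rule sets_PiM_I_finite[OF fin]) simp
  have setsG: "?G \<in> sets (step_lebesgue n)" by (rule slice_Gamma_sets[OF n])
  have goodB: "good_event M N t c n B" unfolding B_def by (rule good_event_box[OF _ sep]) simp
  have finB: "emeasure (step_lebesgue n) B \<noteq> \<infinity>"
  proof -
    have "emeasure (step_lebesgue n) B = (\<Prod>i\<in>?I. emeasure lborel {a i<..<b i})"
      unfolding B_def by (rule emeasure_step_box[OF fin]) simp
    also have "\<dots> \<noteq> \<infinity>"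
    proof -
      have "emeasure lborel {a i<..<b i} \<noteq> \<infinity>" for i by (cases "a i \<le> b i") simp_all
      then show ?thesis by (simp add: ennreal_prod_eq_top)
    qed
    finally show ?thesis .
  qed
  have closed: "prod_algebra ?I (\<lambda>_. lborel :: real measure) \<subseteq> Pow (PiE ?I (\<lambda>_. UNIV))"
    using prod_algebra_sets_into_space[of ?I "\<lambda>_. lborel :: real measure"] by simp
  have "A \<in> sigma_sets (PiE ?I (\<lambda>_. UNIV)) (prod_algebra ?I (\<lambda>_. lborel :: real measure))"
    using A unfolding step_lebesgue_def by (simp add: sets_PiM)
  with Int_stable_prod_algebra closed have "good_event M N t c n (A \<inter> B)"
  proof (induction rule: sigma_sets_induct_disjoint)
    case (basic A)
    then obtain X where X: "A = PiE ?I X" "\<And>i. i \<in> ?I \<Longrightarrow> X i \<in> sets borel"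
      unfolding prod_algebra_eq_finite[OF fin] by (auto simp: Pi_iff)
    have "A \<inter> B = PiE ?I (\<lambda>i. X i \<inter> {a i<..<b i})" unfolding X(1) B_def by (rule PiE_Int)
    moreover have "separated t ?I (\<lambda>i. X i \<inter> {a i<..<b i})" using sep unfolding separated_def by blast
    ultimately show ?case using X(2) by (auto intro!: good_event_box)
  next
    case empty
    then show ?case unfolding good_event_def cfg_event_def by simp
  next
    case (compl A)
    have setsA: "A \<in> sets (step_lebesgue n)"
      using compl(1) unfolding step_lebesgue_def by (simp add: sets_PiM)
    define A' where "A' = (PiE ?I (\<lambda>_. UNIV) - A) \<inter> B"
    have A'B: "A' = B - A \<inter> B" unfolding A'_def B_def by auto
    have ev: "cfg_event M N t n A' = cfg_event M N t n B - cfg_event M N t n (A \<inter> B)" unfolding A'B by (auto simp: cfg_event_iff)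
    have evs: "cfg_event M N t n B \<in> sets M" "cfg_event M N t n (A \<inter> B) \<in> sets M" using goodB compl(2) unfolding good_event_def by auto
    then have ev': "cfg_event M N t n A' \<in> sets M" unfolding ev by auto
    have "emeasure M (cfg_event M N t n (A \<inter> B)) + emeasure M (cfg_event M N t n A') = emeasure M (cfg_event M N t n B)"
      using evs ev' unfolding ev by (subst plus_emeasure) (auto intro!: arg_cong[of _ _ "emeasure M"] simp: cfg_event_def)
    also have "\<dots> = ?c * emeasure (step_lebesgue n) (B \<inter> ?G)" using goodB unfolding good_event_def by simp
    also have "emeasure (step_lebesgue n) (B \<inter> ?G) =
        emeasure (step_lebesgue n) (A \<inter> B \<inter> ?G) + emeasure (step_lebesgue n) (A' \<inter> ?G)"
      unfolding A'B using setsA setsB setsG by (subst plus_emeasure) (auto intro!: arg_cong[of _ _ "emeasure (step_lebesgue n)"])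
    also have "?c * \<dots> = ?c * emeasure (step_lebesgue n) (A \<inter> B \<inter> ?G) + ?c * emeasure (step_lebesgue n) (A' \<inter> ?G)"
      by (rule distrib_left)
    also have "?c * emeasure (step_lebesgue n) (A \<inter> B \<inter> ?G) = emeasure M (cfg_event M N t n (A \<inter> B))"
      using compl(2) unfolding good_event_def by simp
    finally have sum: "emeasure M (cfg_event M N t n (A \<inter> B)) + emeasure M (cfg_event M N t n A') =
        emeasure M (cfg_event M N t n (A \<inter> B)) + ?c * emeasure (step_lebesgue n) (A' \<inter> ?G)" .
    \<comment> \<open>Finiteness allows the common summand in \<open>sum\<close> to be
      cancelled.\<close>
    have "emeasure M (cfg_event M N t n (A \<inter> B)) \<noteq> \<infinity>"
    proof -
      have "emeasure (step_lebesgue n) (A \<inter> B \<inter> ?G) \<le> emeasure (step_lebesgue n) B"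
        using setsB by (intro emeasure_mono) auto
      then have "emeasure (step_lebesgue n) (A \<inter> B \<inter> ?G) \<noteq> \<infinity>" using finB by (auto simp: top_unique)
      then show ?thesis using compl(2) c unfolding good_event_def by (simp add: ennreal_mult_eq_top_iff)
    qed
    then show ?case using sum ev' unfolding good_event_def A'_def by (simp add: ennreal_add_left_cancel)
  next
    case (union A)
    have "A i \<in> sets (step_lebesgue n)" for i using union(2) unfolding step_lebesgue_def by (auto simp: sets_PiM)
    then have "A i \<inter> B \<in> sets (step_lebesgue n)" for i using setsB by blast
    moreover have "disjoint_family (\<lambda>i. A i \<inter> B)" using union(1) unfolding disjoint_family_on_def by blast
    ultimately have "good_event M N t c n (\<Union>i. A i \<inter> B)" using union(3) by (intro good_event_Union) auto
    also have "(\<Union>i. A i \<inter> B) = (\<Union>i. A i) \<inter> B" by blast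
    finally show ?case .
  qed
  then show ?thesis unfolding B_def .
qed

text \<open>The boxes overlap, so their disjointed versions are used, each of which lies in one
  box.\<close>

lemma good_event_cover:
  assumes A: "A \<in> sets (step_lebesgue n)"
  shows "good_event M N t c n (A \<inter> \<Union>(rational_boxes t n))"
proof (cases "rational_boxes t n = {}")
  case True
  then show ?thesis unfolding good_event_def cfg_event_def by simp
next
  case False
  define B where "B = from_nat_into (rational_boxes t n)"
  have B: "B i \<in> rational_boxes t n" for i unfolding B_def by (rule from_nat_into[OF False])
  have UB: "\<Union>(rational_boxes t n) = (\<Union>i. B i)"
    unfolding B_def using range_from_nat_into[OF False countable_rational_boxes[OF n]] by simp
  have setsB: "B i \<in> sets (step_lebesgue n)" for i
    using B[of i] unfolding rational_boxes_def step_lebesgue_def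
    by (auto intro!: sets_PiM_I_finite[OF finite_step_index[OF n]])
  have disjd: "disjointed B i \<subseteq> B i" for i by (rule disjointed_subset)
  have setsD: "disjointed B i \<in> sets (step_lebesgue n)" for i
    using sets.range_disjointed_sets[of B "step_lebesgue n"] setsB by blast
  have "good_event M N t c n (\<Union>i. A \<inter> disjointed B i)"
  proof (rule good_event_Union)
    show "disjoint_family (\<lambda>i. A \<inter> disjointed B i)"
      using disjoint_family_disjointed[of B] unfolding disjoint_family_on_def by blast
    fix i
    show sets: "A \<inter> disjointed B i \<in> sets (step_lebesgue n)" using A setsD by blast
    obtain a b where ab: "B i = PiE (step_index n) (\<lambda>i. {a i<..<b i})" "separated t (step_index n) (\<lambda>i. {a i<..<b i})"
      using B[of i] unfolding rational_boxes_def by auto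
    have "good_event M N t c n ((A \<inter> disjointed B i) \<inter> B i)" unfolding ab(1) by (rule good_event_subset_box[OF ab(2) sets])
    moreover have "(A \<inter> disjointed B i) \<inter> B i = A \<inter> disjointed B i" using disjd by blast
    ultimately show "good_event M N t c n (A \<inter> disjointed B i)" by simp
  qed
  also have "(\<Union>i. A \<inter> disjointed B i) = A \<inter> \<Union>(rational_boxes t n)" unfolding UB using UN_disjointed_eq[of B] by blast
  finally show ?thesis .
qed

end

section \<open>Negligible configurations\<close>

text \<open>Fubini with the coordinate \<open>j\<close> innermost: for given \<open>x i\<close>,
  equality confines \<open>x j\<close> to a null set.\<close>

lemma (in product_sigma_finite) AE_PiM_neq:
  fixes f g :: "'a \<Rightarrow> real"
  assumes fin: "finite I" and ij: "i \<in> I" "j \<in> I" "i \<noteq> j"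
    and f: "f \<in> borel_measurable (M i)" and g: "g \<in> borel_measurable (M j)"
    and null: "\<And>a. emeasure (M j) {z\<in>space (M j). g z = a} = 0"
  shows "AE x in PiM I M. f (x i) \<noteq> g (x j)"
proof -
  have comp: "(\<lambda>x. f (x i)) \<in> borel_measurable (PiM I M)" "(\<lambda>x. g (x j)) \<in> borel_measurable (PiM I M)"
    using measurable_compose[OF measurable_component_singleton[OF ij(1), of M] f]
      measurable_compose[OF measurable_component_singleton[OF ij(2), of M] g] .
  let ?S = "{x\<in>space (PiM I M). f (x i) = g (x j)}"
  have S: "?S \<in> sets (PiM I M)" using comp by (rule borel_measurable_eq)
  define J where "J = I - {j}"
  have J: "insert j J = I" "j \<notin> J" "finite J" "i \<in> J" using ij fin unfolding J_def by auto
  have "emeasure (PiM I M) ?S = (\<integral>\<^sup>+x. indicator ?S x \<partial>PiM (insert j J) M)"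
    unfolding J(1) using S by simp
  also have "\<dots> = (\<integral>\<^sup>+x. (\<integral>\<^sup>+z. indicator ?S (x(j := z)) \<partial>M j) \<partial>PiM J M)"
    by (rule product_nn_integral_insert[OF J(3,2)]) (use S J(1) in simp)
  also have "\<dots> = (\<integral>\<^sup>+x. 0 \<partial>PiM J M)"
  proof (rule nn_integral_cong)
    fix x assume x: "x \<in> space (PiM J M)"
    have gs: "{z\<in>space (M j). g z = f (x i)} \<in> sets (M j)"
      using g by (intro borel_measurable_eq) auto
    have "(\<integral>\<^sup>+z. indicator ?S (x(j := z)) \<partial>M j) = (\<integral>\<^sup>+z. indicator {z\<in>space (M j). g z = f (x i)} z \<partial>M j)"
    proof (rule nn_integral_cong)
      fix z assume z: "z \<in> space (M j)"
      have "x(j := z) \<in> space (PiM I M)"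
        using x z unfolding J(1)[symmetric] space_PiM by (auto simp: PiE_iff extensional_def)
      then show "indicator ?S (x(j := z)) = (indicator {z\<in>space (M j). g z = f (x i)} z :: ennreal)"
        using z ij(3) by (simp add: indicator_def)
    qed
    also have "\<dots> = 0" using null gs by simp
    finally show "(\<integral>\<^sup>+z. indicator ?S (x(j := z)) \<partial>M j) = 0" .
  qed
  finally have "emeasure (PiM I M) ?S = 0" by simp
  then show ?thesis using S by (subst AE_iff_measurable[OF S]) auto
qed

lemma AE_inj_on_step_lebesgue:
  assumes n: "finite {k. n k \<noteq> 0}"
  shows "AE y in step_lebesgue n. inj_on y (step_index n)"
proof -
  let ?I = "step_index n"
  interpret step_product: product_sigma_finite "\<lambda>_ :: step_index. lborel :: real measure" by standard
  have fin: "finite ?I" by (rule finite_step_index[OF n])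
  have "AE y in step_lebesgue n. y i \<noteq> y j" if "i \<in> ?I" "j \<in> ?I" "i \<noteq> j" for i j
    unfolding step_lebesgue_def
  proof (rule step_product.AE_PiM_neq[OF fin that, of "\<lambda>x. x" "\<lambda>x. x"])
    fix a :: real
    have "{z \<in> space lborel. z = a} = {a}" by auto
    then show "emeasure lborel {z \<in> space lborel. z = a} = 0" by simp
  qed simp_all
  then have "AE y in step_lebesgue n. i \<noteq> j \<longrightarrow> y i \<noteq> y j" if "i \<in> ?I" "j \<in> ?I" for i j
    using that by (cases "i = j") auto
  then have "AE y in step_lebesgue n. \<forall>i\<in>?I. \<forall>j\<in>?I. i \<noteq> j \<longrightarrow> y i \<noteq> y j"
    using fin by (intro AE_finite_allI)
  then show ?thesis by eventually_elim (auto simp: inj_on_def)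
qed

text \<open>Almost every \<open>y\<close> has distinct positions and is therefore covered by the
  boxes as soon as it lies in the slice.\<close>

lemma emeasure_rational_boxes:
  assumes n: "finite {k. n k \<noteq> 0}" and A: "A \<in> sets (step_lebesgue n)"
  shows "emeasure (step_lebesgue n) (A \<inter> \<Union>(rational_boxes t n) \<inter> slice n (Gamma t)) =
    emeasure (step_lebesgue n) (A \<inter> slice n (Gamma t))"
proof (rule emeasure_eq_AE)
  show "AE y in step_lebesgue n. (y \<in> A \<inter> \<Union>(rational_boxes t n) \<inter> slice n (Gamma t)) = (y \<in> A \<inter> slice n (Gamma t))"
    using AE_inj_on_step_lebesgue[OF n] 
  proof eventually_elim
    fix y :: "step_index \<Rightarrow> real" assume "inj_on y (step_index n)"
    then show "(y \<in> A \<inter> \<Union>(rational_boxes t n) \<inter> slice n (Gamma t)) = (y \<in> A \<inter> slice n (Gamma t))"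
      using rational_boxes_cover[OF n] by blast
  qed
  have "B \<in> sets (step_lebesgue n)" if "B \<in> rational_boxes t n" for B
    using that unfolding rational_boxes_def step_lebesgue_def
    by (auto intro!: sets_PiM_I_finite[OF finite_step_index[OF n]])
  then have "\<Union>(rational_boxes t n) \<in> sets (step_lebesgue n)"
    using countable_rational_boxes[OF n] by (intro sets.countable_Union) auto
  then show "A \<inter> \<Union>(rational_boxes t n) \<inter> slice n (Gamma t) \<in> sets (step_lebesgue n)"
    using A slice_Gamma_sets[OF n] by blast
  show "A \<inter> slice n (Gamma t) \<in> sets (step_lebesgue n)" using A slice_Gamma_sets[OF n] by blast
qed

text \<open>Laws are computed on configurations inside some box, where events are conditions on
  counts; the others are shown to be negligible.\<close>

definition regular :: "real \<Rightarrow> step_config set" where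
  "regular t = {(n, y). n \<in> step_numbers \<and> y \<in> \<Union>(rational_boxes t n)}"

lemma law_total:
  assumes law: "matching_law M N t c" and c: "\<And>m. c m \<noteq> \<infinity>" and A: "A \<in> w_sets t"
  defines "E \<equiv> {\<omega>\<in>space M. step_map (rsk_lines (N \<omega>) t) \<in> A \<inter> regular t}"
  shows "E \<in> sets M"
    and "emeasure M E = (\<integral>\<^sup>+n. c (card (up_index n)) * emeasure (step_lebesgue n) (slice n A) \<partial>count_space step_numbers)"
proof -
  define F where "F n = cfg_event M N t n (slice n A \<inter> \<Union>(rational_boxes t n))" for n
  have EF: "E = (\<Union>n\<in>step_numbers. F n)"
    unfolding E_def F_def by (auto simp: cfg_event_iff regular_def slice_def case_prod_unfold)
  have good: "good_event M N t c n (slice n A \<inter> \<Union>(rational_boxes t n))" and sA: "slice n A \<in> sets (step_lebesgue n)"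
    if "n \<in> step_numbers" for n
  proof -
    have n: "finite {k. n k \<noteq> 0}" using that unfolding step_numbers_def by simp
    show "slice n A \<in> sets (step_lebesgue n)" using A n unfolding w_sets_def by blast
    then show "good_event M N t c n (slice n A \<inter> \<Union>(rational_boxes t n))"
      by (rule good_event_cover[OF law n c])
  qed
  have sets: "F n \<in> sets M" if "n \<in> step_numbers" for n
    using good[OF that] unfolding good_event_def F_def by blast
  then show "E \<in> sets M" unfolding EF by (rule sets.countable_UN''[OF countable_step_numbers])
  have disj: "disjoint_family_on F step_numbers"
    unfolding disjoint_family_on_def F_def by (auto simp: cfg_event_iff)
  have "emeasure M E = (\<integral>\<^sup>+n. emeasure M (F n) \<partial>count_space step_numbers)"
    unfolding EF by (rule emeasure_UN_countable[OF sets countable_step_numbers disj])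
  also have "\<dots> = (\<integral>\<^sup>+n. c (card (up_index n)) * emeasure (step_lebesgue n) (slice n A) \<partial>count_space step_numbers)"
  proof (rule nn_integral_cong)
    fix n assume "n \<in> space (count_space step_numbers)"
    then have n: "n \<in> step_numbers" by simp
    have fin: "finite {k. n k \<noteq> 0}" using n unfolding step_numbers_def by simp
    have "slice n A \<inter> slice n (Gamma t) = slice n A" using A unfolding w_sets_def slice_def by blast
    then show "emeasure M (F n) = c (card (up_index n)) * emeasure (step_lebesgue n) (slice n A)"
      using good[OF n] emeasure_rational_boxes[OF fin sA[OF n], of t] unfolding good_event_def F_def by simp
  qed
  finally show "emeasure M E = (\<integral>\<^sup>+n. c (card (up_index n)) * emeasure (step_lebesgue n) (slice n A) \<partial>count_space step_numbers)" .
qed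

text \<open>The hypothesis forbids an up-step and a down-step at one position at time
  \<open>t\<close> and, for \<open>p = q\<close>, a nucleation exactly at that time. Steps of one
  kind are distinct because a ray carries a single label.\<close>

lemma configuration_regular:
  assumes good: "good Q" and neq: "\<And>p q. p \<in> Q \<inter> past t \<Longrightarrow> q \<in> Q \<inter> past t \<Longrightarrow> fst p + snd q \<noteq> 2 * t"
  shows "step_map (rsk_lines Q t) \<in> regular t"
proof -
  obtain n y where eq: "step_map (rsk_lines Q t) = (n, y)" by (metis surj_pair)
  have L: "rsk_lines Q t \<in> Lambda t" by (rule rsk_lines_Lambda[OF good])
  have Gam: "(n, y) \<in> Gamma t" using imageI[OF L, of step_map] unfolding eq Gamma_def .
  have conf: "configuration t n y" and n: "finite {k. n k \<noteq> 0}" using Gam unfolding Gamma_iff by auto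
  note lab = labels_of_step_map[OF good eq]
  have same: "i = i'" if "i = (k, s, j)" "i' = (k, s, j')" "j < n k" "j' < n k" "y i = y i'" for i i' k s j j'
    using that inj_onD[OF configuration_inj(1)[OF conf, of k s], of j j'] by simp
  have up: "i = i'" if i: "i \<in> up_index n" "i' \<in> up_index n" "y i = y i'" for i i'
  proof -
    obtain k j k' j' where ij: "i = (k, Up, j)" "j < n k" "i' = (k', Up, j')" "j' < n k'"
      using i unfolding up_index_def by auto
    then have "y i \<in> positions n y k Up" "y i' \<in> positions n y k' Up" unfolding positions_def by auto
    then have "y i \<in> positions n y k Up" "y i \<in> positions n y k' Up" using i(3) by simp_all
    then have "k = k'" unfolding lab(1)[symmetric] by simp
    then show ?thesis using same ij i(3) by blast
  qed
  have down: "i = i'" if i: "i \<in> down_index n" "i' \<in> down_index n" "y i = y i'" for i i'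
  proof -
    obtain k j k' j' where ij: "i = (k, Down, j)" "j < n k" "i' = (k', Down, j')" "j' < n k'"
      using i unfolding down_index_def by auto
    then have "y i \<in> positions n y k Down" "y i' \<in> positions n y k' Down" unfolding positions_def by auto
    then have "y i \<in> positions n y k Down" "y i \<in> positions n y k' Down" using i(3) by simp_all
    then have "k = k'" unfolding lab(2)[symmetric] by simp
    then show ?thesis using same ij i(3) by blast
  qed
  have ud: "y i \<noteq> y i'" if i: "i \<in> up_index n" "i' \<in> down_index n" for i i'
  proof -
    have "t + y i \<in> fst ` (Q \<inter> past t)" "t - y i' \<in> snd ` (Q \<inter> past t)" unfolding lab(3,4) using i by auto
    then obtain p q where "p \<in> Q \<inter> past t" "t + y i = fst p" "q \<in> Q \<inter> past t" "t - y i' = snd q" by blast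
    then show ?thesis using neq[of p q] by auto
  qed
  have "inj_on y (step_index n)"
  proof (rule inj_onI)
    fix i i' assume "i \<in> step_index n" "i' \<in> step_index n" "y i = y i'"
    then show "i = i'" unfolding step_index_split using up down ud by (metis Un_iff)
  qed
  then have "y \<in> \<Union>(rational_boxes t n)" using Gam by (intro rational_boxes_cover[OF n]) (auto simp: slice_def)
  then show ?thesis unfolding eq regular_def step_numbers_def using n by simp
qed

lemma cone_sets: "past_cone t \<in> sets borel"
proof -
  have "past_cone t = {p. fst p + snd p \<le> 2 * t} \<inter> ({p. 0 < fst p} \<inter> {p. 0 < snd p})"
    unfolding past_cone_def past_def by auto
  also have "\<dots> \<in> sets borel"
    by (intro sets.Int borel_closed closed_Collect_le borel_open open_Collect_less continuous_intros)
  finally show ?thesis .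
qed

lemma emeasure_cone:
  assumes "t \<ge> 0"
  shows "emeasure lborel (past_cone t) = ennreal (2 * t ^ 2)"
proof -
  have "emeasure lborel (past_cone t) = (\<integral>\<^sup>+u. emeasure lborel (Pair u -` past_cone t) \<partial>lborel)"
  proof -
    have "past_cone t \<in> sets (lborel \<Otimes>\<^sub>M lborel)" unfolding lborel_prod using cone_sets by simp
    then show ?thesis unfolding lborel_prod[symmetric] by (rule lborel.emeasure_pair_measure_alt)
  qed
  also have "\<dots> = (\<integral>\<^sup>+u. ennreal (2 * t - u) * indicator {0..2 * t} u \<partial>lborel)"
  proof (rule nn_integral_cong_AE)
    have "AE u in lborel. u \<noteq> (0::real)" by (rule AE_lborel_singleton)
    then show "AE u in lborel. emeasure lborel (Pair u -` past_cone t) = ennreal (2 * t - u) * indicator {0..2 * t} u"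
    proof eventually_elim
      fix u :: real assume "u \<noteq> 0"
      show "emeasure lborel (Pair u -` past_cone t) = ennreal (2 * t - u) * indicator {0..2 * t} u"
      proof (cases "0 < u \<and> u \<le> 2 * t")
        case True
        then have "Pair u -` past_cone t = {0<..2 * t - u}" unfolding past_cone_def past_def by auto
        then show ?thesis using True by simp
      next
        case False
        then have "Pair u -` past_cone t = {}" unfolding past_cone_def past_def by auto
        then show ?thesis using False \<open>u \<noteq> 0\<close> by (auto simp: indicator_def)
      qed
    qed
  qed
  also have "\<dots> = ennreal ((2 * t * (2 * t) - (2 * t)^2 / 2) - (2 * t * 0 - 0^2 / 2))"
    by (rule nn_integral_FTC_Icc) (use assms in \<open>auto intro!: derivative_eq_intros\<close>)
  also have "\<dots> = ennreal (2 * t ^ 2)" by (simp add: power2_eq_square)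
  finally show ?thesis .
qed

section \<open>Independent uniform points\<close>

definition cone_measure :: "real \<Rightarrow> (real \<times> real) measure" where
  "cone_measure t = restrict_space lborel (past_cone t)"

lemma cone_measure:
  "space (cone_measure t) = past_cone t"
  "A \<in> sets (cone_measure t) \<longleftrightarrow> A \<subseteq> past_cone t \<and> A \<in> sets borel"
  "A \<subseteq> past_cone t \<Longrightarrow> emeasure (cone_measure t) A = emeasure lborel A"
  unfolding cone_measure_def using cone_sets[of t]
  by (auto simp: space_restrict_space sets_restrict_space_iff emeasure_restrict_space)

lemma product_sigma_finite_cone:
  assumes "t \<ge> 0"
  shows "product_sigma_finite (\<lambda>_ :: nat. cone_measure t)"
proof -
  have "finite_measure (cone_measure t)"
    by (rule finite_measureI) (simp add: cone_measure emeasure_cone[OF assms])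
  then show ?thesis by (intro product_sigma_finite.intro finite_measure.axioms(1))
qed

lemma sections_null:
  "emeasure (cone_measure t) {z\<in>space (cone_measure t). fst z = a} = 0"
  "emeasure (cone_measure t) {z\<in>space (cone_measure t). snd z = a} = 0"
  "emeasure (cone_measure t) {z\<in>space (cone_measure t). 2 * t - snd z = a} = 0"
proof -
  have fst: "emeasure lborel {z\<in>past_cone t. fst z = a} = 0" for a
  proof -
    have "emeasure lborel ({a} \<times> (UNIV :: real set)) = emeasure lborel {a} * emeasure lborel (UNIV :: real set)"
      unfolding lborel_prod[symmetric] by (rule lborel.emeasure_pair_measure_Times) auto
    then have "emeasure lborel ({a} \<times> (UNIV :: real set)) = 0" by simp
    moreover have "{a} \<times> (UNIV :: real set) \<in> sets lborel" by (auto intro!: borel_closed closed_Times)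
    moreover have "{z\<in>past_cone t. fst z = a} \<subseteq> {a} \<times> UNIV" by (auto simp: mem_Times_iff)
    ultimately show ?thesis using emeasure_mono[of "{z\<in>past_cone t. fst z = a}" "{a} \<times> UNIV" "lborel :: (real \<times> real) measure"] by simp
  qed
  have snd: "emeasure lborel {z\<in>past_cone t. snd z = a} = 0" for a
  proof -
    have "emeasure lborel ((UNIV :: real set) \<times> {a}) = emeasure lborel (UNIV :: real set) * emeasure lborel {a}"
      unfolding lborel_prod[symmetric] by (rule lborel.emeasure_pair_measure_Times) auto
    then have "emeasure lborel ((UNIV :: real set) \<times> {a}) = 0" by simp
    moreover have "(UNIV :: real set) \<times> {a} \<in> sets lborel" by (auto intro!: borel_closed closed_Times)
    moreover have "{z\<in>past_cone t. snd z = a} \<subseteq> UNIV \<times> {a}" by (auto simp: mem_Times_iff)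
    ultimately show ?thesis using emeasure_mono[of "{z\<in>past_cone t. snd z = a}" "UNIV \<times> {a}" "lborel :: (real \<times> real) measure"] by simp
  qed
  show "emeasure (cone_measure t) {z\<in>space (cone_measure t). fst z = a} = 0"
    "emeasure (cone_measure t) {z\<in>space (cone_measure t). snd z = a} = 0"
    unfolding cone_measure(1) using fst snd by (subst cone_measure(3); auto)+
  have "{z\<in>past_cone t. 2 * t - snd z = a} = {z\<in>past_cone t. snd z = 2 * t - a}" by auto
  then show "emeasure (cone_measure t) {z\<in>space (cone_measure t). 2 * t - snd z = a} = 0"
    unfolding cone_measure(1) using snd by (subst cone_measure(3)) auto
qed

lemma hypotenuse_null:
  "emeasure (cone_measure t) {z\<in>space (cone_measure t). fst z + snd z = a} = 0"
    "{z\<in>space (cone_measure t). fst z + snd z = a} \<in> sets (cone_measure t)"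
proof -
  let ?S = "{z :: real \<times> real. fst z + snd z = a}"
  have S: "?S \<in> sets borel" by (intro borel_closed closed_Collect_eq continuous_intros)
  have "?S \<in> sets (lborel \<Otimes>\<^sub>M lborel)" unfolding lborel_prod using S by simp
  then have "emeasure (lborel \<Otimes>\<^sub>M lborel) ?S = (\<integral>\<^sup>+u. emeasure lborel (Pair u -` ?S) \<partial>lborel)"
    by (rule lborel.emeasure_pair_measure_alt)
  also have "\<dots> = (\<integral>\<^sup>+(u::real). 0 \<partial>lborel)"
  proof (rule nn_integral_cong)
    fix u :: real
    have "Pair u -` ?S = {a - u}" by auto
    then show "emeasure lborel (Pair u -` ?S) = 0" by simp
  qed
  finally have "emeasure lborel ?S = 0" by (simp add: lborel_prod)
  then have "emeasure lborel (past_cone t \<inter> ?S) = 0"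
    using emeasure_mono[of "past_cone t \<inter> ?S" ?S lborel] S by simp
  moreover have eq: "{z\<in>space (cone_measure t). fst z + snd z = a} = past_cone t \<inter> ?S" unfolding cone_measure(1) by auto
  ultimately show "emeasure (cone_measure t) {z\<in>space (cone_measure t). fst z + snd z = a} = 0"
    unfolding eq by (subst cone_measure(3)) auto
  show "{z\<in>space (cone_measure t). fst z + snd z = a} \<in> sets (cone_measure t)"
    unfolding eq cone_measure(2) using S cone_sets by auto
qed

text \<open>The measure is not normalised: its total mass is \<open>(2 t^2)^m\<close>, which the
  configurations with \<open>m\<close> up-steps share after division by the \<open>m!\<close>
  orderings of the points.\<close>

definition sample :: "real \<Rightarrow> nat \<Rightarrow> (nat \<Rightarrow> real \<times> real) measure" where
  "sample t m = PiM {..<m} (\<lambda>_. cone_measure t)"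

lemma AE_sample:
  assumes t: "t \<ge> 0"
  shows "AE \<omega> in sample t m. inj_on (\<lambda>j. fst (\<omega> j)) {..<m} \<and> inj_on (\<lambda>j. snd (\<omega> j)) {..<m} \<and>
    (\<forall>i\<in>{..<m}. \<forall>j\<in>{..<m}. fst (\<omega> i) + snd (\<omega> j) \<noteq> 2 * t)"
proof -
  interpret product_sigma_finite "\<lambda>_ :: nat. cone_measure t" by (rule product_sigma_finite_cone[OF t])
  have cont: "f \<in> borel_measurable (cone_measure t)" if "continuous_on UNIV f" for f :: "real \<times> real \<Rightarrow> real"
    unfolding cone_measure_def
    by (rule measurable_restrict_space1) (simp add: borel_measurable_continuous_onI[OF that])
  have meas: "fst \<in> borel_measurable (cone_measure t)" "snd \<in> borel_measurable (cone_measure t)"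
    "(\<lambda>z. 2 * t - snd z) \<in> borel_measurable (cone_measure t)"
    by (intro cont continuous_intros)+
  have "AE \<omega> in sample t m. (i \<noteq> j \<longrightarrow> fst (\<omega> i) \<noteq> fst (\<omega> j) \<and> snd (\<omega> i) \<noteq> snd (\<omega> j)) \<and> fst (\<omega> i) + snd (\<omega> j) \<noteq> 2 * t"
    if ij: "i \<in> {..<m}" "j \<in> {..<m}" for i j
  proof (cases "i = j")
    case True
    \<comment> \<open>For \<open>i = j\<close> only the last condition has content: the point avoids
      the hypotenuse of the triangle.\<close>
    let ?Z = "{z\<in>space (cone_measure t). fst z + snd z = 2 * t}"
    let ?B = "PiE {..<m} (\<lambda>k. if k = i then ?Z else space (cone_measure t))"
    have sets: "(if k = i then ?Z else space (cone_measure t)) \<in> sets (cone_measure t)" for k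
      using hypotenuse_null(2)[of t "2 * t"] by auto
    have B: "?B \<in> sets (sample t m)" unfolding sample_def by (rule sets_PiM_I_finite) (use sets in auto)
    have "emeasure (sample t m) ?B = (\<Prod>k<m. emeasure (cone_measure t) (if k = i then ?Z else space (cone_measure t)))"
      unfolding sample_def by (rule emeasure_PiM) (use sets in auto)
    also have "\<dots> = 0"
      by (rule prod_zero) (use ij hypotenuse_null(1)[of t "2 * t"] in auto)
    finally have "emeasure (sample t m) ?B = 0" .
    then have "?B \<in> null_sets (sample t m)" using B by (rule null_setsI)
    then have "AE \<omega> in sample t m. \<omega> \<notin> ?B" by (rule AE_not_in)
    with AE_space show ?thesis
    proof eventually_elim
      fix \<omega> assume \<omega>: "\<omega> \<in> space (sample t m)" "\<omega> \<notin> ?B"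
      then have "\<omega> i \<notin> ?Z" unfolding sample_def space_PiM by (auto simp: PiE_iff split: if_splits)
      moreover have "\<omega> i \<in> space (cone_measure t)" using \<omega>(1) ij unfolding sample_def space_PiM by (auto dest: PiE_mem)
      ultimately show "(i \<noteq> j \<longrightarrow> fst (\<omega> i) \<noteq> fst (\<omega> j) \<and> snd (\<omega> i) \<noteq> snd (\<omega> j)) \<and> fst (\<omega> i) + snd (\<omega> j) \<noteq> 2 * t"
        using True by simp
    qed
  next
    case False
    have "AE \<omega> in sample t m. fst (\<omega> i) \<noteq> fst (\<omega> j)" "AE \<omega> in sample t m. snd (\<omega> i) \<noteq> snd (\<omega> j)"
      "AE \<omega> in sample t m. fst (\<omega> i) \<noteq> 2 * t - snd (\<omega> j)"
      unfolding sample_def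
      by (rule AE_PiM_neq[OF finite_lessThan ij False]; intro meas sections_null)+
    then show ?thesis by eventually_elim auto
  qed
  then have "AE \<omega> in sample t m. \<forall>i\<in>{..<m}. \<forall>j\<in>{..<m}. (i \<noteq> j \<longrightarrow> fst (\<omega> i) \<noteq> fst (\<omega> j) \<and> snd (\<omega> i) \<noteq> snd (\<omega> j)) \<and>
      fst (\<omega> i) + snd (\<omega> j) \<noteq> 2 * t"
    by (intro AE_finite_allI finite_lessThan)
  then show ?thesis by eventually_elim (auto simp: inj_on_def)
qed

lemma disjoint_family_onD_eq:
  "disjoint_family_on R I \<Longrightarrow> i \<in> I \<Longrightarrow> j \<in> I \<Longrightarrow> x \<in> R i \<Longrightarrow> x \<in> R j \<Longrightarrow> i = j"
  unfolding disjoint_family_on_def by blast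

text \<open>The event is the disjoint union, over the \<open>m!\<close> orderings of the points, of
  product sets of equal measure.\<close>

lemma sample_matching:
  fixes I :: "'i set" and m :: nat
  assumes t: "t \<ge> 0" and I: "finite I" "disjoint_family_on R I" "\<And>i. i \<in> I \<Longrightarrow> R i \<in> sets borel \<and> R i \<subseteq> past_cone t"
  defines "E \<equiv> {\<omega>\<in>space (sample t m). \<exists>\<pi>. bij_betw \<pi> {..<m} I \<and> (\<forall>j\<in>{..<m}. \<omega> j \<in> R (\<pi> j))}"
  shows "E \<in> sets (sample t m)"
    and "emeasure (sample t m) E = (if card I = m then fact m else 0) * (\<Prod>i\<in>I. emeasure lborel (R i))"
proof -
  interpret product_sigma_finite "\<lambda>_ :: nat. cone_measure t" by (rule product_sigma_finite_cone[OF t])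
  have "E \<in> sets (sample t m) \<and> emeasure (sample t m) E = (if card I = m then fact m else 0) * (\<Prod>i\<in>I. emeasure lborel (R i))"
  proof (cases "card I = m")
    case False
    have "\<not> bij_betw \<pi> {..<m} I" for \<pi> using False bij_betw_same_card[of \<pi> "{..<m}" I] by auto
    then have "E = {}" unfolding E_def by blast
    then show ?thesis using False by simp
  next
    case True
    then obtain \<pi>0 where \<pi>0: "bij_betw \<pi>0 {..<m} I"
      using finite_same_card_bij[of "{..<m}" I] I(1) by auto
    define F where "F p = PiE {..<m} (\<lambda>j. R (\<pi>0 (p j)))" for p
    let ?S = "{p. p permutes {..<m}}"
    have pI: "\<pi>0 (p j) \<in> I" if "p \<in> ?S" "j \<in> {..<m}" for p j
      using that \<pi>0 by (metis bij_betw_apply mem_Collect_eq permutes_in_image)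
    have bij: "bij_betw (\<lambda>j. \<pi>0 (p j)) {..<m} I" if "p \<in> ?S" for p
      using bij_betw_trans[OF permutes_imp_bij \<pi>0] that by (simp add: comp_def)
    have setsR: "R i \<in> sets (cone_measure t)" if "i \<in> I" for i using I(3)[OF that] unfolding cone_measure(2) by blast
    have setsF: "F p \<in> sets (sample t m)" if "p \<in> ?S" for p
      unfolding F_def sample_def by (rule sets_PiM_I_finite) (use pI[OF that] setsR in auto)
    have EF: "E = (\<Union>p\<in>?S. F p)"
    proof (rule set_eqI)
      fix \<omega>
      show "\<omega> \<in> E \<longleftrightarrow> \<omega> \<in> (\<Union>p\<in>?S. F p)"
      proof
        assume "\<omega> \<in> E"
        then obtain \<pi> where \<omega>: "\<omega> \<in> space (sample t m)" and \<pi>: "bij_betw \<pi> {..<m} I" "\<forall>j\<in>{..<m}. \<omega> j \<in> R (\<pi> j)"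
          unfolding E_def by blast
        define p where "p j = (if j \<in> {..<m} then inv_into {..<m} \<pi>0 (\<pi> j) else j)" for j
        have "bij_betw (inv_into {..<m} \<pi>0 \<circ> \<pi>) {..<m} {..<m}"
          by (rule bij_betw_trans[OF \<pi>(1) bij_betw_inv_into[OF \<pi>0]])
        then have "bij_betw p {..<m} {..<m}"
          by (rule bij_betw_cong[THEN iffD1, rotated]) (simp add: p_def)
        then have "p permutes {..<m}" by (rule bij_imp_permutes) (simp add: p_def)
        moreover have "\<pi>0 (p j) = \<pi> j" if "j \<in> {..<m}" for j
        proof -
          have "\<pi> j \<in> \<pi>0 ` {..<m}" using \<pi>(1) \<pi>0 that unfolding bij_betw_def by blast
          then show ?thesis unfolding p_def using that by (simp add: f_inv_into_f)
        qed
        then have "\<omega> \<in> F p" using \<omega> \<pi>(2) unfolding F_def sample_def space_PiM by (auto simp: PiE_iff)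
        ultimately show "\<omega> \<in> (\<Union>p\<in>?S. F p)" by blast
      next
        assume "\<omega> \<in> (\<Union>p\<in>?S. F p)"
        then obtain p where p: "p \<in> ?S" "\<omega> \<in> F p" by blast
        have "\<omega> \<in> space (sample t m)" using sets.sets_into_space[OF setsF[OF p(1)]] p(2) by blast
        moreover have "\<forall>j\<in>{..<m}. \<omega> j \<in> R (\<pi>0 (p j))" using p(2) unfolding F_def by (auto dest: PiE_mem)
        ultimately show "\<omega> \<in> E" unfolding E_def using bij[OF p(1)] by blast
      qed
    qed
    have disj: "disjoint_family_on F ?S" unfolding disjoint_family_on_def
    proof (intro ballI impI)
      fix p q assume pq: "p \<in> ?S" "q \<in> ?S" "p \<noteq> q"
      show "F p \<inter> F q = {}"
      proof (rule ccontr)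
        assume "F p \<inter> F q \<noteq> {}"
        then obtain \<omega> where \<omega>: "\<omega> \<in> F p" "\<omega> \<in> F q" by blast
        have "p j = q j" for j
        proof (cases "j \<in> {..<m}")
          case j: True
          have "\<omega> j \<in> R (\<pi>0 (p j)) \<inter> R (\<pi>0 (q j))" using \<omega> j unfolding F_def by (auto dest: PiE_mem)
          then have "\<pi>0 (p j) = \<pi>0 (q j)"
            using disjoint_family_onD_eq[OF I(2) pI[OF pq(1) j] pI[OF pq(2) j], of "\<omega> j"] by simp
          moreover have "p j \<in> {..<m}" "q j \<in> {..<m}" using pq j by (metis mem_Collect_eq permutes_in_image)+
          ultimately show ?thesis using \<pi>0 unfolding bij_betw_def inj_on_def by blast
        next
          case False
          then show ?thesis using pq by (metis mem_Collect_eq permutes_not_in)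
        qed
        then show False using pq(3) by blast
      qed
    qed
    have finS: "finite ?S" by (rule finite_permutations) simp
    have emF: "emeasure (sample t m) (F p) = (\<Prod>i\<in>I. emeasure lborel (R i))" if "p \<in> ?S" for p
    proof -
      have "emeasure (sample t m) (F p) = (\<Prod>j<m. emeasure (cone_measure t) (R (\<pi>0 (p j))))"
        unfolding F_def sample_def by (rule emeasure_PiM) (use pI[OF that] setsR in auto)
      also have "\<dots> = (\<Prod>i\<in>I. emeasure (cone_measure t) (R i))"
        by (rule prod.reindex_bij_betw[OF bij[OF that]])
      also have "\<dots> = (\<Prod>i\<in>I. emeasure lborel (R i))"
        by (rule prod.cong) (use I(3) cone_measure(3) in auto)
      finally show ?thesis .
    qed
    have "emeasure (sample t m) E = (\<Sum>p\<in>?S. emeasure (sample t m) (F p))"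
      unfolding EF by (rule sum_emeasure[symmetric]) (use setsF disj finS in auto)
    also have "\<dots> = of_nat (card ?S) * (\<Prod>i\<in>I. emeasure lborel (R i))" using emF by simp
    also have "card ?S = fact m" by (rule card_permutations) auto
    finally have "emeasure (sample t m) E = (if card I = m then fact m else 0) * (\<Prod>i\<in>I. emeasure lborel (R i))"
      using True by simp
    moreover have "E \<in> sets (sample t m)" unfolding EF by (rule sets.finite_UN[OF finS setsF])
    ultimately show ?thesis by blast
  qed
  then show "E \<in> sets (sample t m)"
    "emeasure (sample t m) E = (if card I = m then fact m else 0) * (\<Prod>i\<in>I. emeasure lborel (R i))" by auto
qed

text \<open>The rectangles are disjoint, so a point lies in at most one of them; conditions on
  counts thus become a bijection between sample indices and rectangles.\<close>

lemma bijective_matching: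
  assumes inj: "inj_on \<omega> J" and J: "finite J" and I: "disjoint_family_on R I" and sub: "\<omega> ` J \<subseteq> S" and R: "\<And>i. i \<in> I \<Longrightarrow> R i \<subseteq> S"
  shows "(\<forall>i\<in>I. card (\<omega> ` J \<inter> R i) = 1) \<and> \<omega> ` J \<inter> S \<subseteq> (\<Union>i\<in>I. R i) \<longleftrightarrow>
    (\<exists>\<pi>. bij_betw \<pi> J I \<and> (\<forall>j\<in>J. \<omega> j \<in> R (\<pi> j)))"
proof
  assume *: "(\<forall>i\<in>I. card (\<omega> ` J \<inter> R i) = 1) \<and> \<omega> ` J \<inter> S \<subseteq> (\<Union>i\<in>I. R i)"
  then have "\<forall>j\<in>J. \<exists>i. i \<in> I \<and> \<omega> j \<in> R i" using sub by blast
  then obtain \<pi> where \<pi>: "\<And>j. j \<in> J \<Longrightarrow> \<pi> j \<in> I \<and> \<omega> j \<in> R (\<pi> j)" by metis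
  have one: "\<exists>q. \<omega> ` J \<inter> R i = {q}" if "i \<in> I" for i using * that by (metis card_1_singletonE)
  have "inj_on \<pi> J"
  proof (rule inj_onI)
    fix j j' assume j: "j \<in> J" "j' \<in> J" "\<pi> j = \<pi> j'"
    obtain q where "\<omega> ` J \<inter> R (\<pi> j) = {q}" using one \<pi>[OF j(1)] by blast
    moreover have "\<omega> j \<in> \<omega> ` J \<inter> R (\<pi> j)" "\<omega> j' \<in> \<omega> ` J \<inter> R (\<pi> j)"
      using \<pi>[OF j(1)] \<pi>[OF j(2)] j by simp_all
    ultimately have "\<omega> j = \<omega> j'" by simp
    then show "j = j'" using inj_onD[OF inj _ j(1,2)] by blast
  qed
  moreover have "i \<in> \<pi> ` J" if i: "i \<in> I" for i
  proof -
    obtain q where "\<omega> ` J \<inter> R i = {q}" using one[OF i] ..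
    then have "q \<in> \<omega> ` J" "q \<in> R i" by blast+
    then obtain j where j: "j \<in> J" "\<omega> j \<in> R i" by blast
    then have "\<pi> j = i" using disjoint_family_onD_eq[OF I _ i, of "\<pi> j" "\<omega> j"] \<pi>[OF j(1)] by simp
    then show ?thesis using j(1) by blast
  qed
  ultimately have "bij_betw \<pi> J I" unfolding bij_betw_def using \<pi> by blast
  then show "\<exists>\<pi>. bij_betw \<pi> J I \<and> (\<forall>j\<in>J. \<omega> j \<in> R (\<pi> j))" using \<pi> by blast
next
  assume "\<exists>\<pi>. bij_betw \<pi> J I \<and> (\<forall>j\<in>J. \<omega> j \<in> R (\<pi> j))"
  then obtain \<pi> where \<pi>: "bij_betw \<pi> J I" "\<forall>j\<in>J. \<omega> j \<in> R (\<pi> j)" by blast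
  have mem: "\<pi> j \<in> I" if "j \<in> J" for j using \<pi>(1) that by (rule bij_betw_apply)
  have "card (\<omega> ` J \<inter> R i) = 1" if i: "i \<in> I" for i
  proof -
    obtain j where j: "j \<in> J" "\<pi> j = i" using \<pi>(1) i unfolding bij_betw_def by blast
    have "j' = j" if j': "j' \<in> J" "\<omega> j' \<in> R i" for j'
    proof -
      have "\<pi> j' = i" using disjoint_family_onD_eq[OF I mem[OF j'(1)] i, of "\<omega> j'"] j' \<pi>(2) by simp
      then show ?thesis using \<pi>(1) j j' unfolding bij_betw_def inj_on_def by blast
    qed
    then have "\<omega> ` J \<inter> R i = {\<omega> j}" using \<pi>(2) j by (intro equalityI subsetI) auto
    then show ?thesis by simp
  qed
  moreover have "\<omega> ` J \<inter> S \<subseteq> (\<Union>i\<in>I. R i)" using \<pi>(2) mem by blast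
  ultimately show "(\<forall>i\<in>I. card (\<omega> ` J \<inter> R i) = 1) \<and> \<omega> ` J \<inter> S \<subseteq> (\<Union>i\<in>I. R i)" by blast
qed

lemma Gamma_w_sets: "Gamma t \<in> w_sets t"
  unfolding w_sets_def using slice_Gamma_sets by auto

lemma good_empty: "good {}"
  unfolding good_def generic_def by auto

text \<open>Both sides are the total mass of \<open>sample t m\<close>: the right one by the product
  formula, the left one because almost every sample gives a regular configuration and
  \<open>law_total\<close> computes the mass of those.\<close>

lemma size_mass:
  assumes t: "t \<ge> 0"
  shows "(\<integral>\<^sup>+n. (if card (up_index n) = m then fact m else 0) * emeasure (step_lebesgue n) (slice n (Gamma t)) \<partial>count_space step_numbers)
    = ennreal ((2 * t ^ 2) ^ m)"
proof -
  interpret product_sigma_finite "\<lambda>_ :: nat. cone_measure t" by (rule product_sigma_finite_cone[OF t])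
  let ?M = "sample t m"
  obtain N0 where N0: "N0 \<in> null_sets ?M" and AE: "\<And>\<omega>. \<omega> \<in> space ?M - N0 \<Longrightarrow>
      inj_on (\<lambda>j. fst (\<omega> j)) {..<m} \<and> inj_on (\<lambda>j. snd (\<omega> j)) {..<m} \<and>
      (\<forall>i\<in>{..<m}. \<forall>j\<in>{..<m}. fst (\<omega> i) + snd (\<omega> j) \<noteq> 2 * t)"
    using AE_E3[OF AE_sample[OF t, of m]] by metis
  have N0s: "N0 \<in> sets ?M" "N0 \<subseteq> space ?M" using N0 sets.sets_into_space by blast+
  \<comment> \<open>\<open>matching_law\<close> asks for good points everywhere, so the exceptional
    samples are given the empty point set.\<close>
  define N where "N \<omega> = (if \<omega> \<in> N0 then {} else \<omega> ` {..<m})" for \<omega> :: "nat \<Rightarrow> real \<times> real"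
  have inC: "\<omega> j \<in> past_cone t" if "\<omega> \<in> space ?M" "j \<in> {..<m}" for \<omega> j
    using that unfolding sample_def space_PiM cone_measure(1) by (auto dest: PiE_mem)
  have good: "good (N \<omega>)" if \<omega>: "\<omega> \<in> space ?M" for \<omega>
  proof (cases "\<omega> \<in> N0")
    case False
    then have "inj_on (fst \<circ> \<omega>) {..<m}" "inj_on (snd \<circ> \<omega>) {..<m}" using AE[of \<omega>] \<omega> by (simp_all add: comp_def)
    then have "inj_on fst (\<omega> ` {..<m})" "inj_on snd (\<omega> ` {..<m})" by (auto intro: inj_on_imageI)
    then have "generic (\<omega> ` {..<m})" by (intro generic_finite) auto
    moreover have "0 < fst p \<and> 0 < snd p" if "p \<in> \<omega> ` {..<m}" for p
      using that inC[OF \<omega>] unfolding past_cone_def by auto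
    ultimately show ?thesis unfolding N_def good_def using False by simp
  qed (simp add: N_def good_empty)
  define c :: "nat \<Rightarrow> ennreal" where "c k = (if k = m then fact m else 0)" for k
  have "matching_law ?M N t c" unfolding matching_law_def
  proof (intro conjI ballI good allI impI, assumption)
    fix I :: "step_index set" and R
    assume IR: "finite I \<and> disjoint_family_on R I \<and> (\<forall>i\<in>I. R i \<in> sets borel \<and> R i \<subseteq> past_cone t)"
    define E where "E = {\<omega>\<in>space ?M. (\<forall>i\<in>I. card (N \<omega> \<inter> R i) = 1) \<and> N \<omega> \<inter> past t \<subseteq> (\<Union>i\<in>I. R i)}"
    define E' where "E' = {\<omega>\<in>space ?M. \<exists>\<pi>. bij_betw \<pi> {..<m} I \<and> (\<forall>j\<in>{..<m}. \<omega> j \<in> R (\<pi> j))}"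
    have E': "E' \<in> sets ?M" "emeasure ?M E' = c (card I) * (\<Prod>i\<in>I. emeasure lborel (R i))"
      unfolding E'_def c_def using IR by (intro sample_matching[OF t]; blast)+
    have iff: "\<omega> \<in> E \<longleftrightarrow> \<omega> \<in> E'" if \<omega>: "\<omega> \<in> space ?M - N0" for \<omega>
    proof -
      have inj: "inj_on \<omega> {..<m}" using AE[OF \<omega>] unfolding inj_on_def by metis
      have N: "N \<omega> = \<omega> ` {..<m}" using \<omega> unfolding N_def by simp
      have cp: "past_cone t \<subseteq> past t" unfolding past_cone_def by blast
      have Rp: "R i \<subseteq> past t" if "i \<in> I" for i using IR that cp by blast
      have sub: "\<omega> ` {..<m} \<subseteq> past t" using inC[of \<omega>] \<omega> cp by blast
      have "disjoint_family_on R I" using IR by blast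
      from bijective_matching[OF inj finite_lessThan this sub Rp] \<omega>
      show ?thesis unfolding E_def E'_def by (simp add: N)
    qed
    \<comment> \<open>The empty point set satisfies the event exactly if there is no
      rectangle.\<close>
    have EN: "E \<inter> N0 = (if I = {} then N0 else {})"
      using N0s(2) unfolding E_def N_def by auto
    have "E = (E' - N0) \<union> (if I = {} then N0 else {})"
    proof -
      have "E = (E - N0) \<union> (E \<inter> N0)" by blast
      also have "E - N0 = E' - N0" using iff unfolding E_def E'_def by blast
      finally show ?thesis unfolding EN .
    qed
    then have setsE: "E \<in> sets ?M" using E'(1) N0s(1) by auto
    have "emeasure ?M E = emeasure ?M E'"
    proof (rule emeasure_eq_AE[OF _ setsE E'(1)])
      have "AE \<omega> in ?M. \<omega> \<notin> N0" by (rule AE_not_in[OF N0])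
      with AE_space show "AE \<omega> in ?M. (\<omega> \<in> E) = (\<omega> \<in> E')" by eventually_elim (use iff in blast)
    qed
    then show "{\<omega>\<in>space ?M. (\<forall>i\<in>I. card (N \<omega> \<inter> R i) = 1) \<and> N \<omega> \<inter> past t \<subseteq> (\<Union>i\<in>I. R i)} \<in> sets ?M"
      "emeasure ?M {\<omega>\<in>space ?M. (\<forall>i\<in>I. card (N \<omega> \<inter> R i) = 1) \<and> N \<omega> \<inter> past t \<subseteq> (\<Union>i\<in>I. R i)} =
        c (card I) * (\<Prod>i\<in>I. emeasure lborel (R i))"
      using setsE E'(2) unfolding E_def by simp_all
  qed
  note law0 = this
  have cfin: "c k \<noteq> \<infinity>" for k
  proof -
    have "(fact m :: ennreal) = of_nat (fact m)" by simp
    then show ?thesis unfolding c_def by (metis ennreal_of_nat_neq_top infinity_ennreal_def ennreal_0 ennreal_neq_top)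
  qed
  have law: "emeasure ?M {\<omega>\<in>space ?M. step_map (rsk_lines (N \<omega>) t) \<in> Gamma t \<inter> regular t} =
      (\<integral>\<^sup>+n. c (card (up_index n)) * emeasure (step_lebesgue n) (slice n (Gamma t)) \<partial>count_space step_numbers)"
    and setsL: "{\<omega>\<in>space ?M. step_map (rsk_lines (N \<omega>) t) \<in> Gamma t \<inter> regular t} \<in> sets ?M"
    using law_total[OF law0 cfin Gamma_w_sets] by simp_all
  have "emeasure ?M {\<omega>\<in>space ?M. step_map (rsk_lines (N \<omega>) t) \<in> Gamma t \<inter> regular t} = emeasure ?M (space ?M)"
  proof (rule emeasure_eq_AE[OF _ setsL])
    have "AE \<omega> in ?M. \<omega> \<notin> N0" by (rule AE_not_in[OF N0])
    with AE_space show "AE \<omega> in ?M. (\<omega> \<in> {\<omega>\<in>space ?M. step_map (rsk_lines (N \<omega>) t) \<in> Gamma t \<inter> regular t}) = (\<omega> \<in> space ?M)"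
    proof eventually_elim
      fix \<omega> assume \<omega>: "\<omega> \<in> space ?M" "\<omega> \<notin> N0"
      have "step_map (rsk_lines (N \<omega>) t) \<in> regular t"
      proof (rule configuration_regular[OF good[OF \<omega>(1)]])
        fix p q assume "p \<in> N \<omega> \<inter> past t" "q \<in> N \<omega> \<inter> past t"
        then obtain i j where "i \<in> {..<m}" "p = \<omega> i" "j \<in> {..<m}" "q = \<omega> j" using \<omega>(2) unfolding N_def by auto
        then show "fst p + snd q \<noteq> 2 * t" using AE[of \<omega>] \<omega> by auto
      qed
      moreover have "step_map (rsk_lines (N \<omega>) t) \<in> Gamma t"
        unfolding Gamma_def by (intro imageI rsk_lines_Lambda good \<omega>(1))
      ultimately show "(\<omega> \<in> {\<omega>\<in>space ?M. step_map (rsk_lines (N \<omega>) t) \<in> Gamma t \<inter> regular t}) = (\<omega> \<in> space ?M)" using \<omega> by simp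
    qed
  qed simp
  also have "emeasure ?M (space ?M) = (\<Prod>j<m. emeasure (cone_measure t) (space (cone_measure t)))"
    unfolding sample_def space_PiM by (rule emeasure_PiM) auto
  also have "\<dots> = ennreal ((2 * t ^ 2) ^ m)"
    by (simp add: cone_measure emeasure_cone[OF t] ennreal_power)
  finally show ?thesis using law unfolding c_def by simp
qed

section \<open>The Poisson process\<close>

definition uv_intensity :: "(real \<times> real) measure" where
  "uv_intensity = density lborel (indicator {p. 0 < fst p \<and> 0 < snd p})"

lemma quadrant_borel: "{p :: real \<times> real. 0 < fst p \<and> 0 < snd p} \<in> sets borel"
  by (intro borel_open open_Collect_conj open_Collect_less continuous_intros)

lemma light_cone_borel: "light_cone \<in> borel_measurable borel"
  unfolding light_cone_def case_prod_unfold
  by (intro borel_measurable_continuous_onI continuous_intros)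

lemma emeasure_uv:
  assumes "A \<in> sets borel"
  shows "emeasure uv_intensity A = emeasure lborel (A \<inter> {p. 0 < fst p \<and> 0 < snd p})"
proof -
  have "emeasure uv_intensity A = (\<integral>\<^sup>+p. indicator {p. 0 < fst p \<and> 0 < snd p} p * indicator A p \<partial>lborel)"
    unfolding uv_intensity_def using assms quadrant_borel by (intro emeasure_density) auto
  also have "\<dots> = (\<integral>\<^sup>+p. indicator (A \<inter> {p. 0 < fst p \<and> 0 < snd p}) p \<partial>lborel)"
    by (intro nn_integral_cong) (auto simp: indicator_def)
  also have "\<dots> = emeasure lborel (A \<inter> {p. 0 < fst p \<and> 0 < snd p})"
    using assms quadrant_borel by (intro nn_integral_indicator) auto
  finally show ?thesis .
qed

text \<open>The map \<open>(x, s) \<mapsto> (s + x, s - x)\<close> doubles areas, which absorbs the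
  intensity 2. The change of variables is done one coordinate at a time, first
  \<open>u = s + x\<close>, then \<open>v = u - 2 x\<close>.\<close>

lemma emeasure_nucleation:
  assumes A: "A \<in> sets borel"
  shows "emeasure nucleation_intensity (light_cone -` A) = emeasure uv_intensity A"
proof -
  define E where "E = A \<inter> {p. 0 < fst p \<and> 0 < snd p}"
  have E: "E \<in> sets borel" unfolding E_def using A quadrant_borel by auto
  define F :: "real \<times> real \<Rightarrow> ennreal" where "F = indicator E"
  have F: "F \<in> borel_measurable borel" unfolding F_def using E by simp
  have Fc: "(\<lambda>p. F (f p)) \<in> borel_measurable borel" if "continuous_on UNIV f" for f :: "'b::topological_space \<Rightarrow> real \<times> real"
    by (rule measurable_compose[OF borel_measurable_continuous_onI[OF that] F])
  have past_cone: "{p :: real \<times> real. \<bar>fst p\<bar> < snd p} \<in> sets borel"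
    by (intro borel_open open_Collect_less continuous_intros)
  have dens: "(\<lambda>(x :: real, s :: real). if \<bar>x\<bar> < s then 2 else 0 :: ennreal) \<in> borel_measurable lborel"
  proof -
    have "(\<lambda>p. if p \<in> {p :: real \<times> real. \<bar>fst p\<bar> < snd p} then 2 else 0 :: ennreal) \<in> borel_measurable lborel"
      by (rule measurable_If_set) (use past_cone in auto)
    then show ?thesis by (simp add: case_prod_unfold)
  qed
  have lcA: "light_cone -` A \<in> sets lborel" using measurable_sets[OF light_cone_borel A] by simp
  have "emeasure nucleation_intensity (light_cone -` A) =
      (\<integral>\<^sup>+p. (\<lambda>(x, s). if \<bar>x\<bar> < s then 2 else 0) p * indicator (light_cone -` A) p \<partial>lborel)"
    unfolding nucleation_intensity_def by (rule emeasure_density[OF dens lcA])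
  also have "\<dots> = (\<integral>\<^sup>+p. 2 * F (snd p + fst p, snd p - fst p) \<partial>(lborel \<Otimes>\<^sub>M lborel))"
    unfolding lborel_prod
  proof (rule nn_integral_cong)
    fix p :: "real \<times> real"
    have "\<bar>fst p\<bar> < snd p \<longleftrightarrow> 0 < snd p + fst p \<and> 0 < snd p - fst p" by auto
    then show "(\<lambda>(x, s). if \<bar>x\<bar> < s then 2 else 0) p * indicator (light_cone -` A) p = 2 * F (snd p + fst p, snd p - fst p)"
      unfolding F_def E_def light_cone_def by (auto simp: indicator_def case_prod_unfold)
  qed
  also have "\<dots> = (\<integral>\<^sup>+x. \<integral>\<^sup>+s. 2 * F (s + x, s - x) \<partial>lborel \<partial>lborel)"
  proof -
    have "(\<lambda>p. 2 * F (snd p + fst p, snd p - fst p)) \<in> borel_measurable (lborel \<Otimes>\<^sub>M lborel)"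
      unfolding lborel_prod using Fc[of "\<lambda>p. (snd p + fst p, snd p - fst p)"] by (simp add: continuous_intros)
    from lborel.nn_integral_fst[OF this] show ?thesis by simp
  qed
  also have "\<dots> = (\<integral>\<^sup>+x. \<integral>\<^sup>+u. 2 * F (u, u - 2 * x) \<partial>lborel \<partial>lborel)"
  proof (rule nn_integral_cong)
    fix x :: real
    have "(\<lambda>s. 2 * F (s + x, s - x)) \<in> borel_measurable borel"
      using Fc[of "\<lambda>s. (s + x, s - x)"] by (simp add: continuous_intros)
    from nn_integral_real_affine[OF this, of 1 "- x"]
    show "(\<integral>\<^sup>+s. 2 * F (s + x, s - x) \<partial>lborel) = (\<integral>\<^sup>+u. 2 * F (u, u - 2 * x) \<partial>lborel)"
      by (simp add: algebra_simps)
  qed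
  also have "\<dots> = (\<integral>\<^sup>+u. \<integral>\<^sup>+x. 2 * F (u, u - 2 * x) \<partial>lborel \<partial>lborel)"
  proof -
    have "(\<lambda>p. 2 * F (fst p, fst p - 2 * snd p)) \<in> borel_measurable (lborel \<Otimes>\<^sub>M lborel)"
      unfolding lborel_prod using Fc[of "\<lambda>p. (fst p, fst p - 2 * snd p)"] by (simp add: continuous_intros)
    from lborel_pair.Fubini[OF this] show ?thesis by simp
  qed
  also have "\<dots> = (\<integral>\<^sup>+u. \<integral>\<^sup>+v. F (u, v) \<partial>lborel \<partial>lborel)"
  proof (rule nn_integral_cong)
    fix u :: real
    have m: "(\<lambda>v. F (u, v)) \<in> borel_measurable borel" "(\<lambda>x. F (u, u - 2 * x)) \<in> borel_measurable borel"
      using Fc[of "\<lambda>v. (u, v)"] Fc[of "\<lambda>x. (u, u - 2 * x)"] by (simp_all add: continuous_intros)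
    have "(\<integral>\<^sup>+v. F (u, v) \<partial>lborel) = 2 * (\<integral>\<^sup>+x. F (u, u - 2 * x) \<partial>lborel)"
      using nn_integral_real_affine[OF m(1), of "-2" u] by simp
    also have "\<dots> = (\<integral>\<^sup>+x. 2 * F (u, u - 2 * x) \<partial>lborel)"
      using m(2) by (intro nn_integral_cmult[symmetric]) simp
    finally show "(\<integral>\<^sup>+x. 2 * F (u, u - 2 * x) \<partial>lborel) = (\<integral>\<^sup>+v. F (u, v) \<partial>lborel)" ..
  qed
  also have "\<dots> = (\<integral>\<^sup>+p. F p \<partial>(lborel \<Otimes>\<^sub>M lborel))"
    by (rule lborel.nn_integral_fst) (use F in \<open>simp add: lborel_prod\<close>)
  also have "\<dots> = emeasure lborel E" unfolding lborel_prod F_def using E by simp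
  also have "\<dots> = emeasure uv_intensity A" unfolding emeasure_uv[OF A] E_def ..
  finally show ?thesis .
qed

lemma inj_light_cone: "inj light_cone"
  unfolding light_cone_def by (rule injI) auto

lemma poisson_uv:
  assumes "poisson_point_process M nucleation_intensity N"
  shows "poisson_point_process M uv_intensity (\<lambda>\<omega>. light_cone ` N \<omega>)"
proof -
  have img: "light_cone ` N \<omega> \<inter> A = light_cone ` (N \<omega> \<inter> light_cone -` A)" for \<omega> A by auto
  have card: "card (light_cone ` N \<omega> \<inter> A) = card (N \<omega> \<inter> light_cone -` A)" for \<omega> A
    unfolding img by (rule card_image) (rule inj_on_subset[OF inj_light_cone], simp)
  have fin: "finite (light_cone ` N \<omega> \<inter> A) \<longleftrightarrow> finite (N \<omega> \<inter> light_cone -` A)" for \<omega> A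
    unfolding img by (rule finite_image_iff) (rule inj_on_subset[OF inj_light_cone], simp)
  have sets: "light_cone -` A \<in> sets nucleation_intensity" "emeasure nucleation_intensity (light_cone -` A) = emeasure uv_intensity A"
    "measure nucleation_intensity (light_cone -` A) = measure uv_intensity A"
    if "A \<in> sets uv_intensity" for A
  proof -
    have A: "A \<in> sets borel" using that unfolding uv_intensity_def by simp
    show "light_cone -` A \<in> sets nucleation_intensity"
      using measurable_sets[OF light_cone_borel A] unfolding nucleation_intensity_def by simp
    show "emeasure nucleation_intensity (light_cone -` A) = emeasure uv_intensity A"
      by (rule emeasure_nucleation[OF A])
    then show "measure nucleation_intensity (light_cone -` A) = measure uv_intensity A" unfolding measure_def by simp
  qed
  note ppp = assms[unfolded poisson_point_process_def]
  show ?thesis unfolding poisson_point_process_def card fin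
  proof (intro conjI allI impI ballI)
    fix A assume A: "A \<in> sets uv_intensity" "emeasure uv_intensity A < \<infinity>"
    note p = ppp[THEN conjunct1, rule_format, OF sets(1)[OF A(1)], unfolded sets(2,3)[OF A(1)], OF A(2)]
    show "AE \<omega> in M. finite (N \<omega> \<inter> light_cone -` A)" using p by blast
    show "(\<lambda>\<omega>. card (N \<omega> \<inter> light_cone -` A)) \<in> M \<rightarrow>\<^sub>M count_space UNIV" using p by blast
    show "measure M {\<omega> \<in> space M. card (N \<omega> \<inter> light_cone -` A) = m} =
       measure uv_intensity A ^ m / fact m * exp (- measure uv_intensity A)" for m using p by blast
  next
    fix I :: "nat set" and A
    assume IA: "finite I \<and> (\<forall>i\<in>I. A i \<in> sets uv_intensity \<and> emeasure uv_intensity (A i) < \<infinity>) \<and> disjoint_family_on A I"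
    have "finite I \<and> (\<forall>i\<in>I. light_cone -` A i \<in> sets nucleation_intensity \<and> emeasure nucleation_intensity (light_cone -` A i) < \<infinity>) \<and>
        disjoint_family_on (\<lambda>i. light_cone -` A i) I"
    proof (intro conjI ballI)
      show "disjoint_family_on (\<lambda>i. light_cone -` A i) I"
        using IA unfolding disjoint_family_on_def by (simp add: vimage_Int[symmetric])
    qed (use IA sets(1,2) in auto)
    then show "prob_space.indep_vars M (\<lambda>_. count_space UNIV) (\<lambda>i \<omega>. card (N \<omega> \<inter> light_cone -` A i)) I"
      using ppp[THEN conjunct2, rule_format, of I "\<lambda>i. light_cone -` A i"] by blast
  qed
qed

locale uv_process = prob_space M for M :: "'a measure" +
  fixes P :: "'a \<Rightarrow> (real \<times> real) set"
  assumes ppp: "poisson_point_process M uv_intensity P"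
begin

lemma count_law:
  assumes "A \<in> sets borel" "emeasure uv_intensity A < \<infinity>"
  shows "AE \<omega> in M. finite (P \<omega> \<inter> A)" "(\<lambda>\<omega>. card (P \<omega> \<inter> A)) \<in> measurable M (count_space UNIV)"
    "prob {\<omega> \<in> space M. card (P \<omega> \<inter> A) = m} = measure uv_intensity A ^ m / fact m * exp (- measure uv_intensity A)"
  using ppp[unfolded poisson_point_process_def, THEN conjunct1, rule_format, of A] assms
  unfolding uv_intensity_def by auto

lemma count_sets:
  assumes "A \<in> sets borel" "emeasure uv_intensity A < \<infinity>"
  shows "{\<omega>\<in>space M. Q (card (P \<omega> \<inter> A))} \<in> events"
  using measurable_sets[OF count_law(2)[OF assms], of "Collect Q"] by (simp add: vimage_def Int_def conj_commute)

lemma emeasure_uv_cone: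
  assumes "A \<in> sets borel" "A \<subseteq> past_cone t"
  shows "emeasure uv_intensity A = emeasure lborel A" "emeasure uv_intensity A < \<infinity>"
proof -
  have "A \<inter> {p. 0 < fst p \<and> 0 < snd p} = A" using assms unfolding past_cone_def by blast
  then show eq: "emeasure uv_intensity A = emeasure lborel A" using emeasure_uv[OF assms(1)] by simp
  have "A \<subseteq> past_cone \<bar>t\<bar>" using assms(2) unfolding past_cone_def past_def by force
  then have "emeasure lborel A \<le> emeasure lborel (past_cone \<bar>t\<bar>)" using cone_sets by (intro emeasure_mono) auto
  then show "emeasure uv_intensity A < \<infinity>" unfolding eq emeasure_cone[OF abs_ge_zero] by (simp add: order_le_less_trans)
qed

lemma AE_quadrant: "AE \<omega> in M. P \<omega> \<subseteq> {p. 0 < fst p \<and> 0 < snd p}"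
proof -
  let ?A = "- {p :: real \<times> real. 0 < fst p \<and> 0 < snd p}"
  have A: "?A \<in> sets borel" using quadrant_borel by auto
  have "emeasure uv_intensity ?A = 0" unfolding emeasure_uv[OF A] by simp
  then have z: "emeasure uv_intensity ?A < \<infinity>" "measure uv_intensity ?A = 0" unfolding measure_def by simp_all
  have "prob {\<omega> \<in> space M. card (P \<omega> \<inter> ?A) = 0} = 1" using count_law(3)[OF A z(1), of 0] z(2) by simp
  then have "AE \<omega> in M. \<omega> \<in> {\<omega> \<in> space M. card (P \<omega> \<inter> ?A) = 0}"
    using count_sets[OF A z(1)] by (subst (asm) prob_eq_1) auto
  with count_law(1)[OF A z(1)] show ?thesis
  proof eventually_elim
    fix \<omega> assume "finite (P \<omega> \<inter> ?A)" "\<omega> \<in> {\<omega> \<in> space M. card (P \<omega> \<inter> ?A) = 0}"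
    then have "P \<omega> \<inter> ?A = {}" by simp
    then show "P \<omega> \<subseteq> {p. 0 < fst p \<and> 0 < snd p}" by blast
  qed
qed

text \<open>The bound is of second order in the intensity, which beats the number of strips in
  \<open>AE_strips\<close>. It comes from \<open>1 - l \<le> exp (- l)\<close>, multiplied by
  \<open>1 + l\<close>.\<close>

lemma prob_two_points:
  assumes "A \<in> sets borel" "emeasure uv_intensity A < \<infinity>"
  shows "prob {\<omega>\<in>space M. \<not> card (P \<omega> \<inter> A) \<le> 1} \<le> (measure uv_intensity A)\<^sup>2"
proof -
  define l where "l = measure uv_intensity A"
  have l: "l \<ge> 0" unfolding l_def by simp
  let ?E = "\<lambda>k. {\<omega>\<in>space M. card (P \<omega> \<inter> A) = k}"
  have E: "?E k \<in> events" for k by (rule count_sets[OF assms])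
  have "{\<omega>\<in>space M. \<not> card (P \<omega> \<inter> A) \<le> 1} = space M - (?E 0 \<union> ?E 1)" by auto
  then have "prob {\<omega>\<in>space M. \<not> card (P \<omega> \<inter> A) \<le> 1} = 1 - prob (?E 0 \<union> ?E 1)"
    using E by (simp add: prob_compl)
  also have "prob (?E 0 \<union> ?E 1) = prob (?E 0) + prob (?E 1)"
    by (rule finite_measure_Union[OF E E]) auto
  also have "\<dots> = (1 + l) * exp (- l)"
    using count_law(3)[OF assms, of 0] count_law(3)[OF assms, of 1] unfolding l_def by (simp add: algebra_simps)
  also have "1 - (1 + l) * exp (- l) \<le> l\<^sup>2"
  proof -
    have "1 - l \<le> exp (- l)" using exp_ge_add_one_self[of "- l"] by simp
    then have "(1 + l) * (1 - l) \<le> (1 + l) * exp (- l)" using l by (intro mult_left_mono) auto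
    then show ?thesis by (simp add: algebra_simps power2_eq_square)
  qed
  finally show ?thesis unfolding l_def .
qed

text \<open>A union bound over \<open>n\<close> strips of mass at most \<open>C / n\<close> gives
  failure probability at most \<open>C^2 / n\<close>, and failure for all \<open>n\<close> has
  probability below each of these bounds.\<close>

lemma AE_strips:
  assumes A: "\<And>n i. A n i \<in> sets borel" "\<And>n i. emeasure uv_intensity (A n i) < \<infinity>"
    and C: "\<And>n i. n \<ge> 1 \<Longrightarrow> measure uv_intensity (A n i) \<le> C / real n"
  shows "AE \<omega> in M. \<exists>n\<ge>1. \<forall>i<n. card (P \<omega> \<inter> A n i) \<le> 1"
proof -
  define B where "B n = {\<omega>\<in>space M. \<exists>i<n. \<not> card (P \<omega> \<inter> A n i) \<le> 1}" for n :: nat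
  have BU: "B n = (\<Union>i<n. {\<omega>\<in>space M. \<not> card (P \<omega> \<inter> A n i) \<le> 1})" for n unfolding B_def by blast
  have B: "B n \<in> events" for n unfolding BU using count_sets[OF A] by (intro sets.finite_UN) auto
  have pB: "prob (B n) \<le> C\<^sup>2 / real n" if n: "n \<ge> 1" for n
  proof -
    have "prob (B n) \<le> (\<Sum>i<n. prob {\<omega>\<in>space M. \<not> card (P \<omega> \<inter> A n i) \<le> 1})"
      unfolding BU using count_sets[OF A] by (intro finite_measure_subadditive_finite) auto
    also have "\<dots> \<le> (\<Sum>i<n. (C / real n)\<^sup>2)"
    proof (rule sum_mono)
      fix i
      have "prob {\<omega>\<in>space M. \<not> card (P \<omega> \<inter> A n i) \<le> 1} \<le> (measure uv_intensity (A n i))\<^sup>2"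
        by (rule prob_two_points[OF A])
      also have "\<dots> \<le> (C / real n)\<^sup>2" using C[OF n] by (intro power_mono) auto
      finally show "prob {\<omega>\<in>space M. \<not> card (P \<omega> \<inter> A n i) \<le> 1} \<le> (C / real n)\<^sup>2" .
    qed
    also have "\<dots> = C\<^sup>2 / real n" using n by (simp add: power2_eq_square field_simps)
    finally show ?thesis .
  qed
  define D where "D = (\<Inter>n\<in>{1..}. B n)"
  have D: "D \<in> events" unfolding D_def using B by (intro sets.countable_INT') auto
  have "prob D \<le> C\<^sup>2 / real (Suc n)" for n
  proof -
    have "prob D \<le> prob (B (Suc n))" unfolding D_def by (rule finite_measure_mono[OF _ B]) auto
    also have "\<dots> \<le> C\<^sup>2 / real (Suc n)" by (rule pB) simp
    finally show ?thesis .
  qed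
  moreover have "(\<lambda>n. C\<^sup>2 / real (Suc n)) \<longlonglongrightarrow> 0"
    using LIMSEQ_Suc[OF lim_const_over_n[of "C\<^sup>2"]] by simp
  ultimately have "prob D \<le> 0" by (intro LIMSEQ_le_const) auto
  then have "prob D = 0" using measure_nonneg[of M D] by linarith
  then have "AE \<omega> in M. \<omega> \<notin> D" using D by (intro AE_not_in) (simp add: null_sets_def emeasure_eq_measure)
  with AE_space show ?thesis by eventually_elim (auto simp: D_def B_def)
qed

text \<open>Two points with equal \<open>f\<close> lie in a common strip for every subdivision into
  \<open>n\<close> strips of width \<open>2 k / n\<close>, whose areas are at most
  \<open>(2 k)^2 / n\<close>; by \<open>AE_strips\<close> this almost surely fails for some
  \<open>n\<close>.\<close>

lemma AE_inj_cone:
  fixes f :: "real \<times> real \<Rightarrow> real"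
  assumes f: "f = fst \<or> f = snd"
  shows "AE \<omega> in M. inj_on f (P \<omega> \<inter> past_cone (real k))"
proof -
  define A where "A n i = past_cone (real k) \<inter> {p. 2 * real k * real i / real n < f p \<and> f p \<le> 2 * real k * real (Suc i) / real n}" for n i :: nat
  have contf: "continuous_on UNIV f" using f by (auto intro: continuous_intros)
  have Ab: "A n i \<in> sets borel" for n i
    unfolding A_def Collect_conj_eq
    by (intro sets.Int cone_sets borel_open borel_closed open_Collect_less closed_Collect_le continuous_intros contf)
  have Ac: "A n i \<subseteq> past_cone (real k)" for n i unfolding A_def by blast
  have Afin: "emeasure uv_intensity (A n i) < \<infinity>" for n i by (rule emeasure_uv_cone(2)[OF Ab Ac])
  have le: "measure uv_intensity (A n i) \<le> (2 * real k)\<^sup>2 / real n" if n: "n \<ge> 1" for n i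
  proof -
    let ?a = "2 * real k * real i / real n" and ?b = "2 * real k * real (Suc i) / real n"
    have ab: "?b - ?a = 2 * real k / real n" using n by (simp add: field_simps)
    have ne: "snd \<noteq> (fst :: real \<times> real \<Rightarrow> real)"
    proof
      assume "snd = (fst :: real \<times> real \<Rightarrow> real)"
      then have "snd (0 :: real, 1 :: real) = fst (0 :: real, 1 :: real)" by (rule fun_cong)
      then show False by simp
    qed
    have ab': "?a \<le> ?b" by (intro divide_right_mono mult_left_mono) auto
    define S where "S = (if f = fst then {?a<..?b} else {0<..2 * real k})"
    define T where "T = (if f = fst then {0<..2 * real k} else {?a<..?b})"
    have "A n i \<subseteq> S \<times> T" using f ne unfolding A_def S_def T_def past_cone_def past_def by (elim disjE) (auto simp: mem_Times_iff)
    then have "emeasure lborel (A n i) \<le> emeasure lborel (S \<times> T)"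
      unfolding S_def T_def by (intro emeasure_mono) (auto simp: borel_prod[symmetric])
    also have "emeasure lborel (S \<times> T) = emeasure lborel S * emeasure lborel T"
      unfolding lborel_prod[symmetric] S_def T_def by (intro lborel.emeasure_pair_measure_Times) auto
    also have "\<dots> = ennreal (2 * real k / real n * (2 * real k))"
      using ab ab' unfolding S_def T_def by (simp add: ennreal_mult[symmetric] mult.commute)
    finally have "measure uv_intensity (A n i) \<le> 2 * real k / real n * (2 * real k)"
      unfolding measure_def emeasure_uv_cone(1)[OF Ab Ac] by (intro enn2real_leI) auto
    then show ?thesis by (simp add: power2_eq_square)
  qed
  have "emeasure uv_intensity (past_cone (real k)) < \<infinity>" by (rule emeasure_uv_cone(2)[OF cone_sets order_refl])
  note fin = count_law(1)[OF cone_sets this]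
  have "AE \<omega> in M. \<exists>n\<ge>1. \<forall>i<n. card (P \<omega> \<inter> A n i) \<le> 1" by (rule AE_strips[OF Ab Afin le])
  with fin show ?thesis
  proof eventually_elim
    fix \<omega> assume fin: "finite (P \<omega> \<inter> past_cone (real k))" and "\<exists>n\<ge>1. \<forall>i<n. card (P \<omega> \<inter> A n i) \<le> 1"
    then obtain n where n: "n \<ge> 1" "\<And>i. i < n \<Longrightarrow> card (P \<omega> \<inter> A n i) \<le> 1" by blast
    show "inj_on f (P \<omega> \<inter> past_cone (real k))"
    proof (rule inj_onI)
      fix p q assume pq: "p \<in> P \<omega> \<inter> past_cone (real k)" "q \<in> P \<omega> \<inter> past_cone (real k)" "f p = f q"
      have fp: "0 < f p" "f p < 2 * real k" using pq(1) f unfolding past_cone_def past_def by auto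
      then have k: "0 < real k" by linarith
      define z where "z = f p * real n / (2 * real k)"
      have z: "0 < z" "z < real n" unfolding z_def using fp k n(1) by (auto simp: field_simps)
      \<comment> \<open>The strips are open on the left and closed on the right, hence the ceiling
        minus 1.\<close>
      define i where "i = nat (\<lceil>z\<rceil> - 1)"
      have i: "real i < z" "z \<le> real (Suc i)" "i < n"
        unfolding i_def using z by (auto simp: of_nat_nat) linarith+
      have "f p = 2 * real k * z / real n" unfolding z_def using k n(1) by (simp add: field_simps)
      then have "2 * real k * real i / real n < f p" "f p \<le> 2 * real k * real (Suc i) / real n"
        using i k n(1) by (auto intro!: divide_strict_right_mono divide_right_mono)
      then have "p \<in> P \<omega> \<inter> A n i" "q \<in> P \<omega> \<inter> A n i" using pq unfolding A_def by auto
      moreover have "finite (P \<omega> \<inter> A n i)" using fin Ac by (rule_tac finite_subset[of _ "P \<omega> \<inter> past_cone (real k)"]) auto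
      ultimately show "p = q" using n(2)[OF i(3)] by (metis One_nat_def card_le_Suc0_iff_eq)
    qed
  qed
qed

lemma AE_good: "AE \<omega> in M. good (P \<omega>)"
proof -
  have fin: "AE \<omega> in M. finite (P \<omega> \<inter> past_cone (real k))" for k :: nat
    by (rule count_law(1)[OF cone_sets emeasure_uv_cone(2)[OF cone_sets order_refl]])
  have "AE \<omega> in M. \<forall>k::nat. finite (P \<omega> \<inter> past_cone (real k)) \<and> inj_on fst (P \<omega> \<inter> past_cone (real k)) \<and> inj_on snd (P \<omega> \<inter> past_cone (real k))"
    unfolding AE_all_countable using fin AE_inj_cone by (intro allI AE_conjI) auto
  with AE_quadrant show ?thesis
  proof eventually_elim
    fix \<omega> assume Q: "P \<omega> \<subseteq> {p. 0 < fst p \<and> 0 < snd p}"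
      and *: "\<forall>k::nat. finite (P \<omega> \<inter> past_cone (real k)) \<and> inj_on fst (P \<omega> \<inter> past_cone (real k)) \<and> inj_on snd (P \<omega> \<inter> past_cone (real k))"
    have past_cone: "p \<in> P \<omega> \<inter> past_cone (real k)" if "p \<in> P \<omega>" "fst p + snd p \<le> real k" for p k
      using that Q unfolding past_cone_def past_def by force
    have "finite (P \<omega> \<inter> {..a} \<times> {..b})" for a b
    proof -
      obtain k :: nat where "a + b \<le> real k" using real_arch_simple by blast
      then have "P \<omega> \<inter> {..a} \<times> {..b} \<subseteq> P \<omega> \<inter> past_cone (real k)" using past_cone by (intro subsetI) force
      then show ?thesis using * finite_subset by blast
    qed
    moreover have inj: "inj_on f (P \<omega>)" if "\<And>k::nat. inj_on f (P \<omega> \<inter> past_cone (real k))" for f :: "real \<times> real \<Rightarrow> real"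
    proof (rule inj_onI)
      fix p q assume pq: "p \<in> P \<omega>" "q \<in> P \<omega>" "f p = f q"
      obtain k :: nat where "max (fst p + snd p) (fst q + snd q) \<le> real k" using real_arch_simple by blast
      then have "p \<in> P \<omega> \<inter> past_cone (real k)" "q \<in> P \<omega> \<inter> past_cone (real k)" using past_cone pq by auto
      then show "p = q" using inj_onD[OF that] pq(3) by blast
    qed
    ultimately have "generic (P \<omega>)" unfolding generic_def using * by blast
    then show "good (P \<omega>)" unfolding good_def using Q by blast
  qed
qed

text \<open>The uncovered part of the triangle becomes cell 0 with prescribed count 0. The cells
  then partition \<open>past_cone t\<close>, and by independence their exponential factors multiply
  to that of the whole area \<open>2 t^2\<close>.\<close>

lemma matching_event:
  fixes R :: "'i \<Rightarrow> (real \<times> real) set"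
  assumes t: "t \<ge> 0" and I: "finite I" "disjoint_family_on R I" "\<And>i. i \<in> I \<Longrightarrow> R i \<in> sets borel \<and> R i \<subseteq> past_cone t"
  defines "E \<equiv> {\<omega>\<in>space M. (\<forall>i\<in>I. card (P \<omega> \<inter> R i) = 1) \<and> card (P \<omega> \<inter> (past_cone t - (\<Union>i\<in>I. R i))) = 0}"
  shows "E \<in> events" "emeasure M E = ennreal (exp (- (2 * t\<^sup>2))) * (\<Prod>i\<in>I. emeasure lborel (R i))"
proof -
  define m where "m = card I"
  obtain e where e: "bij_betw e {1..m} I" using ex_bij_betw_nat_finite_1[OF I(1)] unfolding m_def by blast
  define A where "A j = (if j = 0 then past_cone t - (\<Union>i\<in>I. R i) else R (e j))" for j :: nat
  define J where "J = {..m}"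
  have J: "J = insert 0 {1..m}" "finite J" "J \<noteq> {}" unfolding J_def by auto
  have eI: "e j \<in> I" if "j \<in> {1..m}" for j using e that by (rule bij_betw_apply)
  have UR: "(\<Union>i\<in>I. R i) \<in> sets borel" using I by (intro sets.finite_UN) auto
  have A: "A j \<in> sets borel" "A j \<subseteq> past_cone t" if "j \<in> J" for j
    using that I(3) eI UR cone_sets[of t] unfolding A_def J(1) by auto
  note fin = emeasure_uv_cone(2)[OF A]
  have disj: "disjoint_family_on A J" unfolding disjoint_family_on_def
  proof (intro ballI impI)
    fix i j assume ij: "i \<in> J" "j \<in> J" "i \<noteq> j"
    have R0: "A 0 \<inter> A j = {}" if "j \<in> {1..m}" for j using eI[OF that] that unfolding A_def by auto
    have "A i \<inter> A j = {}" if "i \<in> {1..m}" "j \<in> {1..m}"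
    proof -
      have "e i \<noteq> e j" using e ij(3) that unfolding bij_betw_def inj_on_def by blast
      then have "R (e i) \<inter> R (e j) = {}" using I(2) eI that unfolding disjoint_family_on_def by blast
      then show ?thesis using that unfolding A_def by auto
    qed
    then show "A i \<inter> A j = {}" using ij R0[of i] R0[of j] unfolding J(1) by auto
  qed
  have "finite J \<and> (\<forall>i\<in>J. A i \<in> sets uv_intensity \<and> emeasure uv_intensity (A i) < \<infinity>) \<and> disjoint_family_on A J"
    using J(2) A fin disj unfolding uv_intensity_def by auto
  then have ind: "indep_vars (\<lambda>_. count_space UNIV) (\<lambda>i \<omega>. card (P \<omega> \<inter> A i)) J"
    using ppp[unfolded poisson_point_process_def, THEN conjunct2] by blast
  define k where "k j = (if j = 0 then 0 else 1 :: nat)" for j :: nat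
  let ?F = "\<lambda>j. (\<lambda>\<omega>. card (P \<omega> \<inter> A j)) -` {k j} \<inter> space M"
  have EF: "E = (\<Inter>j\<in>J. ?F j)"
  proof -
    have "(\<forall>i\<in>I. card (P \<omega> \<inter> R i) = 1) \<longleftrightarrow> (\<forall>j\<in>{1..m}. card (P \<omega> \<inter> R (e j)) = 1)" for \<omega>
      using e unfolding bij_betw_def by blast
    then show ?thesis unfolding E_def J(1) by (auto simp: A_def k_def)
  qed
  have F: "?F j \<in> events" if "j \<in> J" for j
    using measurable_sets[OF count_law(2)[OF A(1)[OF that] fin[OF that that]], of "{k j}"] by simp
  show E: "E \<in> events" unfolding EF using J F by (intro sets.finite_INT) auto
  have "prob E = (\<Prod>j\<in>J. prob (?F j))"
    unfolding EF by (rule indep_varsD_finite[OF ind J(3,2)]) auto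
  also have "\<dots> = (\<Prod>j\<in>J. measure lborel (A j) ^ k j * exp (- measure lborel (A j)))"
  proof (rule prod.cong[OF refl])
    fix j assume j: "j \<in> J"
    have "?F j = {\<omega>\<in>space M. card (P \<omega> \<inter> A j) = k j}" by auto
    moreover have "measure uv_intensity (A j) = measure lborel (A j)"
      unfolding measure_def emeasure_uv_cone(1)[OF A[OF j]] ..
    moreover have "(fact (k j) :: real) = 1" unfolding k_def by simp
    ultimately show "prob (?F j) = measure lborel (A j) ^ k j * exp (- measure lborel (A j))"
      using count_law(3)[OF A(1)[OF j] fin[OF j j], of "k j"] by simp
  qed
  also have "\<dots> = (\<Prod>j\<in>J. measure lborel (A j) ^ k j) * exp (- (\<Sum>j\<in>J. measure lborel (A j)))"
    using J(2) by (simp add: prod.distrib exp_sum[symmetric] sum_negf[symmetric])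
  also have "(\<Prod>j\<in>J. measure lborel (A j) ^ k j) = (\<Prod>i\<in>I. measure lborel (R i))"
  proof -
    have "(\<Prod>j\<in>J. measure lborel (A j) ^ k j) = (\<Prod>j\<in>{1..m}. measure lborel (R (e j)))"
      unfolding J(1) by (simp add: k_def A_def)
    also have "\<dots> = (\<Prod>i\<in>I. measure lborel (R i))" by (rule prod.reindex_bij_betw[OF e])
    finally show ?thesis .
  qed
  also have "(\<Sum>j\<in>J. measure lborel (A j)) = 2 * t\<^sup>2"
  proof -
    have finl: "emeasure lborel (A j) \<noteq> \<infinity>" if "j \<in> J" for j
      using fin[OF that that] emeasure_uv_cone(1)[OF A[OF that]] by simp
    have "(\<Sum>j\<in>J. measure lborel (A j)) = measure lborel (\<Union>j\<in>J. A j)"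
      using J(2) A(1) disj finl by (intro measure_finite_Union[symmetric]) auto
    also have "(\<Union>j\<in>J. A j) = past_cone t"
    proof
      show "(\<Union>j\<in>J. A j) \<subseteq> past_cone t" using A(2) by blast
      show "past_cone t \<subseteq> (\<Union>j\<in>J. A j)"
      proof
        fix p assume p: "p \<in> past_cone t"
        show "p \<in> (\<Union>j\<in>J. A j)"
        proof (cases "p \<in> (\<Union>i\<in>I. R i)")
          case True
          then obtain j where "j \<in> {1..m}" "p \<in> R (e j)" using e unfolding bij_betw_def by blast
          then show ?thesis unfolding J(1) A_def by (intro UN_I[of j]) auto
        qed (use p in \<open>auto simp: A_def J(1)\<close>)
      qed
    qed
    also have "measure lborel (past_cone t) = 2 * t\<^sup>2" unfolding measure_def emeasure_cone[OF t] by simp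
    finally show ?thesis .
  qed
  finally have "emeasure M E = ennreal (\<Prod>i\<in>I. measure lborel (R i)) * ennreal (exp (- (2 * t\<^sup>2)))"
    unfolding emeasure_eq_measure by (simp add: ennreal_mult prod_nonneg)
  also have "ennreal (\<Prod>i\<in>I. measure lborel (R i)) = (\<Prod>i\<in>I. emeasure lborel (R i))"
  proof -
    have "emeasure lborel (R i) = ennreal (measure lborel (R i))" if "i \<in> I" for i
      using emeasure_uv_cone[of "R i" t] I(3)[OF that] by (intro emeasure_eq_ennreal_measure) auto
    then show ?thesis by (simp add: prod_ennreal)
  qed
  finally show "emeasure M E = ennreal (exp (- (2 * t\<^sup>2))) * (\<Prod>i\<in>I. emeasure lborel (R i))" by (simp only: mult.commute)
qed

end

section \<open>Total mass and the law of the evolution\<close>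

text \<open>Sorting by the number \<open>card (up_index n)\<close> of up-steps and dividing
  \<open>size_mass\<close> by \<open>m!\<close> gives the exponential series.\<close>

lemma w_mass_Gamma:
  assumes t: "t \<ge> 0"
  shows "w_mass (Gamma t) = ennreal (exp (2 * t\<^sup>2))"
proof -
  let ?L = "\<lambda>n. emeasure (step_lebesgue n) (slice n (Gamma t))"
  let ?e = "\<lambda>m n. (if card (up_index n) = m then 1 else 0 :: ennreal)"
  have size: "(\<integral>\<^sup>+n. ?e m n * ?L n \<partial>count_space step_numbers) = ennreal ((2 * t\<^sup>2) ^ m / fact m)" for m
  proof -
    have fact: "(fact m :: ennreal) = ennreal (fact m)"
      by (metis ennreal_of_nat_eq_real_of_nat of_nat_fact)
    have "ennreal (fact m) * (\<integral>\<^sup>+n. ?e m n * ?L n \<partial>count_space step_numbers) =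
        (\<integral>\<^sup>+n. ennreal (fact m) * (?e m n * ?L n) \<partial>count_space step_numbers)"
      by (rule nn_integral_cmult[symmetric]) simp
    also have "\<dots> = (\<integral>\<^sup>+n. (if card (up_index n) = m then fact m else 0) * ?L n \<partial>count_space step_numbers)"
      unfolding fact by (intro nn_integral_cong) simp
    also have "\<dots> = ennreal ((2 * t\<^sup>2) ^ m)" by (rule size_mass[OF t])
    also have "\<dots> = ennreal (fact m) * ennreal ((2 * t\<^sup>2) ^ m / fact m)"
      by (simp add: ennreal_mult[symmetric])
    finally show ?thesis by (simp add: ennreal_mult_cancel_left)
  qed
  have "w_mass (Gamma t) = (\<integral>\<^sup>+n. (\<Sum>m. ?e m n * ?L n) \<partial>count_space step_numbers)"
    unfolding w_mass_def
  proof (rule nn_integral_cong)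
    fix n :: "nat \<Rightarrow> nat"
    have "(\<lambda>m. ?e m n * ?L n) sums (\<Sum>m\<in>{card (up_index n)}. ?e m n * ?L n)" by (rule sums_finite) auto
    then show "?L n = (\<Sum>m. ?e m n * ?L n)" by (simp add: sums_iff)
  qed
  also have "\<dots> = (\<Sum>m. \<integral>\<^sup>+n. ?e m n * ?L n \<partial>count_space step_numbers)"
    by (rule nn_integral_suminf) simp
  also have "\<dots> = (\<Sum>m. ennreal ((2 * t\<^sup>2) ^ m / fact m))" unfolding size ..
  also have "\<dots> = ennreal (exp (2 * t\<^sup>2))"
  proof (rule sums_unique[symmetric])
    have "(\<lambda>m. (2 * t\<^sup>2) ^ m / fact m) sums exp (2 * t\<^sup>2)"
      using exp_converges[of "2 * t\<^sup>2"] by (simp add: field_simps)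
    then show "(\<lambda>m. ennreal ((2 * t\<^sup>2) ^ m / fact m)) sums ennreal (exp (2 * t\<^sup>2))"
      using t by (subst sums_ennreal) auto
  qed
  finally show ?thesis .
qed

lemma emeasure_w_space: "t \<ge> 0 \<Longrightarrow> emeasure (w t) (space (w t)) = ennreal (exp (2 * t\<^sup>2))"
  unfolding space_w by (simp add: emeasure_w[OF Gamma_w_sets] w_mass_Gamma)

lemma inverse_Z:
  assumes "t \<ge> 0"
  shows "inverse (Z t) = ennreal (exp (- (2 * t\<^sup>2)))"
  unfolding Z_def emeasure_w_space[OF assms] by (simp add: inverse_ennreal exp_minus)

lemma sets_mu: "sets (mu t) = w_sets t"
  unfolding mu_def by (simp add: sets_w)

lemma space_mu: "space (mu t) = Gamma t"
  using sets_eq_imp_space_eq[of "mu t" "w t"] by (simp add: sets_mu sets_w space_w)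

lemma emeasure_mu:
  assumes "t \<ge> 0" "A \<in> w_sets t"
  shows "emeasure (mu t) A = ennreal (exp (- (2 * t\<^sup>2))) * w_mass A"
  unfolding mu_def using assms by (simp add: emeasure_scale_measure inverse_Z emeasure_w)

lemma emeasure_mu_Gamma:
  assumes "t \<ge> 0"
  shows "emeasure (mu t) (Gamma t) = 1"
  unfolding emeasure_mu[OF assms Gamma_w_sets] w_mass_Gamma[OF assms]
  by (simp add: ennreal_mult[symmetric] exp_minus)

lemma prob_space_mu: "t \<ge> 0 \<Longrightarrow> prob_space (mu t)"
  by (intro prob_spaceI) (simp add: space_mu emeasure_mu_Gamma)

context uv_process
begin

lemma step_map_law:
  assumes t: "t \<ge> 0"
  obtains X where "X \<in> measurable M (mu t)" "AE \<omega> in M. X \<omega> = step_map (rsk_lines (P \<omega>) t)" "distr M (mu t) X = mu t"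
proof -
  obtain N0 where N0: "N0 \<in> null_sets M" and goodP: "\<And>\<omega>. \<omega> \<in> space M - N0 \<Longrightarrow> good (P \<omega>) \<and> finite (P \<omega> \<inter> past_cone t)"
    using AE_E3[OF AE_conjI[OF AE_good count_law(1)[OF cone_sets emeasure_uv_cone(2)[OF cone_sets order_refl]]]] by metis
  have N0s: "N0 \<in> events" "N0 \<subseteq> space M" using N0 sets.sets_into_space by blast+
  \<comment> \<open>On the null set \<open>N0\<close> the points are replaced by the empty set, so
    that they are good everywhere.\<close>
  define P' where "P' \<omega> = (if \<omega> \<in> N0 then {} else P \<omega>)" for \<omega>
  have good': "good (P' \<omega>)" if "\<omega> \<in> space M" for \<omega>
    using goodP that good_empty unfolding P'_def by auto
  define c :: "nat \<Rightarrow> ennreal" where "c m = ennreal (exp (- (2 * t\<^sup>2)))" for m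
  have law: "matching_law M P' t c" unfolding matching_law_def
  proof (intro conjI ballI good' allI impI, assumption)
    fix I :: "step_index set" and R
    assume IR: "finite I \<and> disjoint_family_on R I \<and> (\<forall>i\<in>I. R i \<in> sets borel \<and> R i \<subseteq> past_cone t)"
    define E where "E = {\<omega>\<in>space M. (\<forall>i\<in>I. card (P' \<omega> \<inter> R i) = 1) \<and> P' \<omega> \<inter> past t \<subseteq> (\<Union>i\<in>I. R i)}"
    define E' where "E' = {\<omega>\<in>space M. (\<forall>i\<in>I. card (P \<omega> \<inter> R i) = 1) \<and> card (P \<omega> \<inter> (past_cone t - (\<Union>i\<in>I. R i))) = 0}"
    have E': "E' \<in> events" "emeasure M E' = c (card I) * (\<Prod>i\<in>I. emeasure lborel (R i))"
      unfolding E'_def c_def using IR by (intro matching_event[OF t]; blast)+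
    have iff: "\<omega> \<in> E \<longleftrightarrow> \<omega> \<in> E'" if \<omega>: "\<omega> \<in> space M - N0" for \<omega>
    proof -
      have P': "P' \<omega> = P \<omega>" using \<omega> unfolding P'_def by simp
      have "P \<omega> \<inter> past t = P \<omega> \<inter> past_cone t" using goodP[OF \<omega>] unfolding good_def past_cone_def by blast
      then have "P \<omega> \<inter> past t \<subseteq> (\<Union>i\<in>I. R i) \<longleftrightarrow> P \<omega> \<inter> (past_cone t - (\<Union>i\<in>I. R i)) = {}" by blast
      also have "\<dots> \<longleftrightarrow> card (P \<omega> \<inter> (past_cone t - (\<Union>i\<in>I. R i))) = 0"
      proof -
        have "finite (P \<omega> \<inter> (past_cone t - (\<Union>i\<in>I. R i)))"
          by (rule finite_subset[of _ "P \<omega> \<inter> past_cone t"]) (use goodP[OF \<omega>] in auto)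
        then show ?thesis by simp
      qed
      finally show ?thesis unfolding E_def E'_def mem_Collect_eq P' by blast
    qed
    have EN: "E \<inter> N0 = (if I = {} then N0 else {})"
      using N0s(2) unfolding E_def P'_def by auto
    have "E = (E' - N0) \<union> (if I = {} then N0 else {})"
    proof -
      have "E = (E - N0) \<union> (E \<inter> N0)" by blast
      also have "E - N0 = E' - N0" using iff unfolding E_def E'_def by blast
      finally show ?thesis unfolding EN .
    qed
    then have setsE: "E \<in> events" using E'(1) N0s(1) by auto
    have "emeasure M E = emeasure M E'"
    proof (rule emeasure_eq_AE[OF _ setsE E'(1)])
      have "AE \<omega> in M. \<omega> \<notin> N0" by (rule AE_not_in[OF N0])
      with AE_space show "AE \<omega> in M. (\<omega> \<in> E) = (\<omega> \<in> E')" by eventually_elim (use iff in blast)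
    qed
    then show "{\<omega>\<in>space M. (\<forall>i\<in>I. card (P' \<omega> \<inter> R i) = 1) \<and> P' \<omega> \<inter> past t \<subseteq> (\<Union>i\<in>I. R i)} \<in> events"
      "emeasure M {\<omega>\<in>space M. (\<forall>i\<in>I. card (P' \<omega> \<inter> R i) = 1) \<and> P' \<omega> \<inter> past t \<subseteq> (\<Union>i\<in>I. R i)} =
        c (card I) * (\<Prod>i\<in>I. emeasure lborel (R i))"
      using setsE E'(2) unfolding E_def by simp_all
  qed
  define \<Phi> where "\<Phi> \<omega> = step_map (rsk_lines (P' \<omega>) t)" for \<omega>
  have \<Phi>Gam: "\<Phi> \<omega> \<in> Gamma t" if "\<omega> \<in> space M" for \<omega>
    unfolding \<Phi>_def Gamma_def by (intro imageI rsk_lines_Lambda good' that)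
  have cfin: "c m \<noteq> \<infinity>" for m unfolding c_def by simp
  have \<Phi>: "{\<omega>\<in>space M. \<Phi> \<omega> \<in> A \<inter> regular t} \<in> events"
    "emeasure M {\<omega>\<in>space M. \<Phi> \<omega> \<in> A \<inter> regular t} = emeasure (mu t) A" if A: "A \<in> w_sets t" for A
  proof -
    show "{\<omega>\<in>space M. \<Phi> \<omega> \<in> A \<inter> regular t} \<in> events" unfolding \<Phi>_def by (rule law_total(1)[OF law cfin A])
    have "emeasure M {\<omega>\<in>space M. \<Phi> \<omega> \<in> A \<inter> regular t} =
        (\<integral>\<^sup>+n. ennreal (exp (- (2 * t\<^sup>2))) * emeasure (step_lebesgue n) (slice n A) \<partial>count_space step_numbers)"
      unfolding \<Phi>_def law_total(2)[OF law cfin A] c_def ..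
    also have "\<dots> = ennreal (exp (- (2 * t\<^sup>2))) * w_mass A" unfolding w_mass_def by (rule nn_integral_cmult) simp
    finally show "emeasure M {\<omega>\<in>space M. \<Phi> \<omega> \<in> A \<inter> regular t} = emeasure (mu t) A" using emeasure_mu[OF t A] by simp
  qed
  \<comment> \<open>Regularity follows from the total mass: the part of the law carried by regular
    configurations has the mass of \<open>mu t\<close>, which is 1.\<close>
  have "prob {\<omega>\<in>space M. \<Phi> \<omega> \<in> Gamma t \<inter> regular t} = 1"
    using \<Phi>(2)[OF Gamma_w_sets] emeasure_mu_Gamma[OF t] unfolding measure_def by simp
  then have "AE \<omega> in M. \<omega> \<in> {\<omega>\<in>space M. \<Phi> \<omega> \<in> Gamma t \<inter> regular t}"
    using \<Phi>(1)[OF Gamma_w_sets] by (subst (asm) prob_eq_1) auto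
  then have reg: "AE \<omega> in M. \<Phi> \<omega> \<in> regular t" by eventually_elim auto
  define x0 where "x0 = step_map (rsk_lines {} t)"
  have x0: "x0 \<in> Gamma t" unfolding x0_def Gamma_def by (intro imageI rsk_lines_Lambda good_empty)
  \<comment> \<open>Irregular configurations are replaced by the flat one, since preimages are known
    to be events only within \<open>regular t\<close>.\<close>
  define X where "X \<omega> = (if \<Phi> \<omega> \<in> regular t then \<Phi> \<omega> else x0)" for \<omega>
  have X: "X \<in> measurable M (mu t)"
  proof (rule measurableI)
    show "X \<omega> \<in> space (mu t)" if "\<omega> \<in> space M" for \<omega> using \<Phi>Gam[OF that] x0 unfolding X_def space_mu by simp
    fix A assume "A \<in> sets (mu t)"
    then have A: "A \<in> w_sets t" unfolding sets_mu .
    have "X -` A \<inter> space M = {\<omega>\<in>space M. \<Phi> \<omega> \<in> A \<inter> regular t} \<union>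
        (if x0 \<in> A then space M - {\<omega>\<in>space M. \<Phi> \<omega> \<in> Gamma t \<inter> regular t} else {})"
      using \<Phi>Gam unfolding X_def by (auto split: if_splits)
    also have "\<dots> \<in> events" using \<Phi>(1)[OF A] \<Phi>(1)[OF Gamma_w_sets] by auto
    finally show "X -` A \<inter> space M \<in> events" .
  qed
  have XP: "AE \<omega> in M. X \<omega> = step_map (rsk_lines (P \<omega>) t)"
    using reg AE_not_in[OF N0] by eventually_elim (simp add: X_def \<Phi>_def P'_def)
  have "distr M (mu t) X = mu t"
  proof (rule measure_eqI)
    fix A assume A': "A \<in> sets (distr M (mu t) X)"
    then have A: "A \<in> w_sets t" by (simp add: sets_mu)
    have "emeasure (distr M (mu t) X) A = emeasure M (X -` A \<inter> space M)"
      using X A' by (intro emeasure_distr) auto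
    also have "\<dots> = emeasure M {\<omega>\<in>space M. \<Phi> \<omega> \<in> A \<inter> regular t}"
    proof (rule emeasure_eq_AE)
      show "AE \<omega> in M. (\<omega> \<in> X -` A \<inter> space M) = (\<omega> \<in> {\<omega>\<in>space M. \<Phi> \<omega> \<in> A \<inter> regular t})"
        using reg by eventually_elim (auto simp: X_def)
      show "X -` A \<inter> space M \<in> events" using X A' by (intro measurable_sets) auto
    qed (rule \<Phi>(1)[OF A])
    also have "\<dots> = emeasure (mu t) A" by (rule \<Phi>(2)[OF A])
    finally show "emeasure (distr M (mu t) X) A = emeasure (mu t) A" .
  qed simp
  then show thesis using that X XP by blast
qed

end

theorem theorem2p1:
  fixes t :: real
  assumes "t \<ge> 0"
  shows "emeasure (w t) (space (w t)) = ennreal (exp (2 * t ^ 2)) \<and>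
    prob_space (mu t) \<and>
    (\<forall>(M :: 'a measure) (N :: 'a \<Rightarrow> (real \<times> real) set).
       prob_space M \<and> poisson_point_process M nucleation_intensity N \<longrightarrow>
         (AE \<omega> in M. \<exists>h. rsk_evolution (N \<omega>) h) \<and>
         (\<forall>h :: 'a \<Rightarrow> real \<Rightarrow> line_config.
            (AE \<omega> in M. rsk_evolution (N \<omega>) (h \<omega>)) \<longrightarrow>
              (AE \<omega> in M. h \<omega> t \<in> Lambda t) \<and>
              (\<exists>X \<in> measurable M (mu t).
                 (AE \<omega> in M. X \<omega> = step_map (h \<omega> t)) \<and> distr M (mu t) X = mu t)))"
proof (intro conjI allI impI)
  show "emeasure (w t) (space (w t)) = ennreal (exp (2 * t ^ 2))" by (rule emeasure_w_space[OF assms])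
  show "prob_space (mu t)" by (rule prob_space_mu[OF assms])
  fix M :: "'a measure" and N :: "'a \<Rightarrow> (real \<times> real) set"
  assume MN: "prob_space M \<and> poisson_point_process M nucleation_intensity N"
  define P where "P \<omega> = light_cone ` N \<omega>" for \<omega>
  interpret uv_process M P
    unfolding uv_process_def uv_process_axioms_def P_def using MN poisson_uv by blast
  show "AE \<omega> in M. \<exists>h. rsk_evolution (N \<omega>) h"
    using AE_good unfolding P_def by eventually_elim (blast intro: rsk_evolution_rsk_lines)
  fix h :: "'a \<Rightarrow> real \<Rightarrow> line_config"
  assume h: "AE \<omega> in M. rsk_evolution (N \<omega>) (h \<omega>)"
  \<comment> \<open>Whatever evolution \<open>h\<close> is chosen, it is almost surely the one built
    from longest chains.\<close>
  have eq: "AE \<omega> in M. h \<omega> t = rsk_lines (P \<omega>) t"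
    using h AE_good unfolding P_def by eventually_elim (rule rsk_evolution_unique[OF _ _ assms])
  show "AE \<omega> in M. h \<omega> t \<in> Lambda t"
    using eq AE_good by eventually_elim (simp add: rsk_lines_Lambda)
  obtain X where X: "X \<in> measurable M (mu t)" "AE \<omega> in M. X \<omega> = step_map (rsk_lines (P \<omega>) t)" "distr M (mu t) X = mu t"
    by (rule step_map_law[OF assms])
  have "AE \<omega> in M. X \<omega> = step_map (h \<omega> t)" using eq X(2) by eventually_elim simp
  then show "\<exists>X \<in> measurable M (mu t). (AE \<omega> in M. X \<omega> = step_map (h \<omega> t)) \<and> distr M (mu t) X = mu t"
    using X(1,3) by blast
qed

end
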